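(* Let $\mathcal{A}=\mathcal{A}_n^{\bar q,\Lambda}(\mathbb{K})$ and suppose $q_1^{i_1}\cdots q_n^{i_n}=1$ ($i_k\in\mathbb{Z}$) implies $i_1=\cdots=i_n=0$. (1) For every $\mathbb{K}$-algebra automorphism $\varphi$ of $\mathcal{A}_{\mathcal{Z}}$ there exist a partition $\{1,\dots,n\}=P_1\cup P_2$, integers $c_k$ ($1\le k\le n$), integers $a_{ij}$ and $b_{ji}$ ($i\in P_1$, $j\in P_2$), and scalars $\alpha_k,\beta_k\in\mathbb{K}^*$ ($1\le k\le n$) such that for $i\in P_1$: $\varphi(x_i)=\alpha_i\big(\prod_{j\in P_2}z_j^{a_{ij}}\big)z_i^{c_i}x_i$, $\varphi(y_i)=\beta_i\big(\prod_{j\in P_2}z_j^{-a_{ij}}\big)z_i^{-c_i}y_i$, with $\alpha_i\beta_i=q_i^{c_i}$; for $j\in P_2$: $\varphi(x_j)=\alpha_j\big(\prod_{i\in P_1}z_i^{b_{ji}}\big)z_j^{c_j}y_j$, $\varphi(y_j)=\beta_j\big(\prod_{i\in P_1}z_i^{-b_{ji}}\big)z_j^{-c_j-1}x_j$, with $\alpha_j\beta_j=-q_j^{-c_j-1}$; and $q_i^{b_{ji}}q_j^{a_{ij}}=\lambda_{ij}^2$ for all $i\in P_1$, $j\in P_2$. (2) Conversely, for any partition $P_1\cup P_2$ and any integers and scalars satisfying these conditions, the formulas above extend to a $\mathbb{K}$-algebra automorphism of $\mathcal{A}_{\mathcal{Z}}$.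
   Context: Let $\mathbb{K}$ be a field, $n\ge 1$, $\bar q=(q_1,\dots,q_n)\in(\mathbb{K}^* )^n$, and $\Lambda=(\lambda_{ij})$ an $n\times n$ matrix over $\mathbb{K}^*$ with $\lambda_{ij}=\lambda_{ji}^{-1}$, $\lambda_{ii}=1$. $\mathcal{A}_n^{\bar q,\Lambda}(\mathbb{K})$ is the $\mathbb{K}$-algebra generated by $x_1,y_1,\dots,x_n,y_n$ with relations: for $1\le i<j\le n$, $x_ix_j=\lambda_{ij}x_jx_i$, $y_jy_i=\lambda_{ji}y_iy_j$, $x_iy_j=\lambda_{ji}y_jx_i$, $x_jy_i=\lambda_{ij}y_ix_j$; and $x_iy_i-q_iy_ix_i=1$ for all $i$. Put $z_i=x_iy_i-y_ix_i$; these are pairwise commuting normal elements ($z_iy_i=q_iy_iz_i$, $z_ix_i=q_i^{-1}x_iz_i$, $z_i$ commutes with $x_j,y_j$ for $j\ne i$). $\mathcal{Z}$ is the multiplicative submonoid generated by $z_1,\dots,z_n$ (an Ore set) and $\mathcal{A}_{\mathcal{Z}}$ the localization of $\mathcal{A}$ at $\mathcal{Z}$, in which the $z_i$ are invertible. *)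

theory Defs
  imports Main
begin

text \<open>Generators: GX i = x_i, GY i = y_i, GW i = w_i (w_i plays the role of z_i^{-1}
  in the localization A_Z, which we present as the algebra obtained from A by adjoining
  two-sided inverses of z_1..z_n; since Z is an Ore set, the Ore localization coincides
  with this universal Z-inverting algebra).\<close>

datatype gen = GX nat | GY nat | GW nat

fun gen_idx :: "gen \<Rightarrow> nat" where
  "gen_idx (GX i) = i" | "gen_idx (GY i) = i" | "gen_idx (GW i) = i"

type_synonym 'k fa = "gen list \<Rightarrow> 'k"

definition fa_valid :: "nat \<Rightarrow> 'k::field fa \<Rightarrow> bool" where
  "fa_valid n f \<longleftrightarrow> finite {w. f w \<noteq> 0} \<and>
     (\<forall>w. f w \<noteq> 0 \<longrightarrow> (\<forall>g\<in>set w. gen_idx g \<in> {1..n}))"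

definition fa_zero :: "'k::field fa" where "fa_zero = (\<lambda>_. 0)"
definition fa_one :: "'k::field fa" where "fa_one = (\<lambda>w. if w = [] then 1 else 0)"
definition fa_gen :: "gen \<Rightarrow> 'k::field fa" where "fa_gen g = (\<lambda>w. if w = [g] then 1 else 0)"
definition fa_add :: "'k::field fa \<Rightarrow> 'k fa \<Rightarrow> 'k fa" where "fa_add f g = (\<lambda>w. f w + g w)"
definition fa_sub :: "'k::field fa \<Rightarrow> 'k fa \<Rightarrow> 'k fa" where "fa_sub f g = (\<lambda>w. f w - g w)"
definition fa_smult :: "'k::field \<Rightarrow> 'k fa \<Rightarrow> 'k fa" where "fa_smult c f = (\<lambda>w. c * f w)"
definition fa_mult :: "'k::field fa \<Rightarrow> 'k fa \<Rightarrow> 'k fa" where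
  "fa_mult f g = (\<lambda>w. \<Sum>k\<le>length w. f (take k w) * g (drop k w))"

fun fa_pow :: "'k::field fa \<Rightarrow> nat \<Rightarrow> 'k fa" where
  "fa_pow f 0 = fa_one"
| "fa_pow f (Suc m) = fa_mult f (fa_pow f m)"

abbreviation X :: "nat \<Rightarrow> 'k::field fa" where "X i \<equiv> fa_gen (GX i)"
abbreviation Y :: "nat \<Rightarrow> 'k::field fa" where "Y i \<equiv> fa_gen (GY i)"
abbreviation W :: "nat \<Rightarrow> 'k::field fa" where "W i \<equiv> fa_gen (GW i)"

definition Z :: "nat \<Rightarrow> 'k::field fa" where
  "Z i = fa_sub (fa_mult (X i) (Y i)) (fa_mult (Y i) (X i))"

definition zpow :: "nat \<Rightarrow> int \<Rightarrow> 'k::field fa" where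
  "zpow i k = (if k \<ge> 0 then fa_pow (Z i) (nat k) else fa_pow (W i) (nat (- k)))"

text \<open>Product over j in a finite set P of z_j^(e j), in increasing order of j
  (the z_j commute in A_Z, so the order is immaterial there).\<close>
definition zprod :: "nat set \<Rightarrow> (nat \<Rightarrow> int) \<Rightarrow> 'k::field fa" where
  "zprod P e = foldr (\<lambda>j acc. fa_mult (zpow j (e j)) acc) (sorted_list_of_set P) fa_one"

definition fa_rels :: "nat \<Rightarrow> (nat \<Rightarrow> 'k::field) \<Rightarrow> (nat \<Rightarrow> nat \<Rightarrow> 'k) \<Rightarrow> 'k fa set" where
  "fa_rels n q lam =
     {fa_sub (fa_mult (X i) (X j)) (fa_smult (lam i j) (fa_mult (X j) (X i))) | i j. 1 \<le> i \<and> i < j \<and> j \<le> n}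
   \<union> {fa_sub (fa_mult (Y j) (Y i)) (fa_smult (lam j i) (fa_mult (Y i) (Y j))) | i j. 1 \<le> i \<and> i < j \<and> j \<le> n}
   \<union> {fa_sub (fa_mult (X i) (Y j)) (fa_smult (lam j i) (fa_mult (Y j) (X i))) | i j. 1 \<le> i \<and> i < j \<and> j \<le> n}
   \<union> {fa_sub (fa_mult (X j) (Y i)) (fa_smult (lam i j) (fa_mult (Y i) (X j))) | i j. 1 \<le> i \<and> i < j \<and> j \<le> n}
   \<union> {fa_sub (fa_sub (fa_mult (X i) (Y i)) (fa_smult (q i) (fa_mult (Y i) (X i)))) fa_one | i. 1 \<le> i \<and> i \<le> n}
   \<union> {fa_sub (fa_mult (W i) (Z i)) fa_one | i. 1 \<le> i \<and> i \<le> n}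
   \<union> {fa_sub (fa_mult (Z i) (W i)) fa_one | i. 1 \<le> i \<and> i \<le> n}"

inductive_set fa_ideal :: "nat \<Rightarrow> (nat \<Rightarrow> 'k::field) \<Rightarrow> (nat \<Rightarrow> nat \<Rightarrow> 'k) \<Rightarrow> 'k fa set"
  for n q lam where
  rel: "r \<in> fa_rels n q lam \<Longrightarrow> r \<in> fa_ideal n q lam"
| zero: "fa_zero \<in> fa_ideal n q lam"
| add: "a \<in> fa_ideal n q lam \<Longrightarrow> b \<in> fa_ideal n q lam \<Longrightarrow> fa_add a b \<in> fa_ideal n q lam"
| mult: "a \<in> fa_ideal n q lam \<Longrightarrow> fa_valid n u \<Longrightarrow> fa_valid n v \<Longrightarrow>
         fa_mult (fa_mult u a) v \<in> fa_ideal n q lam"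

definition fa_cong :: "nat \<Rightarrow> (nat \<Rightarrow> 'k::field) \<Rightarrow> (nat \<Rightarrow> nat \<Rightarrow> 'k) \<Rightarrow> 'k fa \<Rightarrow> 'k fa \<Rightarrow> bool" where
  "fa_cong n q lam a b \<longleftrightarrow> fa_sub a b \<in> fa_ideal n q lam"

text \<open>phi (a map on representatives) induces a K-algebra automorphism of A_Z.\<close>
definition is_AZ_auto :: "nat \<Rightarrow> (nat \<Rightarrow> 'k::field) \<Rightarrow> (nat \<Rightarrow> nat \<Rightarrow> 'k) \<Rightarrow> ('k fa \<Rightarrow> 'k fa) \<Rightarrow> bool" where
  "is_AZ_auto n q lam \<phi> \<longleftrightarrow>
     (\<forall>a. fa_valid n a \<longrightarrow> fa_valid n (\<phi> a)) \<and>
     (\<forall>a b. fa_valid n a \<and> fa_valid n b \<and> fa_cong n q lam a b \<longrightarrow> fa_cong n q lam (\<phi> a) (\<phi> b)) \<and>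
     (\<forall>a b. fa_valid n a \<and> fa_valid n b \<longrightarrow> fa_cong n q lam (\<phi> (fa_add a b)) (fa_add (\<phi> a) (\<phi> b))) \<and>
     (\<forall>c a. fa_valid n a \<longrightarrow> fa_cong n q lam (\<phi> (fa_smult c a)) (fa_smult c (\<phi> a))) \<and>
     (\<forall>a b. fa_valid n a \<and> fa_valid n b \<longrightarrow> fa_cong n q lam (\<phi> (fa_mult a b)) (fa_mult (\<phi> a) (\<phi> b))) \<and>
     fa_cong n q lam (\<phi> fa_one) fa_one \<and>
     (\<forall>a b. fa_valid n a \<and> fa_valid n b \<and> fa_cong n q lam (\<phi> a) (\<phi> b) \<longrightarrow> fa_cong n q lam a b) \<and>
     (\<forall>b. fa_valid n b \<longrightarrow> (\<exists>a. fa_valid n a \<and> fa_cong n q lam (\<phi> a) b))"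

definition auto_shape ::
  "nat \<Rightarrow> (nat \<Rightarrow> 'k::field) \<Rightarrow> (nat \<Rightarrow> nat \<Rightarrow> 'k) \<Rightarrow> ('k fa \<Rightarrow> 'k fa) \<Rightarrow>
   nat set \<Rightarrow> nat set \<Rightarrow> (nat \<Rightarrow> int) \<Rightarrow> (nat \<Rightarrow> nat \<Rightarrow> int) \<Rightarrow> (nat \<Rightarrow> nat \<Rightarrow> int) \<Rightarrow>
   (nat \<Rightarrow> 'k) \<Rightarrow> (nat \<Rightarrow> 'k) \<Rightarrow> bool" where
  "auto_shape n q lam \<phi> P1 P2 c a b \<alpha> \<beta> \<longleftrightarrow>
     (\<forall>i\<in>P1.
        fa_cong n q lam (\<phi> (X i))
          (fa_smult (\<alpha> i) (fa_mult (fa_mult (zprod P2 (\<lambda>j. a i j)) (zpow i (c i))) (X i))) \<and>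
        fa_cong n q lam (\<phi> (Y i))
          (fa_smult (\<beta> i) (fa_mult (fa_mult (zprod P2 (\<lambda>j. - a i j)) (zpow i (- c i))) (Y i)))) \<and>
     (\<forall>j\<in>P2.
        fa_cong n q lam (\<phi> (X j))
          (fa_smult (\<alpha> j) (fa_mult (fa_mult (zprod P1 (\<lambda>i. b j i)) (zpow j (c j))) (Y j))) \<and>
        fa_cong n q lam (\<phi> (Y j))
          (fa_smult (\<beta> j) (fa_mult (fa_mult (zprod P1 (\<lambda>i. - b j i)) (zpow j (- c j - 1))) (X j))))"

definition shape_params ::
  "nat \<Rightarrow> (nat \<Rightarrow> 'k::field) \<Rightarrow> (nat \<Rightarrow> nat \<Rightarrow> 'k) \<Rightarrow>
   nat set \<Rightarrow> nat set \<Rightarrow> (nat \<Rightarrow> int) \<Rightarrow> (nat \<Rightarrow> nat \<Rightarrow> int) \<Rightarrow> (nat \<Rightarrow> nat \<Rightarrow> int) \<Rightarrow>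
   (nat \<Rightarrow> 'k) \<Rightarrow> (nat \<Rightarrow> 'k) \<Rightarrow> bool" where
  "shape_params n q lam P1 P2 c a b \<alpha> \<beta> \<longleftrightarrow>
     P1 \<union> P2 = {1..n} \<and> P1 \<inter> P2 = {} \<and>
     (\<forall>k\<in>{1..n}. \<alpha> k \<noteq> 0 \<and> \<beta> k \<noteq> 0) \<and>
     (\<forall>i\<in>P1. \<alpha> i * \<beta> i = q i powi c i) \<and>
     (\<forall>j\<in>P2. \<alpha> j * \<beta> j = - (q j powi (- c j - 1))) \<and>
     (\<forall>i\<in>P1. \<forall>j\<in>P2. q i powi b j i * q j powi a i j = (lam i j)\<^sup>2)"

end

theory Submission
  imports Defs "HOL-Library.Function_Algebras" "HOL-Library.Multiset"
begin

text \<open>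
  The localized algebra embeds into the quantum torus with generators z_i, x_i and their inverses
  (z_i x_i = q_i^(-1) x_i z_i) by y_i = (z_i - 1) x_i^(-1) / (q_i - 1). Faithfulness: modulo shorter
  words all letters x_i, y_i, w_i commute up to scalars and w_i y_i x_i reduces to shorter words, and
  the remaining words have distinct leading monomials for a lexicographic order.

  The same order shows that units of the quantum torus are monomials; those that are units of the
  embedded algebra are monomials in the z_i alone. Hence an automorphism f maps each z_i to such a
  monomial, and comparing the commutation of f(z_i) and f(x_k) with the independence of the q_i
  yields f(z_i) = c z_i or c z_i^(-1), so that f(x_k) has degree 1 or -1 in x_k and degree 0 in
  the other x_j. As f preserves the commutative algebra of Laurent polynomials in the z_i (the
  centralizer of the z_i), f(x_k) is a unit of it times x_k or y_k. The relations then determine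
  all parameters. Conversely the formulas respect the relations, and the inverse has the same form.
\<close>

text \<open>The embedded algebra \<open>B\<close> is smaller than the torus: it contains x_k but not
  its inverse. What is said about units of \<open>B\<close> and about f(x_k) rests on telling which
  torus elements lie in \<open>B\<close>, and an image comes with no direct test. The test comes
  from modules. Let z_k act by q_k^m in height m; then x_k lowers the height and y_k raises it, and
  the step of y_k from height -1 to 0 carries the factor q_k^0 - 1 = 0. So the functions of negative
  height form a \<open>B\<close>-submodule \<open>U\<close> that the inverse of x_k does not
  preserve. Its invariance keeps monomials of negative x_k-degree out of \<open>B\<close> and makes
  an element of \<open>B\<close> of degree -1 in x_k and 0 in the other x_j a Laurent polynomial in
  the z_i times y_k.

  That the Laurent polynomial in f(x_k) is a unit uses the inverse automorphism: it has the same
  form, and composing both leaves a product equal to 1 in a domain. The parameters come from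
  comparing the two terms of f(y_k) f(x_k) = (f(z_k) - 1) / (q_k - 1) and the scalars of f(x_i)
  f(x_k).\<close>

notation fa_mult (infixl "\<star>" 70)
notation fa_smult (infixr "\<odot>" 75)

section \<open>The free algebra\<close>

lemma fa_add_eq: "fa_add a b = a + b"
  by (simp add: fa_add_def fun_eq_iff)

lemma fa_sub_eq: "fa_sub a b = a - b"
  by (simp add: fa_sub_def fun_eq_iff)

lemma fa_zero_eq: "fa_zero = 0"
  by (simp add: fa_zero_def fun_eq_iff)

lemma sum_fun_apply: "(\<Sum>a\<in>A. f a) x = (\<Sum>a\<in>A. f a x)"
  by (induction A rule: infinite_finite_induct) auto

lemma fa_mult_add_left: "(a + b) \<star> c = a \<star> c + b \<star> c"
  by (simp add: fa_mult_def fun_eq_iff distrib_right sum.distrib)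

lemma fa_mult_add_right: "c \<star> (a + b) = c \<star> a + c \<star> b"
  by (simp add: fa_mult_def fun_eq_iff distrib_left sum.distrib)

lemma fa_mult_diff_left: "(a - b) \<star> c = a \<star> c - b \<star> c"
  by (simp add: fa_mult_def fun_eq_iff left_diff_distrib sum_subtractf)

lemma fa_mult_diff_right: "c \<star> (a - b) = c \<star> a - c \<star> b"
  by (simp add: fa_mult_def fun_eq_iff right_diff_distrib sum_subtractf)

lemma fa_smult_mult_left: "(k \<odot> a) \<star> b = k \<odot> (a \<star> b)"
  by (simp add: fa_mult_def fa_smult_def fun_eq_iff sum_distrib_left mult.assoc)

lemma fa_smult_mult_right: "a \<star> (k \<odot> b) = k \<odot> (a \<star> b)"
  by (simp add: fa_mult_def fa_smult_def fun_eq_iff sum_distrib_left ac_simps)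

lemma fa_smult_add: "k \<odot> (a + b) = k \<odot> a + k \<odot> b"
  by (simp add: fa_smult_def fun_eq_iff distrib_left)

lemma fa_smult_diff: "k \<odot> (a - b) = k \<odot> a - k \<odot> b"
  by (simp add: fa_smult_def fun_eq_iff right_diff_distrib)

lemma fa_smult_smult: "k \<odot> l \<odot> a = (k * l) \<odot> a"
  by (simp add: fa_smult_def fun_eq_iff)

lemma fa_smult_one: "1 \<odot> a = a"
  by (simp add: fa_smult_def fun_eq_iff)

lemma fa_smult_uminus: "(- 1) \<odot> a = - a"
  by (simp add: fa_smult_def fun_eq_iff)

lemma fa_mult_zero: "0 \<star> a = 0" "a \<star> 0 = 0"
  by (simp_all add: fa_mult_def fun_eq_iff)

text \<open>Both sides are sums over two cut points j \<le> k of the word; the reindexing trades (k,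
  j) for (j, k - j). A word has finitely many cuts, so this is a law for arbitrary functions on
  words.\<close>

lemma fa_mult_assoc: "(f \<star> g) \<star> h = f \<star> (g \<star> h)"
proof
  fix w :: "gen list"
  let ?N = "length w"
  let ?a = "\<lambda>j k. f (take j w) * g (take (k - j) (drop j w)) * h (drop k w)"
  have "((f \<star> g) \<star> h) w = (\<Sum>k\<le>?N. \<Sum>j\<le>k. ?a j k)"
    unfolding fa_mult_def sum_distrib_right
    by (intro sum.cong refl) (auto simp: min_def drop_take)
  also have "\<dots> = (\<Sum>(k,j)\<in>(SIGMA k:{..?N}. {..k}). ?a j k)"
    by (simp add: sum.Sigma)
  also have "\<dots> = (\<Sum>(j,i)\<in>(SIGMA j:{..?N}. {..?N - j}). ?a j (j + i))"
    by (rule sum.reindex_bij_witness[where i = "\<lambda>(j,i). (j + i, j)" and j = "\<lambda>(k,j). (j, k - j)"]) auto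
  also have "\<dots> = (\<Sum>j\<le>?N. \<Sum>i\<le>?N - j. ?a j (j + i))"
    by (simp add: sum.Sigma)
  also have "\<dots> = (f \<star> (g \<star> h)) w"
    unfolding fa_mult_def sum_distrib_left
    by (intro sum.cong refl) (auto simp: mult.assoc add.commute)
  finally show "((f \<star> g) \<star> h) w = (f \<star> (g \<star> h)) w" .
qed

section \<open>Words as the basis of the free algebra\<close>

definition wd :: "gen list \<Rightarrow> 'k::field fa" where
  "wd u = (\<lambda>w. if w = u then 1 else 0)"

lemma wd_mult_left: "(wd u \<star> f) w = (if take (length u) w = u then f (drop (length u) w) else 0)"
proof -
  have "(wd u \<star> f) w = (\<Sum>k\<le>length w. if k = length u \<and> take (length u) w = u then f (drop (length u) w) else 0)"
    unfolding fa_mult_def wd_def by (intro sum.cong refl) (auto simp: min.absorb2)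
  also have "\<dots> = (if take (length u) w = u then f (drop (length u) w) else 0)"
  proof (cases "take (length u) w = u")
    case True
    then have "length u \<le> length w" by (metis length_take min.cobounded1)
    with True show ?thesis by simp
  qed simp
  finally show ?thesis .
qed

lemma fa_mult_wd: "wd u \<star> wd v = wd (u @ v)"
proof
  fix w
  have "take (length u) w = u \<and> drop (length u) w = v \<longleftrightarrow> w = u @ v"
    by (metis append_eq_conv_conj)
  then show "(wd u \<star> wd v) w = wd (u @ v) w"
    unfolding wd_mult_left by (auto simp: wd_def)
qed

lemma fa_gen_eq: "fa_gen g = wd [g]" by (simp add: fa_gen_def wd_def)
lemma fa_one_eq: "fa_one = wd []" by (simp add: fa_one_def wd_def)

lemma fa_mult_one_left: "fa_one \<star> f = f"
  by (simp add: fun_eq_iff fa_one_eq wd_mult_left)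

lemma fa_mult_one_right: "f \<star> fa_one = f"
proof
  fix w
  have "(f \<star> fa_one) w = (\<Sum>k\<le>length w. if k = length w then f w else 0)"
    unfolding fa_mult_def fa_one_def by (intro sum.cong refl) auto
  then show "(f \<star> fa_one) w = f w" by simp
qed

lemmas fa_ring = fa_mult_add_left fa_mult_add_right fa_mult_diff_left fa_mult_diff_right
  fa_smult_mult_left fa_smult_mult_right fa_smult_add fa_smult_diff fa_smult_smult fa_mult_assoc
  fa_mult_one_left fa_mult_one_right

lemma fa_expand:
  assumes "finite S" "\<And>w. f w \<noteq> 0 \<Longrightarrow> w \<in> S"
  shows "f = (\<Sum>w\<in>S. f w \<odot> wd w)"
proof
  fix v
  have "(\<Sum>w\<in>S. f w \<odot> wd w) v = (\<Sum>w\<in>S. if w = v then f v else 0)"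
    unfolding sum_fun_apply by (intro sum.cong refl) (auto simp: fa_smult_def wd_def)
  also have "\<dots> = f v" using assms by auto
  finally show "f v = (\<Sum>w\<in>S. f w \<odot> wd w) v" by simp
qed

section \<open>Closure properties of valid elements\<close>

definition word_ok :: "nat \<Rightarrow> gen list \<Rightarrow> bool" where
  "word_ok n w \<longleftrightarrow> (\<forall>g\<in>set w. gen_idx g \<in> {1..n})"

lemma fa_valid_iff: "fa_valid n f \<longleftrightarrow> finite {w. f w \<noteq> 0} \<and> (\<forall>w. f w \<noteq> 0 \<longrightarrow> word_ok n w)"
  by (simp add: fa_valid_def word_ok_def)

lemma word_ok_append: "word_ok n (u @ v) \<longleftrightarrow> word_ok n u \<and> word_ok n v"
  by (auto simp: word_ok_def)

lemma fa_valid_wd: "word_ok n w \<Longrightarrow> fa_valid n (wd w)"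
  by (auto simp: fa_valid_iff wd_def split: if_splits)

lemma fa_valid_add: "fa_valid n a \<Longrightarrow> fa_valid n b \<Longrightarrow> fa_valid n (a + b)"
  unfolding fa_valid_iff
  by (auto intro: finite_subset[of _ "{w. a w \<noteq> 0} \<union> {w. b w \<noteq> 0}"])
    (metis add.right_neutral)

lemma fa_valid_smult: "fa_valid n a \<Longrightarrow> fa_valid n (k \<odot> a)"
  unfolding fa_valid_iff fa_smult_def
  by (auto intro: finite_subset[of _ "{w. a w \<noteq> 0}"])

lemma fa_valid_diff: "fa_valid n a \<Longrightarrow> fa_valid n b \<Longrightarrow> fa_valid n (a - b)"
  using fa_valid_add[of n a "(-1) \<odot> b"] fa_valid_smult[of n b "-1"] by (simp add: fa_smult_uminus)

lemma fa_valid_zero: "fa_valid n 0" by (simp add: fa_valid_iff)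

lemma fa_mult_support: "(a \<star> b) w \<noteq> 0 \<Longrightarrow> \<exists>u v. w = u @ v \<and> a u \<noteq> 0 \<and> b v \<noteq> 0"
proof -
  assume "(a \<star> b) w \<noteq> 0"
  then obtain k where "a (take k w) * b (drop k w) \<noteq> 0"
    unfolding fa_mult_def by (meson sum.neutral)
  then show ?thesis by (intro exI[of _ "take k w"] exI[of _ "drop k w"]) auto
qed

lemma fa_valid_mult:
  assumes "fa_valid n a" "fa_valid n b"
  shows "fa_valid n (a \<star> b)"
proof -
  have "{w. (a \<star> b) w \<noteq> 0} \<subseteq> (\<lambda>(u,v). u @ v) ` ({w. a w \<noteq> 0} \<times> {w. b w \<noteq> 0})"
    using fa_mult_support[of a b] by fastforce
  then have "finite {w. (a \<star> b) w \<noteq> 0}"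
    by (rule finite_subset) (use assms in \<open>auto simp: fa_valid_iff\<close>)
  then show ?thesis using fa_mult_support[of a b] assms unfolding fa_valid_iff by (metis word_ok_append)
qed

lemma fa_valid_gen: "gen_idx g \<in> {1..n} \<Longrightarrow> fa_valid n (fa_gen g)"
  by (auto simp: fa_gen_eq word_ok_def intro!: fa_valid_wd)

lemma fa_valid_one: "fa_valid n fa_one"
  by (auto simp: fa_one_eq word_ok_def intro!: fa_valid_wd)

lemma fa_valid_Z: "i \<in> {1..n} \<Longrightarrow> fa_valid n (Z i)"
  unfolding Z_def fa_sub_eq by (intro fa_valid_diff fa_valid_mult fa_valid_gen) auto

lemma fa_valid_pow: "fa_valid n a \<Longrightarrow> fa_valid n (fa_pow a m)"
  by (induction m) (auto intro: fa_valid_one fa_valid_mult)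

lemma fa_valid_zpow: "i \<in> {1..n} \<Longrightarrow> fa_valid n (zpow i k)"
  unfolding zpow_def by (auto intro!: fa_valid_pow fa_valid_Z fa_valid_gen)

lemma fa_valid_zprod:
  assumes "P \<subseteq> {1..n}"
  shows "fa_valid n (zprod P e)"
proof -
  have "set xs \<subseteq> {1..n} \<Longrightarrow> fa_valid n (foldr (\<lambda>j acc. zpow j (e j) \<star> acc) xs fa_one)" for xs
    by (induction xs) (auto intro!: fa_valid_one fa_valid_mult fa_valid_zpow)
  moreover have "finite P" using assms finite_subset by blast
  ultimately show ?thesis using assms unfolding zprod_def by (metis set_sorted_list_of_set)
qed

lemma fa_valid_sum: "(\<And>x. x \<in> A \<Longrightarrow> fa_valid n (f x)) \<Longrightarrow> fa_valid n (\<Sum>x\<in>A. f x)"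
  by (induction A rule: infinite_finite_induct) (auto intro: fa_valid_zero fa_valid_add)

section \<open>The defining ideal\<close>

locale ideal_ctx =
  fixes n :: nat and q :: "nat \<Rightarrow> 'k::field" and lam :: "nat \<Rightarrow> nat \<Rightarrow> 'k"
begin

abbreviation I where "I \<equiv> fa_ideal n q lam"

lemma I_zero: "0 \<in> I"
  using fa_ideal.zero[of n q lam] by (simp add: fa_zero_eq)

lemma I_add: "a \<in> I \<Longrightarrow> b \<in> I \<Longrightarrow> a + b \<in> I"
  using fa_ideal.add[of a n q lam b] by (simp add: fa_add_eq)

lemma I_mult_left: "a \<in> I \<Longrightarrow> fa_valid n u \<Longrightarrow> u \<star> a \<in> I"
  using fa_ideal.mult[of a n q lam u fa_one] by (simp add: fa_valid_one fa_mult_one_right)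

lemma I_mult_right: "a \<in> I \<Longrightarrow> fa_valid n u \<Longrightarrow> a \<star> u \<in> I"
  using fa_ideal.mult[of a n q lam fa_one u] by (simp add: fa_valid_one fa_mult_one_left)

text \<open>The closure rules of \<open>fa_ideal\<close> mention neither scalars nor differences;
  both enter through multiplication by the valid element \<open>k \<odot> fa_one\<close>, with k =
  -1 for \<open>I_diff\<close>.\<close>

lemma I_smult: "a \<in> I \<Longrightarrow> k \<odot> a \<in> I"
  using I_mult_left[of a "k \<odot> fa_one"]
  by (simp add: fa_valid_smult fa_valid_one fa_smult_mult_left fa_mult_one_left)

lemma I_diff: "a \<in> I \<Longrightarrow> b \<in> I \<Longrightarrow> a - b \<in> I"
  using I_add[of a "(-1) \<odot> b"] I_smult[of b "-1"] by (simp add: fa_smult_uminus)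

lemma cong_iff: "fa_cong n q lam a b \<longleftrightarrow> a - b \<in> I"
  by (simp add: fa_cong_def fa_sub_eq)

text \<open>Apart from the relation between x_i and y_i and the invertibility of z_i, every defining
  relation has this form. The scalars multiply under products and invert under exchange, so the
  commutation rules of z_i and w_i are computed from those of the letters.\<close>

definition qcomm :: "'k \<Rightarrow> 'k fa \<Rightarrow> 'k fa \<Rightarrow> bool" where
  "qcomm k u v \<longleftrightarrow> u \<star> v - k \<odot> (v \<star> u) \<in> I"

lemma qcomm_mult:
  assumes "qcomm k u v" "qcomm l u' v" "fa_valid n u" "fa_valid n u'"
  shows "qcomm (k * l) (u \<star> u') v"
proof -
  have "u \<star> (u' \<star> v - l \<odot> (v \<star> u')) + l \<odot> ((u \<star> v - k \<odot> (v \<star> u)) \<star> u') \<in> I"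
    using assms unfolding qcomm_def
    by (intro I_add[OF I_mult_left I_smult[OF I_mult_right]])
  then show ?thesis by (simp add: qcomm_def fa_ring mult.commute)
qed

lemma qcomm_diff:
  assumes "qcomm k u v" "qcomm k u' v"
  shows "qcomm k (u - u') v"
proof -
  have "(u \<star> v - k \<odot> (v \<star> u)) - (u' \<star> v - k \<odot> (v \<star> u')) \<in> I"
    using assms by (auto simp: qcomm_def intro!: I_diff)
  then show ?thesis by (simp add: qcomm_def fa_ring algebra_simps)
qed

lemma qcomm_swap:
  assumes "qcomm k u v" "k \<noteq> 0"
  shows "qcomm (inverse k) v u"
proof -
  have "(- inverse k) \<odot> (u \<star> v - k \<odot> (v \<star> u)) \<in> I"
    using assms by (auto simp: qcomm_def intro!: I_smult)
  moreover have "(- inverse k) \<odot> (u \<star> v - k \<odot> (v \<star> u)) = v \<star> u - inverse k \<odot> (u \<star> v)"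
    using assms(2) by (auto simp: fa_smult_def fun_eq_iff algebra_simps)
  ultimately show ?thesis by (simp add: qcomm_def)
qed

end

section \<open>Commutation rules modulo the ideal\<close>

locale qweyl = ideal_ctx n q lam for n and q :: "nat \<Rightarrow> 'k::field" and lam +
  assumes q_nz: "i \<in> {1..n} \<Longrightarrow> q i \<noteq> 0"
    and lam_nz: "i \<in> {1..n} \<Longrightarrow> j \<in> {1..n} \<Longrightarrow> lam i j \<noteq> 0"
    and lam_inv: "i \<in> {1..n} \<Longrightarrow> j \<in> {1..n} \<Longrightarrow> lam j i = inverse (lam i j)"
    and q_indep: "(\<Prod>k\<in>{1..n}. q k powi e k) = 1 \<Longrightarrow> k \<in> {1..n} \<Longrightarrow> e k = (0::int)"
begin

lemmas valids = fa_valid_gen fa_valid_Z fa_valid_mult fa_valid_diff fa_valid_one fa_valid_smult fa_valid_add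

lemma qcomm_XX: assumes "i \<in> {1..n}" "j \<in> {1..n}" "i \<noteq> j" shows "qcomm (lam i j) (X i) (X j)"
proof -
  have *: "qcomm (lam i j) (X i) (X j)" if "1 \<le> i" "i < j" "j \<le> n" for i j
    unfolding qcomm_def using that by (intro fa_ideal.rel) (auto simp: fa_rels_def fa_sub_eq)
  show ?thesis
    using assms *[of i j] qcomm_swap[OF *[of j i]] lam_inv[of j i]
    by (cases i j rule: linorder_cases) (auto simp: lam_nz)
qed

lemma qcomm_YY: assumes "i \<in> {1..n}" "j \<in> {1..n}" "i \<noteq> j" shows "qcomm (lam i j) (Y i) (Y j)"
proof -
  have *: "qcomm (lam j i) (Y j) (Y i)" if "1 \<le> i" "i < j" "j \<le> n" for i j
    unfolding qcomm_def using that by (intro fa_ideal.rel) (auto simp: fa_rels_def fa_sub_eq)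
  show ?thesis
    using assms *[of j i] qcomm_swap[OF *[of i j]] lam_inv[of j i]
    by (cases i j rule: linorder_cases) (auto simp: lam_nz)
qed

lemma qcomm_XY: assumes "i \<in> {1..n}" "j \<in> {1..n}" "i \<noteq> j" shows "qcomm (lam j i) (X i) (Y j)"
proof -
  have *: "qcomm (lam j i) (X i) (Y j)" if "1 \<le> i" "i < j" "j \<le> n" for i j
    unfolding qcomm_def using that by (intro fa_ideal.rel) (auto simp: fa_rels_def fa_sub_eq)
  have **: "qcomm (lam j i) (X i) (Y j)" if "1 \<le> j" "j < i" "i \<le> n" for i j
    unfolding qcomm_def using that by (intro fa_ideal.rel) (auto simp: fa_rels_def fa_sub_eq)
  show ?thesis
    using assms * ** by (cases i j rule: linorder_cases) auto
qed

lemma qcomm_YX: assumes "i \<in> {1..n}" "j \<in> {1..n}" "i \<noteq> j" shows "qcomm (lam j i) (Y i) (X j)"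
  using qcomm_swap[OF qcomm_XY[of j i]] assms lam_inv[of i j] lam_nz[of i j] by simp

lemma rel_XY: "i \<in> {1..n} \<Longrightarrow> X i \<star> Y i - q i \<odot> (Y i \<star> X i) - fa_one \<in> I"
  by (intro fa_ideal.rel) (auto simp: fa_rels_def fa_sub_eq)

lemma rel_WZ: "i \<in> {1..n} \<Longrightarrow> W i \<star> Z i - fa_one \<in> I"
  by (intro fa_ideal.rel) (auto simp: fa_rels_def fa_sub_eq)

lemma rel_ZW: "i \<in> {1..n} \<Longrightarrow> Z i \<star> W i - fa_one \<in> I"
  by (intro fa_ideal.rel) (auto simp: fa_rels_def fa_sub_eq)

text \<open>For i = j, the commutator of the relation x_i y_i - q_i y_i x_i - 1 with x_i, divided by
  q_i, is exactly z_i x_i - q_i^(-1) x_i z_i. For distinct indices both terms of z_i pick up the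
  scalar lam_ij lam_ji = 1.\<close>

lemma qcomm_ZX: assumes "i \<in> {1..n}" "j \<in> {1..n}" 
  shows "qcomm (if i = j then inverse (q i) else 1) (Z i) (X j)"
proof (cases "i = j")
  case True
  let ?r = "X i \<star> Y i - q i \<odot> (Y i \<star> X i) - fa_one"
  have "inverse (q i) \<odot> (?r \<star> X i) - inverse (q i) \<odot> (X i \<star> ?r) \<in> I"
    using assms by (intro I_diff[OF I_smult[OF I_mult_right] I_smult[OF I_mult_left]] rel_XY valids) auto
  moreover have "inverse (q i) \<odot> (?r \<star> X i) - inverse (q i) \<odot> (X i \<star> ?r)
      = Z i \<star> X i - inverse (q i) \<odot> (X i \<star> Z i)"
    using q_nz[OF assms(1)] by (simp add: Z_def fa_sub_eq fa_ring fa_smult_one)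
  ultimately show ?thesis using True by (simp add: qcomm_def)
next
  case False
  have "qcomm (lam i j * lam j i) (Y i \<star> X i) (X j)" "qcomm (lam i j * lam j i) (X i \<star> Y i) (X j)"
    using qcomm_mult[OF qcomm_YX qcomm_XX, of i j i] qcomm_mult[OF qcomm_XX qcomm_YX, of i j i] assms False
      fa_valid_gen[of "GX i" n] fa_valid_gen[of "GY i" n]
    by (auto simp: mult.commute)
  then have "qcomm 1 (Z i) (X j)"
    unfolding Z_def fa_sub_eq using assms lam_inv[of i j] lam_nz[of i j] by (intro qcomm_diff) auto
  then show ?thesis using False by simp
qed

lemma qcomm_ZY: assumes "i \<in> {1..n}" "j \<in> {1..n}" 
  shows "qcomm (if i = j then q i else 1) (Z i) (Y j)"
proof (cases "i = j")
  case True
  let ?r = "X i \<star> Y i - q i \<odot> (Y i \<star> X i) - fa_one"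
  have "?r \<star> Y i - Y i \<star> ?r \<in> I"
    using assms by (intro I_diff[OF I_mult_right I_mult_left] rel_XY valids) auto
  moreover have "?r \<star> Y i - Y i \<star> ?r = Z i \<star> Y i - q i \<odot> (Y i \<star> Z i)"
    by (simp add: Z_def fa_sub_eq fa_ring fa_smult_one)
  ultimately show ?thesis using True by (simp add: qcomm_def)
next
  case False
  have "qcomm (lam i j * lam j i) (Y i \<star> X i) (Y j)" "qcomm (lam i j * lam j i) (X i \<star> Y i) (Y j)"
    using qcomm_mult[OF qcomm_YY qcomm_XY, of i j i] qcomm_mult[OF qcomm_XY qcomm_YY, of i j i] assms False
      fa_valid_gen[of "GX i" n] fa_valid_gen[of "GY i" n]
    by (auto simp: mult.commute)
  then have "qcomm 1 (Z i) (Y j)"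
    unfolding Z_def fa_sub_eq using assms lam_inv[of i j] lam_nz[of i j] by (intro qcomm_diff) auto
  then show ?thesis using False by simp
qed

text \<open>Multiplying z_i u = k u z_i by w_i from both sides gives u w_i = k w_i u; the
  combination in the proof writes this as an explicit element of the ideal.\<close>

lemma qcomm_W:
  assumes i: "i \<in> {1..n}" and u: "fa_valid n u" and c: "qcomm k (Z i) u"
  shows "qcomm k u (W i)"
proof -
  have W: "fa_valid n (W i)" using i by (intro valids) auto
  have "W i \<star> (Z i \<star> u - k \<odot> (u \<star> Z i)) \<star> W i - (W i \<star> Z i - fa_one) \<star> (u \<star> W i)
        + k \<odot> ((W i \<star> u) \<star> (Z i \<star> W i - fa_one)) \<in> I"
    using c u i unfolding qcomm_def
    by (intro I_add[OF I_diff[OF I_mult_right[OF I_mult_left] I_mult_right] I_smult[OF I_mult_left]]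
        W fa_valid_mult rel_WZ rel_ZW)
  then show ?thesis by (simp add: qcomm_def fa_ring)
qed

lemma qcomm_ZZ: assumes "i \<in> {1..n}" "j \<in> {1..n}" shows "qcomm 1 (Z i) (Z j)"
proof (cases "i = j")
  case True then show ?thesis by (simp add: qcomm_def fa_smult_one I_zero)
next
  case False
  have X: "qcomm 1 (X i) (Z j)" using qcomm_swap[OF qcomm_ZX[of j i]] assms False by auto
  have Y: "qcomm 1 (Y i) (Z j)" using qcomm_swap[OF qcomm_ZY[of j i]] assms False by auto
  have "fa_valid n (X i)" "fa_valid n (Y i)" using assms by (auto intro!: valids)
  then show ?thesis unfolding Z_def[of i] fa_sub_eq
    using qcomm_mult[OF X Y] qcomm_mult[OF Y X] by (intro qcomm_diff) auto
qed

lemma qcomm_WW: assumes "i \<in> {1..n}" "j \<in> {1..n}" shows "qcomm 1 (W i) (W j)"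
proof (rule qcomm_W)
  show "qcomm 1 (Z j) (W i)" using assms by (intro qcomm_W qcomm_ZZ valids) auto
qed (use assms in \<open>auto intro!: valids\<close>)

lemma qcomm_XW: assumes "i \<in> {1..n}" "j \<in> {1..n}"
  shows "qcomm (if i = j then inverse (q i) else 1) (X j) (W i)"
  using assms by (intro qcomm_W qcomm_ZX valids) auto

lemma qcomm_YW: assumes "i \<in> {1..n}" "j \<in> {1..n}"
  shows "qcomm (if i = j then q i else 1) (Y j) (W i)"
  using assms by (intro qcomm_W qcomm_ZY valids) auto

end

section \<open>Linear operators on functions on the exponent lattice\<close>

text \<open>The quantum torus depends on the parameters q and lam, so it cannot be a type of its own;
  the ring of linear operators contains its regular representation for all parameters at once.\<close>

typedef (overloaded) 'k lop = "{L :: ((nat \<Rightarrow> int) \<Rightarrow> 'k::field) \<Rightarrow> ((nat \<Rightarrow> int) \<Rightarrow> 'k).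
    (\<forall>F G. L (F + G) = L F + L G) \<and> (\<forall>c F. L (\<lambda>h. c * F h) = (\<lambda>h. c * L F h))}"
  morphisms ap Lop
  by (intro exI[of _ "\<lambda>F. F"]) auto

setup_lifting type_definition_lop

instantiation lop :: (field) ring_1
begin

lift_definition zero_lop :: "'a lop" is "\<lambda>F. 0" by (auto simp: fun_eq_iff)
lift_definition one_lop :: "'a lop" is "\<lambda>F. F" by auto
lift_definition plus_lop :: "'a lop \<Rightarrow> 'a lop \<Rightarrow> 'a lop" is "\<lambda>L M F. L F + M F"
  by (auto simp: fun_eq_iff algebra_simps)
lift_definition minus_lop :: "'a lop \<Rightarrow> 'a lop \<Rightarrow> 'a lop" is "\<lambda>L M F. L F - M F"
  by (auto simp: fun_eq_iff algebra_simps)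
lift_definition uminus_lop :: "'a lop \<Rightarrow> 'a lop" is "\<lambda>L F. - L F"
  by (auto simp: fun_eq_iff algebra_simps)
lift_definition times_lop :: "'a lop \<Rightarrow> 'a lop \<Rightarrow> 'a lop" is "\<lambda>L M F. L (M F)"
  by auto

instance
proof
  show "(0::'a lop) \<noteq> 1"
  proof
    assume "(0::'a lop) = 1"
    then have "ap (0::'a lop) (\<lambda>_. 1) = ap 1 (\<lambda>_. 1)" by simp
    then show False by (simp add: zero_lop.rep_eq one_lop.rep_eq fun_eq_iff)
  qed
qed (transfer; auto simp: fun_eq_iff algebra_simps)+

end

lemmas ap_simps = zero_lop.rep_eq one_lop.rep_eq plus_lop.rep_eq minus_lop.rep_eq uminus_lop.rep_eq times_lop.rep_eq

lift_definition sc :: "'k::field \<Rightarrow> 'k lop" is "\<lambda>c F h. c * F h"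
  by (auto simp: fun_eq_iff algebra_simps)

lemma sc_0 [simp]: "sc 0 = 0" by transfer (simp add: fun_eq_iff)
lemma sc_1 [simp]: "sc 1 = 1" by transfer simp
lemma sc_add: "sc (a + b) = sc a + sc b" by transfer (simp add: fun_eq_iff algebra_simps)
lemma sc_diff: "sc (a - b) = sc a - sc b" by transfer (simp add: fun_eq_iff algebra_simps)
lemma sc_minus: "sc (- a) = - sc a" by transfer (simp add: fun_eq_iff)
lemma sc_mult: "sc a * sc b = sc (a * b)" by transfer (simp add: fun_eq_iff)
lemma sc_mult': "sc a * (sc b * L) = sc (a * b) * L" by (simp add: sc_mult flip: mult.assoc)
lemma sc_comm: "L * sc c = sc c * L" by transfer simp
lemma sc_comm': "L * (sc c * M) = sc c * (L * M)" by (metis mult.assoc sc_comm)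
lemma sc_inverse: "a \<noteq> 0 \<Longrightarrow> sc a * (sc (inverse a) * L) = L" "a \<noteq> 0 \<Longrightarrow> sc (inverse a) * (sc a * L) = L"
  by (simp_all add: sc_mult')
lemma ap_sc: "ap (sc c * L) F h = c * ap L F h" by (simp add: times_lop.rep_eq sc.rep_eq)
lemma ap_sum: "ap (\<Sum>x\<in>A. f x) F h = (\<Sum>x\<in>A. ap (f x) F h)"
  by (induction A rule: infinite_finite_induct) (auto simp: ap_simps)

definition delta :: "(nat \<Rightarrow> int) \<Rightarrow> (nat \<Rightarrow> int) \<Rightarrow> 'k::field" where
  "delta g = (\<lambda>h. if h = g then 1 else 0)"

text \<open>The operator \<open>t g\<close> of the torus shifts by g with a twist that is 1 at the
  origin, so testing at 0 against \<open>delta g\<close> reads off the coefficient of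
  \<open>t g\<close>. Linear independence of the monomials comes for free.\<close>

definition coef :: "'k::field lop \<Rightarrow> (nat \<Rightarrow> int) \<Rightarrow> 'k" where
  "coef L g = ap L (delta g) 0"

lemma coef_add: "coef (L + M) g = coef L g + coef M g" by (simp add: coef_def ap_simps)
lemma coef_diff: "coef (L - M) g = coef L g - coef M g" by (simp add: coef_def ap_simps)
lemma coef_sc: "coef (sc c * L) g = c * coef L g" by (simp add: coef_def ap_sc)
lemma coef_sum: "coef (\<Sum>x\<in>A. f x) g = (\<Sum>x\<in>A. coef (f x) g)" by (simp add: coef_def ap_sum)
lemma coef_0: "coef 0 g = 0" by (simp add: coef_def ap_simps)

section \<open>Lexicographic cones\<close>

definition lexpos :: "(nat \<Rightarrow> int) \<Rightarrow> bool" where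
  "lexpos g \<longleftrightarrow> (\<exists>k. g k > 0 \<and> (\<forall>j<k. g j = 0))"

text \<open>The strictly positive part of a total group order. It is kept abstract so that the
  reversed order (\<open>cone_neg\<close>) yields lowest exponents from the same lemmas.\<close>

definition cone :: "((nat \<Rightarrow> int) \<Rightarrow> bool) \<Rightarrow> bool" where
  "cone P \<longleftrightarrow> (\<forall>g h. P g \<longrightarrow> P h \<longrightarrow> P (g + h)) \<and> (\<forall>g. g \<noteq> 0 \<longrightarrow> P g \<or> P (- g)) \<and> \<not> P 0"

lemma lexpos_add: "lexpos g \<Longrightarrow> lexpos h \<Longrightarrow> lexpos (g + h)"
proof -
  assume "lexpos g" "lexpos h"
  then obtain k l where k: "g k > 0" "\<forall>j<k. g j = 0" and l: "h l > 0" "\<forall>j<l. h j = 0"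
    unfolding lexpos_def by blast
  then show ?thesis unfolding lexpos_def
    by (intro exI[of _ "min k l"]) (cases k l rule: linorder_cases; auto)
qed

lemma lexpos_total: "g \<noteq> 0 \<Longrightarrow> lexpos g \<or> lexpos (- g)"
proof -
  assume "g \<noteq> 0"
  then obtain k where "g k \<noteq> 0" by (auto simp: fun_eq_iff)
  define m where "m = (LEAST k. g k \<noteq> 0)"
  have "g m \<noteq> 0" unfolding m_def by (rule LeastI) fact
  moreover have "\<forall>j<m. g j = 0" unfolding m_def using not_less_Least by blast
  ultimately show ?thesis unfolding lexpos_def
    by (cases "g m > 0") (auto intro!: exI[of _ m])
qed

lemma cone_lexpos: "cone lexpos"
  unfolding cone_def by (auto simp: lexpos_add lexpos_total) (auto simp: lexpos_def)

lemma cone_neg: "cone P \<Longrightarrow> cone (\<lambda>g. P (- g))"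
  unfolding cone_def by (auto simp: minus_add_distrib)

lemma cone_add: "cone P \<Longrightarrow> P g \<Longrightarrow> P h \<Longrightarrow> P (g + h)"
  by (simp add: cone_def)

lemma cone_total: "cone P \<Longrightarrow> g = h \<or> P (g - h) \<or> P (h - g)"
  unfolding cone_def by (metis minus_diff_eq right_minus_eq)

lemma cone_antisym: "cone P \<Longrightarrow> P g \<Longrightarrow> P (- g) \<Longrightarrow> False"
  using cone_add[of P g "- g"] by (simp add: cone_def)

lemma cone_max:
  assumes "cone P" "finite A" "A \<noteq> {}"
  shows "\<exists>g\<in>A. \<forall>h\<in>A. h = g \<or> P (g - h)"
  using assms(2,3)
proof (induction rule: finite_ne_induct)
  case (singleton x) then show ?case by auto
next
  case (insert x F)
  then obtain g where g: "g \<in> F" "\<forall>h\<in>F. h = g \<or> P (g - h)" by blast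
  consider "x = g" | "P (g - x)" | "P (x - g)"
    using cone_total[OF assms(1)] by blast
  then show ?case
  proof cases
    case 3
    have "P (x - h)" if "h \<in> F" for h
    proof (cases "h = g")
      case False
      then have "P (g - h)" using g(2) that by blast
      from cone_add[OF assms(1) 3 this] show ?thesis by (metis add_diff_eq diff_add_cancel)
    qed (use 3 in blast)
    then show ?thesis by blast
  qed (use g in \<open>blast+\<close>)
qed

section \<open>The quantum torus\<close>

text \<open>Coordinate 2 i of an exponent vector is the exponent of z_i, coordinate 2 i + 1 that of x_i.\<close>

definition zi :: "nat \<Rightarrow> nat \<Rightarrow> int" where "zi i = (\<lambda>k. if k = 2 * i then 1 else 0)"
definition xi :: "nat \<Rightarrow> nat \<Rightarrow> int" where "xi i = (\<lambda>k. if k = 2 * i + 1 then 1 else 0)"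

lemma odd_ne_even: "Suc (2 * j) \<noteq> 2 * (k::nat)" "2 * k \<noteq> Suc (2 * j)" by presburger+

lemma zi_simps [simp]: "zi i (2 * j) = (if i = j then 1 else 0)" "zi i (Suc (2 * j)) = 0"
  by (auto simp: zi_def odd_ne_even)
lemma xi_simps [simp]: "xi i (2 * j) = 0" "xi i (Suc (2 * j)) = (if i = j then 1 else 0)"
  by (auto simp: xi_def odd_ne_even)

definition lattice :: "nat \<Rightarrow> (nat \<Rightarrow> int) set" where
  "lattice n = {g. \<forall>k. k \<notin> {2..2 * n + 1} \<longrightarrow> g k = 0}"

lemma lattice_add: "g \<in> lattice n \<Longrightarrow> h \<in> lattice n \<Longrightarrow> g + h \<in> lattice n"
  and lattice_minus: "g \<in> lattice n \<Longrightarrow> - g \<in> lattice n"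
  and lattice_diff: "g \<in> lattice n \<Longrightarrow> h \<in> lattice n \<Longrightarrow> g - h \<in> lattice n"
  and lattice_0: "0 \<in> lattice n"
  by (auto simp: lattice_def)

lemma lattice_zi: "i \<in> {1..n} \<Longrightarrow> zi i \<in> lattice n"
  and lattice_xi: "i \<in> {1..n} \<Longrightarrow> xi i \<in> lattice n"
  by (auto simp: lattice_def zi_def xi_def)

lemma lattice_eqI:
  assumes "g \<in> lattice n" "h \<in> lattice n" "\<And>i. i \<in> {1..n} \<Longrightarrow> g (2 * i) = h (2 * i)"
    "\<And>i. i \<in> {1..n} \<Longrightarrow> g (Suc (2 * i)) = h (Suc (2 * i))"
  shows "g = h"
proof
  fix k
  show "g k = h k"
  proof (cases "k \<in> {2..2 * n + 1}")
    case False then show ?thesis using assms(1,2) by (auto simp: lattice_def)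
  next
    case True
    then show ?thesis using assms(3,4)[of "k div 2"] 
      by (cases "even k") (auto elim!: evenE oddE)
  qed
qed

context qweyl
begin

text \<open>A bimultiplicative cocycle: \<open>t g\<close> stands for the ordered monomial with the
  powers of the x_i, in decreasing order of i, before those of the z_i, and \<open>tw h g\<close> is
  the scalar produced when \<open>t g * t h\<close> is brought into this order. Bimultiplicativity
  is what makes \<open>t\<close> multiplicative up to this scalar.\<close>

definition tw :: "(nat \<Rightarrow> int) \<Rightarrow> (nat \<Rightarrow> int) \<Rightarrow> 'k" where
  "tw g h = (\<Prod>i\<in>{1..n}. q i powi (- (g (2 * i + 1) * h (2 * i)))) *
     (\<Prod>i\<in>{1..n}. \<Prod>j\<in>{i<..n}. lam i j powi (h (2 * i + 1) * g (2 * j + 1)))"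

lemma tw_nz: "tw g h \<noteq> 0"
  using q_nz lam_nz by (auto simp: tw_def)

lemma powi_sum_exponent: "c \<noteq> 0 \<Longrightarrow> k = i + j \<Longrightarrow> c powi k = c powi i * c powi (j::int)" for c :: 'k
  by (simp add: power_int_add)

lemma tw_add_left: "tw (g + g') h = tw g h * tw g' h"
proof -
  have "(\<Prod>i\<in>{1..n}. q i powi (- ((g + g') (2 * i + 1) * h (2 * i)))) =
      (\<Prod>i\<in>{1..n}. q i powi (- (g (2 * i + 1) * h (2 * i)))) * (\<Prod>i\<in>{1..n}. q i powi (- (g' (2 * i + 1) * h (2 * i))))"
    unfolding prod.distrib[symmetric]
    by (intro prod.cong refl powi_sum_exponent q_nz) (auto simp: algebra_simps)
  moreover have "(\<Prod>i\<in>{1..n}. \<Prod>j\<in>{i<..n}. lam i j powi (h (2 * i + 1) * (g + g') (2 * j + 1))) =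
      (\<Prod>i\<in>{1..n}. \<Prod>j\<in>{i<..n}. lam i j powi (h (2 * i + 1) * g (2 * j + 1))) *
      (\<Prod>i\<in>{1..n}. \<Prod>j\<in>{i<..n}. lam i j powi (h (2 * i + 1) * g' (2 * j + 1)))"
    unfolding prod.distrib[symmetric]
    by (intro prod.cong refl powi_sum_exponent lam_nz) (auto simp: algebra_simps)
  ultimately show ?thesis unfolding tw_def by (simp only: ac_simps)
qed

lemma tw_add_right: "tw g (h + h') = tw g h * tw g h'"
proof -
  have "(\<Prod>i\<in>{1..n}. q i powi (- (g (2 * i + 1) * (h + h') (2 * i)))) =
      (\<Prod>i\<in>{1..n}. q i powi (- (g (2 * i + 1) * h (2 * i)))) * (\<Prod>i\<in>{1..n}. q i powi (- (g (2 * i + 1) * h' (2 * i))))"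
    unfolding prod.distrib[symmetric]
    by (intro prod.cong refl powi_sum_exponent q_nz) (auto simp: algebra_simps)
  moreover have "(\<Prod>i\<in>{1..n}. \<Prod>j\<in>{i<..n}. lam i j powi ((h + h') (2 * i + 1) * g (2 * j + 1))) =
      (\<Prod>i\<in>{1..n}. \<Prod>j\<in>{i<..n}. lam i j powi (h (2 * i + 1) * g (2 * j + 1))) *
      (\<Prod>i\<in>{1..n}. \<Prod>j\<in>{i<..n}. lam i j powi (h' (2 * i + 1) * g (2 * j + 1)))"
    unfolding prod.distrib[symmetric]
    by (intro prod.cong refl powi_sum_exponent lam_nz) (auto simp: algebra_simps)
  ultimately show ?thesis unfolding tw_def by (simp only: ac_simps)
qed

lemma tw_0 [simp]: "tw 0 h = 1" "tw g 0 = 1"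
  by (simp_all add: tw_def)

lift_definition t :: "(nat \<Rightarrow> int) \<Rightarrow> 'k lop" is "\<lambda>g F h. tw g h * F (h + g)"
  by (auto simp: fun_eq_iff algebra_simps)

lemma t_mult: "t g * t h = sc (tw h g) * t (g + h)"
  by transfer (simp add: fun_eq_iff tw_add_left tw_add_right ac_simps)

lemma t_0 [simp]: "t 0 = 1"
  by transfer simp

lemma coef_t: "coef (t g) h = (if g = h then 1 else 0)"
  by (auto simp: coef_def t.rep_eq delta_def)

text \<open>A general operator is not determined by its coefficients, so membership demands that L
  equal its own finite expansion; equality in the torus is then equality of coefficients.\<close>

definition torus :: "'k lop set" where
  "torus = {L. finite {g. coef L g \<noteq> 0} \<and> {g. coef L g \<noteq> 0} \<subseteq> lattice n \<and>
       L = (\<Sum>g | coef L g \<noteq> 0. sc (coef L g) * t g)}"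

abbreviation supp :: "'k lop \<Rightarrow> (nat \<Rightarrow> int) set" where "supp L \<equiv> {g. coef L g \<noteq> 0}"

lemma torus_span:
  assumes "finite A" "f ` A \<subseteq> lattice n"
  shows "(\<Sum>a\<in>A. sc (c a) * t (f a)) \<in> torus"
proof -
  let ?L = "\<Sum>a\<in>A. sc (c a) * t (f a)"
  have cf: "coef ?L g = (\<Sum>a | a \<in> A \<and> f a = g. c a)" for g
    using assms(1) by (simp add: coef_sum coef_sc coef_t if_distrib[of "(*) _"] sum.inter_filter cong: if_cong)
  have sub: "{g. coef ?L g \<noteq> 0} \<subseteq> f ` A"
  proof
    fix g assume "g \<in> {g. coef ?L g \<noteq> 0}"
    then have "(\<Sum>a | a \<in> A \<and> f a = g. c a) \<noteq> 0" by (simp add: cf)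
    then have "{a. a \<in> A \<and> f a = g} \<noteq> {}" by (metis sum.empty)
    then show "g \<in> f ` A" by auto
  qed
  have "?L = (\<Sum>g\<in>f ` A. \<Sum>a | a \<in> A \<and> f a = g. sc (c a) * t (f a))"
    using assms(1) by (rule sum.image_gen)
  also have "\<dots> = (\<Sum>g\<in>f ` A. sc (coef ?L g) * t g)"
  proof (intro sum.cong refl)
    fix g
    have "(\<Sum>a\<in>{x \<in> A. f x = g}. sc (c a) * t (f a)) = (\<Sum>a\<in>{x \<in> A. f x = g}. sc (c a)) * t g"
      by (simp add: sum_distrib_right)
    also have "(\<Sum>a\<in>{x \<in> A. f x = g}. sc (c a)) = sc (\<Sum>a\<in>{x \<in> A. f x = g}. c a)"
      by (induction "{x \<in> A. f x = g}" rule: infinite_finite_induct)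
        (use sum_comp_morphism[of sc] in \<open>auto simp: sc_add o_def\<close>)
    finally show "(\<Sum>a\<in>{x \<in> A. f x = g}. sc (c a) * t (f a)) = sc (coef ?L g) * t g"
      by (simp add: cf)
  qed
  also have "\<dots> = (\<Sum>g | coef ?L g \<noteq> 0. sc (coef ?L g) * t g)"
    using sub assms(1) by (intro sum.mono_neutral_right) auto
  finally have "?L = (\<Sum>g | coef ?L g \<noteq> 0. sc (coef ?L g) * t g)" .
  then show ?thesis unfolding torus_def using sub assms by (auto intro: finite_subset)
qed

lemma torus_expand: "L \<in> torus \<Longrightarrow> L = (\<Sum>g\<in>supp L. sc (coef L g) * t g)"
  by (simp add: torus_def)

lemma torus_finite: "L \<in> torus \<Longrightarrow> finite (supp L)"
  by (simp add: torus_def)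

lemma torus_lattice: "L \<in> torus \<Longrightarrow> coef L g \<noteq> 0 \<Longrightarrow> g \<in> lattice n"
  by (auto simp: torus_def)

lemma torus_expand_superset:
  assumes "L \<in> torus" "finite S" "supp L \<subseteq> S"
  shows "L = (\<Sum>g\<in>S. sc (coef L g) * t g)"
proof -
  have "(\<Sum>g\<in>supp L. sc (coef L g) * t g) = (\<Sum>g\<in>S. sc (coef L g) * t g)"
    using assms by (intro sum.mono_neutral_left) auto
  then show ?thesis using torus_expand[OF assms(1)] by simp
qed

lemma torus_eqI:
  assumes "L \<in> torus" "M \<in> torus" "\<And>g. coef L g = coef M g"
  shows "L = M"
  using assms torus_expand[of L] torus_expand[of M] by simp

lemma torus_t: "g \<in> lattice n \<Longrightarrow> t g \<in> torus"
  using torus_span[of "{()}" "\<lambda>_. g" "\<lambda>_. 1"] by simp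

lemma torus_0: "0 \<in> torus"
  using torus_span[of "{}" "\<lambda>_. 0" "\<lambda>_. 0"] by simp

lemma torus_1: "1 \<in> torus"
  using torus_t[OF lattice_0] by simp

lemma torus_sc: assumes "L \<in> torus" shows "sc c * L \<in> torus"
proof -
  have "sc c * L = (\<Sum>g\<in>supp L. sc (c * coef L g) * t g)"
    using arg_cong[OF torus_expand[OF assms], of "(*) (sc c)"] by (simp add: sum_distrib_left sc_mult')
  then show ?thesis using assms by (auto intro!: torus_span torus_finite dest: torus_lattice)
qed

lemma torus_add: assumes "L \<in> torus" "M \<in> torus" shows "L + M \<in> torus"
proof -
  let ?S = "supp L \<union> supp M"
  have "L + M = (\<Sum>g\<in>?S. sc (coef L g + coef M g) * t g)"
    using assms torus_expand_superset[of L ?S] torus_expand_superset[of M ?S]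
    by (simp add: torus_finite sc_add distrib_right sum.distrib)
  moreover have "(\<lambda>g. g) ` ?S \<subseteq> lattice n" "finite ?S"
    using assms by (auto intro!: torus_finite dest: torus_lattice)
  ultimately show ?thesis using torus_span[of ?S "\<lambda>g. g" "\<lambda>g. coef L g + coef M g"] by simp
qed

lemma torus_minus: "L \<in> torus \<Longrightarrow> - L \<in> torus"
  using torus_sc[of L "-1"] by (simp add: sc_minus)

lemma torus_diff: "L \<in> torus \<Longrightarrow> M \<in> torus \<Longrightarrow> L - M \<in> torus"
  using torus_add[OF _ torus_minus, of L M] by simp

lemma torus_sum: "(\<And>x. x \<in> A \<Longrightarrow> f x \<in> torus) \<Longrightarrow> (\<Sum>x\<in>A. f x) \<in> torus"
  by (induction A rule: infinite_finite_induct) (auto intro: torus_0 torus_add)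

lemma torus_mult_expand:
  assumes "L \<in> torus" "M \<in> torus"
  shows "L * M = (\<Sum>g\<in>supp L. \<Sum>h\<in>supp M. sc (coef L g * coef M h * tw h g) * t (g + h))"
proof -
  have "L * M = (\<Sum>g\<in>supp L. sc (coef L g) * t g) * (\<Sum>h\<in>supp M. sc (coef M h) * t h)"
    using torus_expand[OF assms(1)] torus_expand[OF assms(2)] by simp
  also have "\<dots> = (\<Sum>g\<in>supp L. \<Sum>h\<in>supp M. (sc (coef L g) * t g) * (sc (coef M h) * t h))"
    by (rule sum_product)
  also have "\<dots> = (\<Sum>g\<in>supp L. \<Sum>h\<in>supp M. sc (coef L g * coef M h * tw h g) * t (g + h))"
    by (intro sum.cong refl) (simp add: mult.assoc sc_comm'[of "t _"] t_mult sc_mult')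
  finally show ?thesis .
qed

lemma torus_mult: assumes "L \<in> torus" "M \<in> torus" shows "L * M \<in> torus"
  unfolding torus_mult_expand[OF assms]
  using assms by (intro torus_sum torus_sc torus_t lattice_add) (auto dest: torus_lattice)

lemma coef_mult:
  assumes "L \<in> torus" "M \<in> torus"
  shows "coef (L * M) k = (\<Sum>g\<in>supp L. \<Sum>h\<in>supp M. if g + h = k then coef L g * coef M h * tw h g else 0)"
  unfolding torus_mult_expand[OF assms]
  by (auto simp: coef_sum coef_sc coef_t intro!: sum.cong)

lemma supp_mult:
  assumes "L \<in> torus" "M \<in> torus" "coef (L * M) k \<noteq> 0"
  shows "\<exists>g h. coef L g \<noteq> 0 \<and> coef M h \<noteq> 0 \<and> k = g + h"
proof (rule ccontr)
  assume "\<not> ?thesis"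
  then have "coef (L * M) k = 0"
    unfolding coef_mult[OF assms(1,2)] by (intro sum.neutral ballI) auto
  with assms(3) show False by simp
qed

section \<open>Leading exponents, zero divisors and units\<close>

definition lead :: "((nat \<Rightarrow> int) \<Rightarrow> bool) \<Rightarrow> 'k lop \<Rightarrow> (nat \<Rightarrow> int) \<Rightarrow> bool" where
  "lead P L g \<longleftrightarrow> coef L g \<noteq> 0 \<and> (\<forall>h. coef L h \<noteq> 0 \<longrightarrow> h = g \<or> P (g - h))"

text \<open>Every pair of exponents other than (g, h) has a sum strictly below g + h, so a single
  product of coefficients, times a nonzero twist, survives at g + h.\<close>

lemma lead_mult:
  assumes P: "cone P" and T: "L \<in> torus" "M \<in> torus" and l: "lead P L g" "lead P M h"
  shows "lead P (L * M) (g + h)"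
proof -
  have ineq: "(g' = g \<and> h' = h) \<or> P ((g + h) - (g' + h'))" if "coef L g' \<noteq> 0" "coef M h' \<noteq> 0" for g' h'
  proof -
    have e: "(g + h) - (g' + h') = (g - g') + (h - h')" by simp
    have "g' = g \<or> P (g - g')" "h' = h \<or> P (h - h')" using l that by (auto simp: lead_def)
    then show ?thesis unfolding e using cone_add[OF P, of "g - g'" "h - h'"]
      by (metis add.left_neutral add.right_neutral diff_self)
  qed
  have "coef (L * M) (g + h) = (\<Sum>g'\<in>supp L. \<Sum>h'\<in>supp M. if g' = g \<and> h' = h then coef L g * coef M h * tw h g else 0)"
    unfolding coef_mult[OF T]
  proof (intro sum.cong refl)
    fix g' h' assume "g' \<in> supp L" "h' \<in> supp M"
    then show "(if g' + h' = g + h then coef L g' * coef M h' * tw h' g' else 0) =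
      (if g' = g \<and> h' = h then coef L g * coef M h * tw h g else 0)"
      using ineq[of g' h'] P by (auto simp: cone_def)
  qed
  also have "\<dots> = (\<Sum>g'\<in>supp L. if g' = g then \<Sum>h'\<in>supp M. if h' = h then coef L g * coef M h * tw h g else 0 else 0)"
    by (intro sum.cong refl) auto
  also have "\<dots> = coef L g * coef M h * tw h g"
    using l by (simp add: torus_finite[OF T(1)] torus_finite[OF T(2)] lead_def)
  finally have "coef (L * M) (g + h) \<noteq> 0" using l tw_nz by (simp add: lead_def)
  then show ?thesis unfolding lead_def using supp_mult[OF T] ineq by metis
qed

lemma lead_exists:
  assumes "cone P" "L \<in> torus" "L \<noteq> 0" shows "\<exists>g. lead P L g"
proof -
  have "supp L \<noteq> {}" using torus_expand[OF assms(2)] assms(3) by (metis sum.empty)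
  from cone_max[OF assms(1) torus_finite[OF assms(2)] this] show ?thesis by (auto simp: lead_def)
qed

lemma torus_domain:
  assumes "L \<in> torus" "M \<in> torus" "L \<noteq> 0" "M \<noteq> 0" shows "L * M \<noteq> 0"
proof -
  obtain g h where "lead lexpos L g" "lead lexpos M h"
    using lead_exists[OF cone_lexpos] assms by metis
  then have "lead lexpos (L * M) (g + h)" using lead_mult cone_lexpos assms by blast
  then show ?thesis by (auto simp: lead_def coef_0)
qed

text \<open>Highest and lowest exponents are both additive under multiplication, and those of 1 are
  0; hence the spread between the highest and the lowest exponent of L vanishes.\<close>

lemma torus_unit:
  assumes T: "L \<in> torus" "M \<in> torus" and u: "L * M = 1"
  shows "\<exists>g c. c \<noteq> 0 \<and> g \<in> lattice n \<and> L = sc c * t g"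
proof -
  let ?N = "\<lambda>g. lexpos (- g)"
  have N: "cone ?N" by (rule cone_neg[OF cone_lexpos])
  have nz: "L \<noteq> 0" "M \<noteq> 0" using u by auto
  obtain g h g' h' where l: "lead lexpos L g" "lead lexpos M h" "lead ?N L g'" "lead ?N M h'"
    using lead_exists[OF cone_lexpos] lead_exists[OF N] T nz by metis
  have c1: "coef 1 k = (if k = 0 then 1 else 0::'k)" for k
    using coef_t[of 0 k] by auto
  have "g + h = 0" "g' + h' = 0"
    using lead_mult[OF cone_lexpos T l(1,2)] lead_mult[OF N T l(3,4)]
    by (auto simp: u lead_def c1 split: if_splits)
  then have h: "h = - g" "h' = - g'" by (simp_all add: eq_neg_iff_add_eq_0 add.commute)
  \<comment> \<open>g - g' is the spread of L, and h - h', its negative, is the spread of M; a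
    spread is zero or positive.\<close>
  have "g = g'"
  proof (rule ccontr)
    assume "g \<noteq> g'"
    moreover have "h' = h \<or> lexpos (h - h')" "g' = g \<or> lexpos (g - g')"
      using l by (auto simp: lead_def)
    moreover have "h - h' = - (g - g')" by (simp add: h)
    ultimately show False using cone_antisym[OF cone_lexpos, of "g - g'"] h by auto
  qed
  then have "supp L = {g}"
    using l(1,3) cone_antisym[OF cone_lexpos] unfolding lead_def
    by (auto, metis minus_diff_eq)
  then show ?thesis using torus_expand[OF T(1)] torus_lattice[OF T(1), of g]
    by (intro exI[of _ g] exI[of _ "coef L g"]) auto
qed

end

text \<open>As simplification rules these would eta-expand sums and differences of functions.\<close>
lemmas fun_apply = plus_fun_apply zero_fun_apply minus_apply uminus_apply
declare fun_apply [simp del]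

section \<open>Evaluation of noncommutative polynomials\<close>

definition ev :: "(gen \<Rightarrow> 'k::field lop) \<Rightarrow> 'k fa \<Rightarrow> 'k lop" where
  "ev s f = (\<Sum>w | f w \<noteq> 0. sc (f w) * prod_list (map s w))"

lemma ev_superset:
  assumes "finite S" "{w. f w \<noteq> 0} \<subseteq> S"
  shows "ev s f = (\<Sum>w\<in>S. sc (f w) * prod_list (map s w))"
  unfolding ev_def using assms by (intro sum.mono_neutral_left) auto

lemma ev_0: "ev s 0 = 0" by (simp add: ev_def fun_apply)

lemma ev_wd: "ev s (wd w) = prod_list (map s w)"
  by (subst ev_superset[of "{w}"]) (auto simp: wd_def)

lemma ev_gen: "ev s (fa_gen g) = s g" by (simp add: fa_gen_eq ev_wd)
lemma ev_one: "ev s fa_one = 1" by (simp add: fa_one_eq ev_wd)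

lemma ev_add:
  assumes "fa_valid n a" "fa_valid n b"
  shows "ev s (a + b) = ev s a + ev s b"
proof -
  let ?S = "{w. a w \<noteq> 0} \<union> {w. b w \<noteq> 0}"
  have f: "finite ?S" using assms by (auto simp: fa_valid_iff)
  have "ev s (a + b) = (\<Sum>w\<in>?S. sc ((a + b) w) * prod_list (map s w))"
    by (intro ev_superset f) (auto simp: fun_apply)
  moreover have "ev s a = (\<Sum>w\<in>?S. sc (a w) * prod_list (map s w))"
    "ev s b = (\<Sum>w\<in>?S. sc (b w) * prod_list (map s w))"
    by (intro ev_superset f; auto)+
  ultimately show ?thesis by (simp add: sc_add distrib_right sum.distrib fun_apply)
qed

lemma ev_smult: assumes "fa_valid n a" shows "ev s (k \<odot> a) = sc k * ev s a"
proof -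
  have f: "finite {w. a w \<noteq> 0}" using assms by (auto simp: fa_valid_iff)
  have "ev s (k \<odot> a) = (\<Sum>w | a w \<noteq> 0. sc ((k \<odot> a) w) * prod_list (map s w))"
    by (intro ev_superset f) (auto simp: fa_smult_def)
  then show ?thesis by (simp add: fa_smult_def ev_def sum_distrib_left sc_mult')
qed

lemma ev_diff:
  assumes "fa_valid n a" "fa_valid n b"
  shows "ev s (a - b) = ev s a - ev s b"
  using ev_add[OF assms(1) fa_valid_smult[OF assms(2)], of s "-1"] ev_smult[OF assms(2), of s "-1"]
  by (simp add: fa_smult_uminus sc_minus)

lemma ev_sum:
  assumes "\<And>x. x \<in> A \<Longrightarrow> fa_valid n (f x)"
  shows "ev s (\<Sum>x\<in>A. f x) = (\<Sum>x\<in>A. ev s (f x))"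
  using assms
proof (induction A rule: infinite_finite_induct)
  case (insert x F)
  then have "ev s (f x + sum f F) = ev s (f x) + ev s (sum f F)"
    by (intro ev_add[of n] fa_valid_sum) auto
  then show ?case using insert by simp
qed (auto simp: ev_0)

lemma fa_mult_sum_left: "(\<Sum>x\<in>A. f x) \<star> b = (\<Sum>x\<in>A. f x \<star> b)"
  by (induction A rule: infinite_finite_induct) (auto simp: fa_mult_zero fa_mult_add_left)

lemma fa_mult_sum_right: "b \<star> (\<Sum>x\<in>A. f x) = (\<Sum>x\<in>A. b \<star> f x)"
  by (induction A rule: infinite_finite_induct) (auto simp: fa_mult_zero fa_mult_add_right)

lemma ev_mult:
  fixes a :: "'k::field fa"
  assumes "fa_valid n a" "fa_valid n b"
  shows "ev s (a \<star> b) = ev s a * ev s b"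
proof -
  let ?A = "{w. a w \<noteq> 0}" and ?B = "{w. b w \<noteq> 0}"
  have f: "finite ?A" "finite ?B" using assms by (auto simp: fa_valid_iff)
  have v: "fa_valid n ((a u * b v) \<odot> wd (u @ v))" if "u \<in> ?A" "v \<in> ?B" for u v
    using that assms by (intro fa_valid_smult fa_valid_wd) (auto simp: fa_valid_iff word_ok_append)
  have "a \<star> b = (\<Sum>u\<in>?A. a u \<odot> wd u) \<star> (\<Sum>v\<in>?B. b v \<odot> wd v)"
    using fa_expand[OF f(1), of a] fa_expand[OF f(2), of b] by simp
  also have "\<dots> = (\<Sum>u\<in>?A. \<Sum>v\<in>?B. (a u * b v) \<odot> wd (u @ v))"
    unfolding fa_mult_sum_left unfolding fa_mult_sum_right
    by (simp add: fa_smult_mult_left fa_smult_mult_right fa_smult_smult fa_mult_wd mult.commute)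
  finally have ab: "a \<star> b = (\<Sum>u\<in>?A. \<Sum>v\<in>?B. (a u * b v) \<odot> wd (u @ v))" .
  have "ev s (a \<star> b) = (\<Sum>u\<in>?A. ev s (\<Sum>v\<in>?B. (a u * b v) \<odot> wd (u @ v)))"
    unfolding ab by (intro ev_sum[of _ n] fa_valid_sum v)
  also have "\<dots> = (\<Sum>u\<in>?A. \<Sum>v\<in>?B. ev s ((a u * b v) \<odot> wd (u @ v)))"
    by (intro sum.cong refl ev_sum[of _ n] v)
  also have "\<dots> = (\<Sum>u\<in>?A. \<Sum>v\<in>?B. (sc (a u) * prod_list (map s u)) * (sc (b v) * prod_list (map s v)))"
  proof (intro sum.cong refl)
    fix u v assume "u \<in> ?A" "v \<in> ?B"
    then have "fa_valid n (wd (u @ v) :: 'k fa)" using assms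
      by (intro fa_valid_wd) (auto simp: fa_valid_iff word_ok_append)
    then have "ev s ((a u * b v) \<odot> wd (u @ v)) = sc (a u * b v) * (prod_list (map s u) * prod_list (map s v))"
      by (simp add: ev_smult[of n] ev_wd)
    also have "\<dots> = (sc (a u) * prod_list (map s u)) * (sc (b v) * prod_list (map s v))"
      by (metis mult.assoc sc_comm sc_mult)
    finally show "ev s ((a u * b v) \<odot> wd (u @ v)) = \<dots>" .
  qed
  also have "\<dots> = ev s a * ev s b" unfolding ev_def by (rule sum_product[symmetric])
  finally show ?thesis .
qed

lemma fa_rels_valid: "r \<in> fa_rels n q lam \<Longrightarrow> fa_valid n r"
  unfolding fa_rels_def
  by (auto simp: fa_sub_eq Z_def intro!: fa_valid_gen fa_valid_mult fa_valid_diff fa_valid_one fa_valid_smult)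

lemma fa_ideal_valid: "r \<in> fa_ideal n q lam \<Longrightarrow> fa_valid n r"
  by (induction rule: fa_ideal.induct)
    (auto simp: fa_rels_valid fa_zero_eq fa_add_eq intro: fa_valid_zero fa_valid_add fa_valid_mult)

lemma ev_ideal:
  assumes "\<And>r. r \<in> fa_rels n q lam \<Longrightarrow> ev s r = 0" "f \<in> fa_ideal n q lam"
  shows "ev s f = 0"
  using assms(2)
proof (induction rule: fa_ideal.induct)
  case (add a b)
  then show ?case using ev_add[of n a b s] fa_ideal_valid[of _ n q lam] by (auto simp: fa_add_eq)
next
  case (mult a u v)
  then show ?case using fa_ideal_valid[of a n q lam] by (simp add: ev_mult[of n] fa_valid_mult)
qed (auto simp: assms fa_zero_eq ev_0)

lemma ev_Z: "i \<in> {1..n} \<Longrightarrow> ev (s :: gen \<Rightarrow> 'k::field lop) (Z i) = s (GX i) * s (GY i) - s (GY i) * s (GX i)"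
proof -
  assume i: "i \<in> {1..n}"
  have v: "fa_valid n (X i :: 'k fa)" "fa_valid n (Y i :: 'k fa)" using i by (auto intro: fa_valid_gen)
  have "ev s (Z i) = ev s (X i \<star> Y i) - ev s (Y i \<star> X i)"
    unfolding Z_def fa_sub_eq by (intro ev_diff[of n] fa_valid_mult v)
  then show ?thesis by (simp add: ev_mult[OF v] ev_mult[OF v(2,1)] ev_gen)
qed

text \<open>One checklist for two uses, the representation \<open>rho\<close> and the candidate
  images \<open>s\<close> of the generators. The two mixed relations for i < j are merged into one
  for distinct indices.\<close>

lemma ev_relsI:
  fixes s :: "gen \<Rightarrow> 'k::field lop"
  assumes xx: "\<And>i j. i \<in> {1..n} \<Longrightarrow> j \<in> {1..n} \<Longrightarrow> i < j \<Longrightarrow> s (GX i) * s (GX j) = sc (lam i j) * (s (GX j) * s (GX i))"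
    and yy: "\<And>i j. i \<in> {1..n} \<Longrightarrow> j \<in> {1..n} \<Longrightarrow> i < j \<Longrightarrow> s (GY j) * s (GY i) = sc (lam j i) * (s (GY i) * s (GY j))"
    and xy: "\<And>i j. i \<in> {1..n} \<Longrightarrow> j \<in> {1..n} \<Longrightarrow> i \<noteq> j \<Longrightarrow> s (GX i) * s (GY j) = sc (lam j i) * (s (GY j) * s (GX i))"
    and x: "\<And>i. i \<in> {1..n} \<Longrightarrow> s (GX i) * s (GY i) - sc (q i) * (s (GY i) * s (GX i)) = 1"
    and w1: "\<And>i. i \<in> {1..n} \<Longrightarrow> s (GW i) * (s (GX i) * s (GY i) - s (GY i) * s (GX i)) = 1"
    and w2: "\<And>i. i \<in> {1..n} \<Longrightarrow> (s (GX i) * s (GY i) - s (GY i) * s (GX i)) * s (GW i) = 1"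
    and r: "r \<in> fa_rels n q lam"
  shows "ev s r = 0"
proof -
  have v: "fa_valid n (X i :: 'k fa)" "fa_valid n (Y i :: 'k fa)" "fa_valid n (W i :: 'k fa)" "fa_valid n (Z i :: 'k fa)" if "1 \<le> i" "i \<le> n" for i
    using that by (auto intro!: fa_valid_gen fa_valid_Z)
  note vs = v fa_valid_mult fa_valid_diff fa_valid_one fa_valid_smult
  note es = fa_sub_eq ev_diff[of n] ev_mult[of n] ev_smult[of n] ev_gen ev_one ev_Z[of _ n]
  show ?thesis using r unfolding fa_rels_def
    by (elim UnE CollectE exE conjE) (simp_all add: es vs xx yy xy x w1 w2)
qed

section \<open>The representation of the localized algebra in the quantum torus\<close>

context qweyl
begin

lemma q_powi_eq_1: assumes "i \<in> {1..n}" "q i powi m = 1" shows "m = 0"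
proof -
  have "(\<Prod>k\<in>{1..n}. q k powi (if k = i then m else 0)) = (\<Prod>k\<in>{1..n}. if k = i then q i powi m else 1)"
    by (intro prod.cong) auto
  also have "\<dots> = 1" using assms by simp
  finally show ?thesis using q_indep[of "\<lambda>k. if k = i then m else 0" i] assms(1) by simp
qed

lemma q_ne_1: "i \<in> {1..n} \<Longrightarrow> q i \<noteq> 1"
  using q_powi_eq_1[of i 1] by auto

lemma tw_zi [simp]: "tw (zi i) h = 1"
  by (simp add: tw_def)

lemma tw_xi_zi: assumes "i \<in> {1..n}" shows "tw (xi i) (zi j) = (if i = j then inverse (q i) else 1)"
proof -
  have "tw (xi i) (zi j) = (\<Prod>k\<in>{1..n}. if k = i then (if i = j then inverse (q i) else 1) else 1)"
  proof -
    have "q k powi (- (xi i (2 * k + 1) * zi j (2 * k))) = (if k = i then (if i = j then inverse (q i) else 1) else 1)" for k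
      by (auto simp: power_int_minus)
    then show ?thesis unfolding tw_def by simp
  qed
  then show ?thesis using assms by simp
qed

lemma tw_xi_xi: assumes "i \<in> {1..n}" "j \<in> {1..n}" shows "tw (xi j) (xi i) = (if i < j then lam i j else 1)"
proof -
  have "tw (xi j) (xi i) = (\<Prod>k\<in>{1..n}. \<Prod>l\<in>{k<..n}. if k = i \<and> l = j then lam i j else 1)"
    unfolding tw_def by (simp, intro prod.cong refl, auto)
  also have "\<dots> = (\<Prod>k\<in>{1..n}. if k = i then if i < j then lam i j else 1 else 1)"
  proof (intro prod.cong refl)
    fix k
    have "(\<Prod>l\<in>{i<..n}. if l = j then lam i j else 1) = (if i < j then lam i j else 1)"
      using assms by simp
    then show "(\<Prod>l\<in>{k<..n}. if k = i \<and> l = j then lam i j else 1) = (if k = i then if i < j then lam i j else 1 else 1)"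
      by (cases "k = i") auto
  qed
  finally show ?thesis using assms by simp
qed

lemma tw_minus_left: "tw (- g) h = inverse (tw g h)"
  using tw_add_left[of g "- g" h] tw_nz[of g h] by (simp add: inverse_unique)

lemma tw_minus_right: "tw g (- h) = inverse (tw g h)"
  using tw_add_right[of g h "- h"] tw_nz[of g h] by (simp add: inverse_unique)

lemma t_sc: "t g * sc c = sc c * t g" by (rule sc_comm)
lemma t_sc': "t g * (sc c * M) = sc c * (t g * M)" by (rule sc_comm')

lemma sc_mult_sc: "(sc a * A) * (sc b * B) = sc (a * b) * (A * B)"
  by (simp add: mult.assoc sc_comm'[of A] sc_mult')

lemma mult_exchange: "a * b = c * a \<Longrightarrow> a * (b * d) = c * (a * d)" for a :: "'k lop"
  by (simp flip: mult.assoc)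

text \<open>Subtracting y_i x_i from x_i y_i = 1 + q_i y_i x_i gives z_i = 1 + (q_i - 1) y_i x_i.
  Once x_i is invertible this is solved for y_i; independence of the q_i makes q_i - 1
  nonzero.\<close>

fun rho :: "gen \<Rightarrow> 'k lop" where
  "rho (GX i) = t (xi i)"
| "rho (GY i) = sc (inverse (q i - 1)) * ((t (zi i) - 1) * t (- xi i))"
| "rho (GW i) = t (- zi i)"

lemma rho_Y: "i \<in> {1..n} \<Longrightarrow> rho (GY i) = sc (inverse (q i - 1)) * (sc (q i) * t (zi i - xi i) - t (- xi i))"
  by (simp add: left_diff_distrib t_mult tw_minus_left tw_xi_zi)

lemma xi_cancel: "t (xi i) * t (- xi i) = sc (inverse (tw (xi i) (xi i)))" "t (- xi i) * t (xi i) = sc (inverse (tw (xi i) (xi i)))"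
  by (simp_all add: t_mult tw_minus_left tw_minus_right)

lemma tw_xi_self: "i \<in> {1..n} \<Longrightarrow> tw (xi i) (xi i) = 1" by (simp add: tw_xi_xi)

lemma rho_YX: "i \<in> {1..n} \<Longrightarrow> rho (GY i) * rho (GX i) = sc (inverse (q i - 1)) * (t (zi i) - 1)"
  by (simp add: mult.assoc xi_cancel tw_xi_self)

lemma rho_XY: assumes "i \<in> {1..n}"
  shows "rho (GX i) * rho (GY i) = sc (inverse (q i - 1)) * (sc (q i) * t (zi i) - 1)"
proof -
  have "t (xi i) * (t (zi i) - 1) = (sc (q i) * t (zi i) - 1) * t (xi i)"
    using assms q_nz[OF assms] by (simp add: algebra_simps t_mult tw_xi_zi mult.assoc sc_mult')
  from mult_exchange[OF this] show ?thesis using assms by (simp add: t_sc' xi_cancel tw_xi_self)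
qed

lemma rho_Z: assumes "i \<in> {1..n}"
  shows "rho (GX i) * rho (GY i) - rho (GY i) * rho (GX i) = t (zi i)"
proof -
  have "rho (GX i) * rho (GY i) - rho (GY i) * rho (GX i) = sc (inverse (q i - 1)) * ((sc (q i) - 1) * t (zi i))"
    using assms by (simp add: rho_XY rho_YX algebra_simps del: rho.simps)
  also have "sc (q i) - 1 = sc (q i - 1)" by (simp add: sc_diff)
  finally show ?thesis using q_ne_1[OF assms] by (simp add: sc_mult')
qed

lemma rho_rels: "r \<in> fa_rels n q lam \<Longrightarrow> ev rho r = 0"
proof (erule ev_relsI[rotated -1])
  fix i j assume ij: "i \<in> {1..n}" "j \<in> {1..n}" "i < j"
  show "rho (GX i) * rho (GX j) = sc (lam i j) * (rho (GX j) * rho (GX i))"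
    using ij by (simp add: t_mult tw_xi_xi add.commute)
  have l: "lam j i = inverse (lam i j)" "lam i j \<noteq> 0" using ij lam_inv[of i j] lam_nz[of i j] by auto
  have c: "t (- xi a) * (t (zi b) - 1) = (t (zi b) - 1) * t (- xi a)" if "a \<in> {1..n}" "a \<noteq> b" for a b
    using that by (simp add: algebra_simps t_mult tw_xi_zi tw_minus_left)
  have p: "(t (zi j) - 1) * (t (zi i) - 1) = (t (zi i) - 1) * (t (zi j) - 1)"
    by (simp add: algebra_simps t_mult)
  have U: "t (- xi j) * t (- xi i) = sc (lam j i) * (t (- xi i) * t (- xi j))"
    using ij l by (simp add: t_mult tw_xi_xi tw_minus_left tw_minus_right add.commute sc_inverse)
  have "((t (zi j) - 1) * t (- xi j)) * ((t (zi i) - 1) * t (- xi i))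
      = (t (zi j) - 1) * ((t (zi i) - 1) * (t (- xi j) * t (- xi i)))"
    using mult_exchange[OF c[of j i]] ij by (simp add: mult.assoc)
  also have "\<dots> = sc (lam j i) * ((t (zi i) - 1) * ((t (zi j) - 1) * (t (- xi i) * t (- xi j))))"
    using mult_exchange[OF p] by (simp add: U sc_comm'[of "t (zi j) - 1"] sc_comm'[of "t (zi i) - 1"])
  also have "(t (zi j) - 1) * (t (- xi i) * t (- xi j)) = t (- xi i) * ((t (zi j) - 1) * t (- xi j))"
    using mult_exchange[OF c[of i j]] ij by simp
  finally have "((t (zi j) - 1) * t (- xi j)) * ((t (zi i) - 1) * t (- xi i)) =
     sc (lam j i) * (((t (zi i) - 1) * t (- xi i)) * ((t (zi j) - 1) * t (- xi j)))"
    by (simp add: mult.assoc)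
  then show "rho (GY j) * rho (GY i) = sc (lam j i) * (rho (GY i) * rho (GY j))"
    by (simp add: sc_mult_sc sc_mult' mult.commute mult.left_commute)
next
  fix i j assume ij: "i \<in> {1..n}" "j \<in> {1..n}" "i \<noteq> j"
  have l: "lam j i = inverse (lam i j)" "lam i j \<noteq> 0" using ij lam_inv[of i j] lam_nz[of i j] by auto
  have T: "t (xi i) * t (- xi j) = sc (lam j i) * (t (- xi j) * t (xi i))"
    using ij l by (cases i j rule: linorder_cases)
      (auto simp add: t_mult tw_xi_xi tw_minus_left tw_minus_right add.commute sc_mult')
  have "t (xi i) * (t (zi j) - 1) = (t (zi j) - 1) * t (xi i)"
    using ij by (simp add: algebra_simps t_mult tw_xi_zi add.commute)
  from mult_exchange[OF this]
  have "t (xi i) * ((t (zi j) - 1) * t (- xi j)) = (t (zi j) - 1) * (t (xi i) * t (- xi j))" .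
  also have "\<dots> = sc (lam j i) * (((t (zi j) - 1) * t (- xi j)) * t (xi i))"
    by (simp add: T sc_comm'[of "t (zi j) - 1"] mult.assoc)
  finally show "rho (GX i) * rho (GY j) = sc (lam j i) * (rho (GY j) * rho (GX i))"
    by (simp add: t_sc' sc_mult' mult.assoc mult.commute)
next
  fix i assume i: "i \<in> {1..n}"
  have "rho (GX i) * rho (GY i) - sc (q i) * (rho (GY i) * rho (GX i)) = sc (inverse (q i - 1)) * (sc (q i) - 1)"
    using i by (simp add: rho_XY rho_YX algebra_simps sc_mult sc_mult' del: rho.simps)
  also have "sc (q i) - 1 = sc (q i - 1)" by (simp add: sc_diff)
  finally show "rho (GX i) * rho (GY i) - sc (q i) * (rho (GY i) * rho (GX i)) = 1"
    using q_ne_1[OF i] by (simp add: sc_mult)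
  show "rho (GW i) * (rho (GX i) * rho (GY i) - rho (GY i) * rho (GX i)) = 1"
    "(rho (GX i) * rho (GY i) - rho (GY i) * rho (GX i)) * rho (GW i) = 1"
    using i by (simp_all only: rho_Z) (simp_all add: t_mult tw_minus_left)
qed

lemma rho_ideal: "f \<in> I \<Longrightarrow> ev rho f = 0"
  using ev_ideal[OF rho_rels] by blast

lemma rho_torus: "gen_idx g \<in> {1..n} \<Longrightarrow> rho g \<in> torus"
  by (cases g) (auto intro!: torus_mult torus_sc torus_diff torus_t torus_1 lattice_zi lattice_xi lattice_minus)

section \<open>Leading exponents of words\<close>

fun gen_weight :: "gen \<Rightarrow> nat \<Rightarrow> int" where
  "gen_weight (GX i) = xi i" | "gen_weight (GY i) = zi i - xi i" | "gen_weight (GW i) = - zi i"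

lemma lexpos_zi: "lexpos (zi i)"
  unfolding lexpos_def by (rule exI[of _ "2 * i"]) (auto simp: zi_def)

text \<open>The image of y_i has two terms, with exponents \<open>zi i - xi i\<close> and
  \<open>- xi i\<close>. They differ by \<open>zi i\<close>, which is lexicographically positive, so
  the term with z_i leads.\<close>

lemma rho_lead: assumes "gen_idx g \<in> {1..n}" shows "lead lexpos (rho g) (gen_weight g)"
proof (cases g)
  case (GY i)
  have "zi i \<noteq> 0" by (auto simp: fun_eq_iff zi_def fun_apply)
  then have ne: "zi i - xi i \<noteq> - xi i" by (metis diff_add_cancel add.left_inverse diff_conv_add_uminus add_eq_0_iff add_diff_cancel_right' diff_0)
  have [simp]: "zi i - xi i - - xi i = zi i" by simp
  show ?thesis using assms GY ne q_nz[of i] q_ne_1[of i] lexpos_zi[of i]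
    by (simp add: rho_Y lead_def coef_sc coef_diff coef_t del: rho.simps)
qed (auto simp: lead_def coef_t)

definition weight :: "gen list \<Rightarrow> nat \<Rightarrow> int" where "weight w = sum_list (map gen_weight w)"

lemma rho_word_torus: "word_ok n w \<Longrightarrow> prod_list (map rho w) \<in> torus"
  by (induction w) (auto simp: word_ok_def intro!: torus_1 torus_mult rho_torus)

lemma rho_word_lead: "word_ok n w \<Longrightarrow> lead lexpos (prod_list (map rho w)) (weight w)"
proof (induction w)
  case Nil
  have "lead lexpos (t 0) 0" unfolding lead_def coef_t by simp
  then show ?case by (simp add: weight_def)
next
  case (Cons g w)
  then show ?case
    using lead_mult[OF cone_lexpos rho_torus rho_word_torus rho_lead, of g w "weight w"]
    by (simp add: weight_def word_ok_def)
qed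

lemma weight_z: "weight w (2 * i) = int (count (mset w) (GY i)) - int (count (mset w) (GW i))"
proof (induction w)
  case (Cons g w) then show ?case by (cases g) (auto simp: weight_def fun_apply)
qed (simp add: weight_def fun_apply)

lemma weight_x: "weight w (Suc (2 * i)) = int (count (mset w) (GX i)) - int (count (mset w) (GY i))"
proof (induction w)
  case (Cons g w) then show ?case by (cases g) (auto simp: weight_def fun_apply)
qed (simp add: weight_def fun_apply)

text \<open>The weights of w_i, y_i and x_i sum to 0. Deleting one of each from a word leaves its
  weight unchanged, so such words have to be excluded before the weight can determine the
  letters.\<close>

definition normal_word :: "gen list \<Rightarrow> bool" where
  "normal_word w \<longleftrightarrow> (\<forall>i. \<not> (GX i \<in> set w \<and> GY i \<in> set w \<and> GW i \<in> set w))"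

text \<open>The weight fixes the differences between the numbers of letters x_i, y_i and w_i, hence
  these three counts up to a common integer; normality makes their minimum 0.\<close>

lemma normal_word_wt_inj:
  assumes "normal_word u" "normal_word v" "weight u = weight v" shows "mset u = mset v"
proof (rule multiset_eqI)
  have *: "count (mset u) (GX i) = count (mset v) (GX i) \<and> count (mset u) (GY i) = count (mset v) (GY i) \<and>
     count (mset u) (GW i) = count (mset v) (GW i)" for i
  proof -
    have z: "weight u (2 * i) = weight v (2 * i)" and x: "weight u (Suc (2 * i)) = weight v (Suc (2 * i))"
      using assms(3) by auto
    have c: "count (mset w) (GX i) = 0 \<or> count (mset w) (GY i) = 0 \<or> count (mset w) (GW i) = 0" if "normal_word w" for w
      using that by (auto simp: normal_word_def count_eq_zero_iff)
    show ?thesis using z x c[OF assms(1)] c[OF assms(2)] unfolding weight_z weight_x by linarith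
  qed
  show "count (mset u) g = count (mset v) g" for g using * by (cases g) auto
qed

section \<open>Faithfulness of the representation\<close>

text \<open>The ideal plus everything spanned by words of length below N. It stands in for passing
  to the associated graded algebra of the length filtration.\<close>

definition J :: "nat \<Rightarrow> 'k fa set" where
  "J N = {f1 + f2 | f1 f2. f1 \<in> I \<and> fa_valid n f2 \<and> (\<forall>v. f2 v \<noteq> 0 \<longrightarrow> length v < N)}"

lemma J_I: assumes "f \<in> I" shows "f \<in> J N"
proof -
  have "f = f + 0" "fa_valid n (0 :: 'k fa)" "\<forall>v. (0 :: 'k fa) v \<noteq> 0 \<longrightarrow> length v < N"
    by (auto simp: fa_valid_zero fun_apply)
  then show ?thesis unfolding J_def using assms by blast
qed

lemma J_low: "fa_valid n f \<Longrightarrow> (\<And>v. f v \<noteq> 0 \<Longrightarrow> length v < N) \<Longrightarrow> f \<in> J N"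
  unfolding J_def using I_zero by force

lemma J_add: assumes "f \<in> J N" "g \<in> J N" shows "f + g \<in> J N"
proof -
  obtain f1 f2 g1 g2 where f: "f = f1 + f2" "f1 \<in> I" "fa_valid n f2" "\<And>v. f2 v \<noteq> 0 \<Longrightarrow> length v < N"
    and g: "g = g1 + g2" "g1 \<in> I" "fa_valid n g2" "\<And>v. g2 v \<noteq> 0 \<Longrightarrow> length v < N"
    using assms unfolding J_def by blast
  have "f + g = (f1 + g1) + (f2 + g2)" using f g by (simp add: ac_simps)
  moreover have "length v < N" if "(f2 + g2) v \<noteq> 0" for v
    using that f(4)[of v] g(4)[of v] by (cases "f2 v = 0") (auto simp: fun_apply)
  ultimately show ?thesis unfolding J_def using I_add[OF f(2) g(2)] fa_valid_add[OF f(3) g(3)] by blast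
qed

lemma J_smult: assumes "f \<in> J N" shows "k \<odot> f \<in> J N"
proof -
  obtain f1 f2 where f: "f = f1 + f2" "f1 \<in> I" "fa_valid n f2" "\<And>v. f2 v \<noteq> 0 \<Longrightarrow> length v < N"
    using assms unfolding J_def by blast
  have "k \<odot> f = k \<odot> f1 + k \<odot> f2" using f by (simp add: fa_smult_add)
  moreover have "length v < N" if "(k \<odot> f2) v \<noteq> 0" for v
    using that f(4)[of v] by (auto simp: fa_smult_def)
  ultimately show ?thesis unfolding J_def using I_smult[OF f(2)] fa_valid_smult[OF f(3)] by blast
qed

lemma J_wd: assumes "f \<in> J N" "word_ok n a" "word_ok n b"
  shows "wd a \<star> f \<star> wd b \<in> J (length a + N + length b)"
proof -
  obtain f1 f2 where f: "f = f1 + f2" "f1 \<in> I" "fa_valid n f2" "\<And>v. f2 v \<noteq> 0 \<Longrightarrow> length v < N"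
    using assms(1) unfolding J_def by blast
  have v: "fa_valid n (wd a :: 'k fa)" "fa_valid n (wd b :: 'k fa)" using assms by (auto intro: fa_valid_wd)
  have "wd a \<star> f \<star> wd b = (wd a \<star> f1 \<star> wd b) + (wd a \<star> f2 \<star> wd b)"
    using f by (simp add: fa_ring)
  moreover have "length v < length a + N + length b" if nz: "(wd a \<star> f2 \<star> wd b) v \<noteq> 0" for v
  proof -
    obtain u c where *: "v = u @ c" "(wd a \<star> f2) u \<noteq> 0" "(wd b :: 'k fa) c \<noteq> 0" using fa_mult_support[OF nz] by blast
    obtain d e where "u = d @ e" "(wd a :: 'k fa) d \<noteq> 0" "f2 e \<noteq> 0" using fa_mult_support[OF *(2)] by blast
    then show ?thesis using * f(4)[of e] by (auto simp: wd_def split: if_splits)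
  qed
  ultimately show ?thesis unfolding J_def
    using I_mult_right[OF I_mult_left[OF f(2) v(1)] v(2)] fa_valid_mult[OF fa_valid_mult[OF v(1) f(3)] v(2)] by blast
qed

text \<open>Modulo shorter words, all letters commute up to nonzero scalars, so a word only matters through its multiset.\<close>

definition word_equiv :: "gen list \<Rightarrow> gen list \<Rightarrow> bool" where
  "word_equiv u v \<longleftrightarrow> length u = length v \<and> (\<exists>c. c \<noteq> 0 \<and> wd u - c \<odot> wd v \<in> J (length u))"

lemma word_equiv_refl: "word_equiv u u"
  unfolding word_equiv_def by (auto intro!: exI[of _ 1] J_I simp: fa_smult_one I_zero)

lemma word_equiv_trans: assumes "word_equiv u v" "word_equiv v w" shows "word_equiv u w"
proof -
  obtain c d where c: "c \<noteq> 0" "wd u - c \<odot> wd v \<in> J (length u)" and d: "d \<noteq> 0" "wd v - d \<odot> wd w \<in> J (length u)"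
    and l: "length u = length w"
    using assms unfolding word_equiv_def by auto
  have "(wd u - c \<odot> wd v) + c \<odot> (wd v - d \<odot> wd w) \<in> J (length u)"
    by (intro J_add J_smult c d)
  then have "wd u - (c * d) \<odot> wd w \<in> J (length u)"
    by (simp add: fa_smult_diff fa_smult_smult)
  then show ?thesis unfolding word_equiv_def using c d l by (auto intro!: exI[of _ "c * d"])
qed

lemma word_equiv_context: assumes "word_equiv u v" "word_ok n a" "word_ok n b" shows "word_equiv (a @ u @ b) (a @ v @ b)"
proof -
  obtain c where c: "c \<noteq> 0" "wd u - c \<odot> wd v \<in> J (length u)" and l: "length u = length v"
    using assms unfolding word_equiv_def by auto
  have "wd (a @ u @ b) - c \<odot> wd (a @ v @ b) = wd a \<star> (wd u - c \<odot> wd v) \<star> wd b"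
    by (simp add: fa_ring fa_mult_wd)
  then show ?thesis unfolding word_equiv_def using J_wd[OF c(2) assms(2,3)] c(1) l by (auto simp: ac_simps)
qed

lemma word_equiv_qcomm: "qcomm k (fa_gen g) (fa_gen h) \<Longrightarrow> k \<noteq> 0 \<Longrightarrow> word_equiv [g, h] [h, g]"
  unfolding qcomm_def word_equiv_def by (auto simp: fa_gen_eq fa_mult_wd intro!: exI[of _ k] J_I)

lemma word_equiv_qcomm': "qcomm k (fa_gen h) (fa_gen g) \<Longrightarrow> k \<noteq> 0 \<Longrightarrow> word_equiv [g, h] [h, g]"
  using word_equiv_qcomm[OF qcomm_swap] by simp

lemma J_one: "fa_one \<in> J (Suc N)"
  by (rule J_low[OF fa_valid_one]) (auto simp: fa_one_def split: if_splits)

lemma word_equiv_XY: assumes "i \<in> {1..n}" shows "word_equiv [GX i, GY i] [GY i, GX i]" "word_equiv [GY i, GX i] [GX i, GY i]"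
proof -
  have "(X i \<star> Y i - q i \<odot> (Y i \<star> X i) - fa_one) + fa_one \<in> J 2"
    using J_I[OF rel_XY[OF assms]] J_one[of 1] by (intro J_add) (auto simp: numeral_2_eq_2)
  then have *: "wd [GX i, GY i] - q i \<odot> wd [GY i, GX i] \<in> J 2" by (simp add: fa_gen_eq fa_mult_wd)
  then show "word_equiv [GX i, GY i] [GY i, GX i]"
    unfolding word_equiv_def using q_nz[OF assms] by (auto intro!: exI[of _ "q i"] simp: numeral_2_eq_2)
  have "(- inverse (q i)) \<odot> (wd [GX i, GY i] - q i \<odot> wd [GY i, GX i]) = wd [GY i, GX i] - inverse (q i) \<odot> wd [GX i, GY i]"
    using q_nz[OF assms] by (auto simp: fun_eq_iff fa_smult_def fun_apply algebra_simps)
  then have "wd [GY i, GX i] - inverse (q i) \<odot> wd [GX i, GY i] \<in> J 2"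
    using J_smult[OF *, of "- inverse (q i)"] by simp
  then show "word_equiv [GY i, GX i] [GX i, GY i]"
    unfolding word_equiv_def using q_nz[OF assms] by (auto intro!: exI[of _ "inverse (q i)"] simp: numeral_2_eq_2)
qed

lemma word_equiv_swap: assumes g: "gen_idx g \<in> {1..n}" and h: "gen_idx h \<in> {1..n}" shows "word_equiv [g, h] [h, g]"
proof (cases g)
  case (GX i)
  show ?thesis
  proof (cases h)
    case (GX j)
    then show ?thesis using \<open>g = _\<close> g h qcomm_XX[of i j] lam_nz[of i j] by (cases "i = j") (auto intro: word_equiv_refl word_equiv_qcomm)
  next
    case (GY j)
    then show ?thesis using \<open>g = _\<close> g h qcomm_XY[of i j] lam_nz[of j i] word_equiv_XY[of i] by (cases "i = j") (auto intro: word_equiv_refl word_equiv_qcomm)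
  next
    case (GW j)
    then show ?thesis using \<open>g = _\<close> g h qcomm_XW[of j i] q_nz[of i] by (cases "i = j") (auto intro: word_equiv_qcomm)
  qed
next
  case (GY i)
  show ?thesis
  proof (cases h)
    case (GX j)
    then show ?thesis using \<open>g = _\<close> g h qcomm_YX[of i j] lam_nz[of j i] word_equiv_XY[of i] by (cases "i = j") (auto intro: word_equiv_refl word_equiv_qcomm)
  next
    case (GY j)
    then show ?thesis using \<open>g = _\<close> g h qcomm_YY[of i j] lam_nz[of i j] by (cases "i = j") (auto intro: word_equiv_refl word_equiv_qcomm)
  next
    case (GW j)
    then show ?thesis using \<open>g = _\<close> g h qcomm_YW[of j i] q_nz[of i] by (cases "i = j") (auto intro: word_equiv_qcomm)
  qed
next
  case (GW i)
  show ?thesis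
  proof (cases h)
    case (GX j)
    then show ?thesis using \<open>g = _\<close> g h qcomm_XW[of i j] q_nz[of i] by (cases "i = j") (auto intro: word_equiv_qcomm')
  next
    case (GY j)
    then show ?thesis using \<open>g = _\<close> g h qcomm_YW[of i j] q_nz[of i] by (cases "i = j") (auto intro: word_equiv_qcomm')
  next
    case (GW j)
    then show ?thesis using \<open>g = _\<close> g h qcomm_WW[of i j] by (auto intro: word_equiv_qcomm)
  qed
qed

lemma word_ok_Cons: "word_ok n (g # w) \<longleftrightarrow> gen_idx g \<in> {1..n} \<and> word_ok n w"
  by (simp add: word_ok_def)

lemma word_ok_Nil: "word_ok n []" by (simp add: word_ok_def)

lemma word_equiv_move: "gen_idx g \<in> {1..n} \<Longrightarrow> word_ok n (v @ w) \<Longrightarrow> word_equiv (g # v @ w) (v @ g # w)"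
proof (induction v)
  case Nil then show ?case by (simp add: word_equiv_refl)
next
  case (Cons h v)
  then have ok: "gen_idx h \<in> {1..n}" "word_ok n (v @ w)" by (auto simp: word_ok_Cons)
  have "word_equiv (g # h # v @ w) (h # g # v @ w)"
    using word_equiv_context[OF word_equiv_swap[OF Cons.prems(1) ok(1)] word_ok_Nil ok(2)] by simp
  moreover have "word_equiv (h # g # v @ w) (h # v @ g # w)"
    using word_equiv_context[OF Cons.IH[OF Cons.prems(1) ok(2)], of "[h]" "[]"] ok by (simp add: word_ok_Cons word_ok_Nil)
  ultimately show ?case using word_equiv_trans by simp
qed

lemma word_equiv_mset: "mset u = mset v \<Longrightarrow> word_ok n u \<Longrightarrow> word_equiv u v"
proof (induction u arbitrary: v)
  case Nil then show ?case by (simp add: word_equiv_refl)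
next
  case (Cons g u)
  then have "g \<in> set v" by (metis list.set_intros(1) mset_eq_setD)
  then obtain v1 v2 where v: "v = v1 @ g # v2" by (meson split_list)
  then have m: "mset u = mset (v1 @ v2)" using Cons.prems(1) by simp
  have "word_ok n (v1 @ v2)" using Cons.prems(2) mset_eq_setD[OF m] by (simp add: word_ok_def)
  moreover have "word_equiv (g # u) (g # v1 @ v2)"
    using word_equiv_context[OF Cons.IH[OF m], of "[g]" "[]"] Cons.prems(2) by (simp add: word_ok_Cons word_ok_Nil)
  moreover have "gen_idx g \<in> {1..n}" using Cons.prems(2) by (simp add: word_ok_Cons)
  ultimately show ?case using word_equiv_move[of g v1 v2] word_equiv_trans v by blast
qed

text \<open>Multiplying z_i = 1 + (q_i - 1) y_i x_i by w_i gives (q_i - 1) w_i y_i x_i = 1 - w_i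
  modulo the ideal; the right side has length at most 1, and q_i is not 1.\<close>

lemma J_WYX: assumes "i \<in> {1..n}" shows "wd [GW i, GY i, GX i] \<in> J 3"
proof -
  have W: "fa_valid n (W i)" using assms by (intro fa_valid_gen) auto
  have "(W i \<star> Z i - fa_one) - W i \<star> (X i \<star> Y i - q i \<odot> (Y i \<star> X i) - fa_one) \<in> I"
    by (intro I_diff I_mult_left[OF _ W] rel_WZ rel_XY assms)
  then have *: "(W i \<star> Z i - fa_one) - W i \<star> (X i \<star> Y i - q i \<odot> (Y i \<star> X i) - fa_one) + fa_one + (-1) \<odot> W i \<in> J 3"
    using W by (intro J_add J_I J_smult J_one[of 2, simplified] J_low[of "W i"])
      (auto simp: numeral_3_eq_3 fa_gen_def split: if_splits intro: J_one)
  have "(W i \<star> Z i - fa_one) - W i \<star> (X i \<star> Y i - q i \<odot> (Y i \<star> X i) - fa_one) + fa_one + (-1) \<odot> W i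
     = (q i - 1) \<odot> wd [GW i, GY i, GX i]"
    by (simp add: Z_def fa_sub_eq fa_ring fa_gen_eq fa_mult_wd)
      (auto simp: fun_eq_iff fun_apply fa_smult_def algebra_simps)
  then have "inverse (q i - 1) \<odot> (q i - 1) \<odot> wd [GW i, GY i, GX i] \<in> J 3" using J_smult[OF *] by simp
  then show ?thesis using q_ne_1[OF assms] by (simp add: fa_smult_smult fa_smult_one)
qed

section \<open>Reduction to normal words\<close>

definition canonical_word :: "gen multiset \<Rightarrow> gen list" where "canonical_word M = (SOME w. mset w = M)"

lemma mset_canonical_word: "mset (canonical_word M) = M"
  unfolding canonical_word_def by (rule someI_ex) (rule ex_mset)

text \<open>Weights only see multisets of letters; keeping one arbitrarily chosen ordering per
  multiset is what makes \<open>weight\<close> injective on \<open>canon\<close>.\<close>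

definition canon :: "gen list set" where
  "canon = {w. word_ok n w \<and> normal_word w \<and> w = canonical_word (mset w)}"

definition reducible :: "'k fa \<Rightarrow> bool" where
  "reducible f \<longleftrightarrow> (\<exists>h. fa_valid n h \<and> (\<forall>v. h v \<noteq> 0 \<longrightarrow> v \<in> canon) \<and> f - h \<in> I)"

lemma reducible_I: "f \<in> I \<Longrightarrow> reducible f"
  unfolding reducible_def by (intro exI[of _ 0]) (auto simp: fa_valid_zero fun_apply)

lemma reducible_add: assumes "reducible f" "reducible g" shows "reducible (f + g)"
proof -
  obtain h k where h: "fa_valid n h" "\<forall>v. h v \<noteq> 0 \<longrightarrow> v \<in> canon" "f - h \<in> I"
    and k: "fa_valid n k" "\<forall>v. k v \<noteq> 0 \<longrightarrow> v \<in> canon" "g - k \<in> I" using assms unfolding reducible_def by blast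
  have "(f + g) - (h + k) \<in> I" using I_add[OF h(3) k(3)] by (simp add: algebra_simps)
  moreover have "\<forall>v. (h + k) v \<noteq> 0 \<longrightarrow> v \<in> canon" using h(2) k(2) by (auto simp: fun_apply) (metis add.right_neutral)
  ultimately show ?thesis unfolding reducible_def using fa_valid_add[OF h(1) k(1)] by blast
qed

lemma reducible_smult: assumes "reducible f" shows "reducible (c \<odot> f)"
proof -
  obtain h where h: "fa_valid n h" "\<forall>v. h v \<noteq> 0 \<longrightarrow> v \<in> canon" "f - h \<in> I" using assms unfolding reducible_def by blast
  have "c \<odot> f - c \<odot> h \<in> I" using I_smult[OF h(3)] by (simp add: fa_smult_diff)
  moreover have "\<forall>v. (c \<odot> h) v \<noteq> 0 \<longrightarrow> v \<in> canon" using h(2) by (auto simp: fa_smult_def)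
  ultimately show ?thesis unfolding reducible_def using fa_valid_smult[OF h(1)] by blast
qed

lemma reducible_valid: assumes "fa_valid n f" "\<And>w. f w \<noteq> 0 \<Longrightarrow> reducible (wd w)" shows "reducible f"
proof -
  have fin: "finite {w. f w \<noteq> 0}" using assms by (auto simp: fa_valid_iff)
  have "reducible (\<Sum>w\<in>S. f w \<odot> wd w)" if "finite S" "S \<subseteq> {w. f w \<noteq> 0}" for S
    using that
  proof (induction S rule: finite_induct)
    case (insert w F)
    then have "reducible (f w \<odot> wd w)" "reducible (\<Sum>w\<in>F. f w \<odot> wd w)" by (auto intro!: reducible_smult assms)
    then show ?case using insert.hyps by (simp add: reducible_add)
  qed (simp add: reducible_I I_zero)
  from this[OF fin order_refl] show ?thesis using fa_expand[OF fin, of f] by simp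
qed

lemma reducible_J: assumes "f \<in> J N" "\<And>w. length w < N \<Longrightarrow> word_ok n w \<Longrightarrow> reducible (wd w)" shows "reducible f"
proof -
  obtain f1 f2 where f: "f = f1 + f2" "f1 \<in> I" "fa_valid n f2" "\<And>v. f2 v \<noteq> 0 \<Longrightarrow> length v < N"
    using assms(1) unfolding J_def by blast
  have "reducible (wd w)" if "f2 w \<noteq> 0" for w
    using assms(2)[OF f(4)[OF that]] f(3) that by (simp add: fa_valid_iff)
  then have "reducible f2" by (rule reducible_valid[OF f(3)])
  then show ?thesis using reducible_add[OF reducible_I[OF f(2)]] f(1) by simp
qed

text \<open>Induction on the length. A word may be reordered at the cost of shorter words; a normal
  one goes to its canonical ordering, any other one to an ordering that starts with w_i y_i x_i and
  is therefore a combination of shorter words modulo the ideal.\<close>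

lemma red_word: "word_ok n w \<Longrightarrow> reducible (wd w)"
proof (induction "length w" arbitrary: w rule: less_induct)
  case less
  have reducible_pc: "reducible (wd w)" if "word_equiv w v" "reducible (wd v)" for v
  proof -
    obtain c where "wd w - c \<odot> wd v \<in> J (length w)" using \<open>word_equiv w v\<close> by (auto simp: word_equiv_def)
    then have "reducible (wd w - c \<odot> wd v)" using less.hyps by (rule reducible_J)
    from reducible_add[OF this reducible_smult[OF that(2), of c]] show ?thesis by simp
  qed
  show ?case
  proof (cases "normal_word w")
    case True
    let ?v = "canonical_word (mset w)"
    have m: "mset w = mset ?v" by (simp add: mset_canonical_word)
    then have "set ?v = set w" by (metis mset_eq_setD)
    then have "?v \<in> canon" using True less.prems m by (simp add: canon_def normal_word_def word_ok_def)
    then have "reducible (wd ?v)" unfolding reducible_def using I_zero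
      by (intro exI[of _ "wd ?v"]) (auto simp: wd_def canon_def intro!: fa_valid_wd[unfolded wd_def])
    then show ?thesis using reducible_pc word_equiv_mset[OF m less.prems] by blast
  next
    case False
    then obtain i where i: "GX i \<in> set w" "GY i \<in> set w" "GW i \<in> set w" by (auto simp: normal_word_def)
    have idx: "i \<in> {1..n}" using i less.prems by (force simp: word_ok_def)
    define M where "M = mset w - {#GW i, GY i, GX i#}"
    have "{#GW i, GY i, GX i#} \<subseteq># mset w"
      using i by (simp add: insert_subset_eq_iff in_diff_count)
    then have "mset w = {#GW i, GY i, GX i#} + M"
      unfolding M_def by (simp only: subset_mset.add_diff_inverse)
    then have m: "mset w = mset ([GW i, GY i, GX i] @ canonical_word M)" by (simp add: mset_canonical_word)
    then have ok: "word_ok n ([GW i, GY i, GX i] @ canonical_word M)" using less.prems by (metis mset_eq_setD word_ok_def)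
    then have okM: "word_ok n (canonical_word M)" by (simp add: word_ok_Cons)
    have "wd [] \<star> wd [GW i, GY i, GX i] \<star> wd (canonical_word M) \<in> J (length ([]::gen list) + 3 + length (canonical_word M))"
      by (rule J_wd[OF J_WYX[OF idx] word_ok_Nil okM])
    moreover have "length w = 3 + length (canonical_word M)" using arg_cong[OF m, of size] by simp
    ultimately have "wd ([GW i, GY i, GX i] @ canonical_word M) \<in> J (length w)" by (simp add: fa_mult_wd)
    then have "reducible (wd ([GW i, GY i, GX i] @ canonical_word M))" using less.hyps by (rule reducible_J)
    then show ?thesis using reducible_pc word_equiv_mset[OF m less.prems] by blast
  qed
qed

text \<open>After reduction f is a combination of canonical words. Their leading exponents are
  pairwise distinct, so the coefficient at the largest of them comes from a single word and cannot
  cancel.\<close>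

theorem rho_faithful: assumes f: "fa_valid n f" and 0: "ev rho f = 0" shows "f \<in> I"
proof -
  have "reducible f" by (rule reducible_valid[OF f]) (use f in \<open>auto simp: fa_valid_iff intro: red_word\<close>)
  then obtain h where h: "fa_valid n h" "\<And>v. h v \<noteq> 0 \<Longrightarrow> v \<in> canon" "f - h \<in> I" unfolding reducible_def by blast
  have h0: "ev rho h = 0" using rho_ideal[OF h(3)] ev_diff[OF f h(1), of rho] 0 by simp
  have fin: "finite {w. h w \<noteq> 0}" using h(1) by (simp add: fa_valid_iff)
  have "{w. h w \<noteq> 0} = {}"
  proof (rule ccontr)
    assume "{w. h w \<noteq> 0} \<noteq> {}"
    then obtain g where g: "g \<in> weight ` {w. h w \<noteq> 0}" and max: "\<And>k. k \<in> weight ` {w. h w \<noteq> 0} \<Longrightarrow> k = g \<or> lexpos (g - k)"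
      using cone_max[OF cone_lexpos, of "weight ` {w. h w \<noteq> 0}"] fin by blast
    obtain w where w: "h w \<noteq> 0" "g = weight w" using g by blast
    have lw: "lead lexpos (prod_list (map rho v)) (weight v)" if "h v \<noteq> 0" for v
      using h(2)[OF that] by (intro rho_word_lead) (simp add: canon_def)
    \<comment> \<open>If g occurred in the image of v, the leading exponent of v would be at least
      g, hence equal to g by maximality, and v would be w.\<close>
    have other: "coef (prod_list (map rho v)) g = 0" if v: "h v \<noteq> 0" "v \<noteq> w" for v
    proof (rule ccontr)
      assume "coef (prod_list (map rho v)) g \<noteq> 0"
      then have "g = weight v \<or> lexpos (weight v - g)" using lw[OF v(1)] unfolding lead_def by blast
      moreover have "weight v = g \<or> lexpos (g - weight v)" using max v(1) by blast
      ultimately have "weight v = weight w" using cone_antisym[OF cone_lexpos, of "g - weight v"] w(2) by (metis minus_diff_eq)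
      then have "mset v = mset w" using normal_word_wt_inj h(2)[OF v(1)] h(2)[OF w(1)] by (simp add: canon_def)
      then show False using h(2)[OF v(1)] h(2)[OF w(1)] v(2) unfolding canon_def by (metis (mono_tags, lifting) mem_Collect_eq)
    qed
    have "coef (ev rho h) g = (\<Sum>v | h v \<noteq> 0. if v = w then h w * coef (prod_list (map rho w)) g else 0)"
      unfolding ev_def coef_sum coef_sc by (intro sum.cong refl) (auto simp: other)
    also have "\<dots> = h w * coef (prod_list (map rho w)) g" using fin w(1) by simp
    also have "\<dots> \<noteq> 0" using w lw[OF w(1)] by (simp add: lead_def)
    finally show False by (simp add: h0 coef_0)
  qed
  then have "h = 0" by (auto simp: fun_eq_iff fun_apply)
  then show ?thesis using h(3) by simp
qed

text \<open>Congruence is membership in an inductively generated ideal; faithfulness turns it into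
  an equality of operators, so that automorphisms can be studied in the image.\<close>

lemma rho_cong: assumes "fa_valid n a" "fa_valid n b" shows "fa_cong n q lam a b \<longleftrightarrow> ev rho a = ev rho b"
proof -
  have "ev rho (a - b) = ev rho a - ev rho b" by (rule ev_diff[OF assms])
  then show ?thesis unfolding cong_iff
    using rho_ideal[of "a - b"] rho_faithful[OF fa_valid_diff[OF assms]] by auto
qed

section \<open>The image algebra and its degree-zero part\<close>

definition B :: "'k lop set" where "B = ev rho ` {f. fa_valid n f}"

lemma B_ev: "fa_valid n f \<Longrightarrow> ev rho f \<in> B" by (auto simp: B_def)

lemma B_gen: "gen_idx g \<in> {1..n} \<Longrightarrow> rho g \<in> B"
  using B_ev[OF fa_valid_gen] by (simp add: ev_gen)

lemma B_add: "L \<in> B \<Longrightarrow> M \<in> B \<Longrightarrow> L + M \<in> B"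
  unfolding B_def by (auto simp flip: ev_add[of n] intro!: imageI fa_valid_add)

lemma B_mult: "L \<in> B \<Longrightarrow> M \<in> B \<Longrightarrow> L * M \<in> B"
  unfolding B_def by (auto simp flip: ev_mult[of n] intro!: imageI fa_valid_mult)

lemma B_sc: "L \<in> B \<Longrightarrow> sc c * L \<in> B"
  unfolding B_def by (auto simp flip: ev_smult[of n] intro!: imageI fa_valid_smult)

lemma B_1: "1 \<in> B"
  using B_ev[OF fa_valid_one] by (simp add: ev_one)

lemma B_0: "0 \<in> B"
  using B_ev[OF fa_valid_zero] by (simp add: ev_0)

lemma B_diff: "L \<in> B \<Longrightarrow> M \<in> B \<Longrightarrow> L - M \<in> B"
  using B_add[OF _ B_sc, of L M "-1"] by (simp add: sc_minus)

lemma B_sum: "(\<And>x. x \<in> A \<Longrightarrow> f x \<in> B) \<Longrightarrow> (\<Sum>x\<in>A. f x) \<in> B"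
  by (induction A rule: infinite_finite_induct) (auto intro: B_0 B_add)

lemma B_torus: "L \<in> B \<Longrightarrow> L \<in> torus"
  unfolding B_def ev_def by (auto intro!: torus_sum torus_sc rho_word_torus simp: fa_valid_iff)

section \<open>Laurent monomials in the z_i\<close>

definition zexp :: "(nat \<Rightarrow> int) \<Rightarrow> nat \<Rightarrow> int" where
  "zexp a = (\<lambda>k. if even k \<and> k div 2 \<in> {1..n} then a (k div 2) else 0)"

definition unit_vec :: "nat \<Rightarrow> int \<Rightarrow> nat \<Rightarrow> int" where "unit_vec i m = (\<lambda>j. if j = i then m else 0)"

abbreviation tz :: "(nat \<Rightarrow> int) \<Rightarrow> 'k lop" where "tz a \<equiv> t (zexp a)"

lemma zexp_simps: "i \<in> {1..n} \<Longrightarrow> zexp a (2 * i) = a i" "zexp a (Suc (2 * i)) = 0"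
  by (auto simp: zexp_def)

lemma zexp_add: "zexp (a + b) = zexp a + zexp b" by (auto simp: zexp_def fun_apply)
lemma zexp_minus: "zexp (- a) = - zexp a" by (auto simp: zexp_def fun_apply)
lemma zexp_0: "zexp 0 = 0" by (auto simp: zexp_def fun_apply)
lemma zexp_const_0 [simp]: "zexp (\<lambda>_. 0) = 0" by (auto simp: zexp_def fun_eq_iff fun_apply)
lemma zexp_cong: "(\<And>i. i \<in> {1..n} \<Longrightarrow> a i = b i) \<Longrightarrow> zexp a = zexp b" by (auto simp: zexp_def)
lemma zexp_eq_iff: "zexp a = zexp b \<longleftrightarrow> (\<forall>i\<in>{1..n}. a i = b i)"
  using zexp_cong[of a b] by (metis zexp_simps(1))

lemma lattice_zexp: "zexp a \<in> lattice n"
  by (auto simp: zexp_def lattice_def)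

lemma zexp_un: "i \<in> {1..n} \<Longrightarrow> zexp (unit_vec i 1) = zi i" "i \<in> {1..n} \<Longrightarrow> zexp (unit_vec i (- 1)) = - zi i"
  by (auto simp: fun_eq_iff zexp_def unit_vec_def zi_def fun_apply elim!: evenE)

lemma lattice_zexpI:
  assumes "g \<in> lattice n" "\<And>i. i \<in> {1..n} \<Longrightarrow> g (Suc (2 * i)) = 0"
  shows "g = zexp (\<lambda>i. g (2 * i))"
  by (rule lattice_eqI[OF assms(1) lattice_zexp]) (auto simp: zexp_simps assms)

lemma tw_zexp [simp]: "tw (zexp a) h = 1"
  by (simp add: tw_def zexp_simps)

lemma tw_right_zexp: "tw h (zexp a) = (\<Prod>i\<in>{1..n}. q i powi (- (h (Suc (2 * i)) * a i)))"
  by (simp add: tw_def zexp_simps)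

lemma tz_mult: "tz a * tz b = tz (a + b)"
  by (simp add: t_mult zexp_add)

lemma ev_pow: "fa_valid n f \<Longrightarrow> ev s (fa_pow f m) = ev s f ^ m"
  by (induction m) (auto simp: ev_one ev_mult[of n] fa_valid_pow)

lemma ev_rho_Z: "i \<in> {1..n} \<Longrightarrow> ev rho (Z i) = t (zi i)"
  using ev_Z[of i n rho] rho_Z[of i] by simp

lemma sc_tz_power: "(sc c * tz a) ^ m = sc (c ^ m) * tz (\<lambda>j. int m * a j)"
proof (induction m)
  case (Suc m)
  have "zexp (a + (\<lambda>j. int m * a j)) = zexp (\<lambda>j. int (Suc m) * a j)"
    by (intro zexp_cong) (simp add: fun_apply algebra_simps)
  then show ?case using Suc by (simp add: sc_mult_sc tz_mult)
qed simp

text \<open>Both \<open>rho\<close> and the images \<open>s\<close> of the generators considered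
  later send every z_i to a scalar times a power of the same z_i. Powers and products of the z_i are
  evaluated once for this common form; the clause for w_i supplies the negative powers.\<close>

definition z_diag :: "(gen \<Rightarrow> 'k lop) \<Rightarrow> (nat \<Rightarrow> 'k) \<Rightarrow> (nat \<Rightarrow> int) \<Rightarrow> bool" where
  "z_diag s \<kappa> \<sigma> \<longleftrightarrow> (\<forall>i\<in>{1..n}. \<kappa> i \<noteq> 0 \<and> ev s (Z i) = sc (\<kappa> i) * tz (unit_vec i (\<sigma> i)) \<and>
     s (GW i) = sc (inverse (\<kappa> i)) * tz (unit_vec i (- \<sigma> i)))"

lemma ev_zpow_diag: assumes s: "z_diag s \<kappa> \<sigma>" and i: "i \<in> {1..n}"
  shows "ev s (zpow i k) = sc (\<kappa> i powi k) * tz (unit_vec i (\<sigma> i * k))"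
proof (cases "k \<ge> 0")
  case True
  have "zexp (\<lambda>j. int (nat k) * unit_vec i (\<sigma> i) j) = zexp (unit_vec i (\<sigma> i * k))"
    using True by (intro zexp_cong) (auto simp: unit_vec_def)
  then show ?thesis
    using True s i by (simp add: zpow_def ev_pow fa_valid_Z z_diag_def sc_tz_power power_int_def)
next
  case False
  have "zexp (\<lambda>j. int (nat (- k)) * unit_vec i (- \<sigma> i) j) = zexp (unit_vec i (\<sigma> i * k))"
    using False by (intro zexp_cong) (auto simp: unit_vec_def)
  then show ?thesis
    using False s i by (simp add: zpow_def ev_pow fa_valid_gen ev_gen z_diag_def sc_tz_power power_int_def)
qed

lemma ev_zprod_diag: assumes s: "z_diag s \<kappa> \<sigma>" and P: "P \<subseteq> {1..n}"
  shows "ev s (zprod P e) = sc (\<Prod>j\<in>P. \<kappa> j powi e j) * tz (\<lambda>j. if j \<in> P then \<sigma> j * e j else 0)"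
proof -
  have v: "set xs \<subseteq> {1..n} \<Longrightarrow> fa_valid n (foldr (\<lambda>j acc. zpow j (e j) \<star> acc) xs (fa_one :: 'k fa))" for xs
    by (induction xs) (auto intro!: fa_valid_one fa_valid_mult fa_valid_zpow)
  have "set xs \<subseteq> {1..n} \<Longrightarrow> distinct xs \<Longrightarrow> ev s (foldr (\<lambda>j acc. zpow j (e j) \<star> acc) xs fa_one) =
     sc (\<Prod>j\<in>set xs. \<kappa> j powi e j) * tz (\<lambda>j. if j \<in> set xs then \<sigma> j * e j else 0)" for xs
  proof (induction xs)
    case Nil then show ?case by (simp add: ev_one)
  next
    case (Cons i xs)
    have "ev s (foldr (\<lambda>j acc. zpow j (e j) \<star> acc) (i # xs) fa_one)
      = ev s (zpow i (e i)) * ev s (foldr (\<lambda>j acc. zpow j (e j) \<star> acc) xs fa_one)"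
      using Cons.prems v[of xs] by (simp add: ev_mult[of n] fa_valid_zpow)
    also have "\<dots> = (sc (\<kappa> i powi e i) * tz (unit_vec i (\<sigma> i * e i))) *
        (sc (\<Prod>j\<in>set xs. \<kappa> j powi e j) * tz (\<lambda>j. if j \<in> set xs then \<sigma> j * e j else 0))"
      using Cons by (simp add: ev_zpow_diag[OF s])
    also have "\<dots> = sc (\<Prod>j\<in>set (i # xs). \<kappa> j powi e j) * tz (unit_vec i (\<sigma> i * e i) + (\<lambda>j. if j \<in> set xs then \<sigma> j * e j else 0))"
      using Cons.prems by (simp add: sc_mult_sc tz_mult)
    also have "zexp (unit_vec i (\<sigma> i * e i) + (\<lambda>j. if j \<in> set xs then \<sigma> j * e j else 0))
        = zexp (\<lambda>j. if j \<in> set (i # xs) then \<sigma> j * e j else 0)"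
      using Cons.prems by (intro zexp_cong) (auto simp: unit_vec_def fun_apply)
    finally show ?case .
  qed
  from this[of "sorted_list_of_set P"] show ?thesis
    using P finite_subset[OF P] by (simp add: zprod_def)
qed

lemma z_diag_rho: "z_diag rho (\<lambda>_. 1) (\<lambda>_. 1)"
  by (simp add: z_diag_def ev_rho_Z zexp_un)

lemma ev_zpow: "i \<in> {1..n} \<Longrightarrow> ev rho (zpow i k) = tz (unit_vec i k)"
  by (simp add: ev_zpow_diag[OF z_diag_rho])

lemma ev_zprod: "P \<subseteq> {1..n} \<Longrightarrow> ev rho (zprod P e) = tz (\<lambda>j. if j \<in> P then e j else 0)"
  unfolding ev_zprod_diag[OF z_diag_rho] by (simp cong: if_cong)

lemma B_tz: "tz a \<in> B"
proof -
  have "ev rho (zprod {1..n} a) = tz a" unfolding ev_zprod[OF order_refl] by (intro arg_cong[of _ _ t] zexp_cong) auto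
  then show ?thesis using B_ev[OF fa_valid_zprod[OF order_refl, of n a]] by simp
qed

section \<open>Laurent polynomials in the z_i\<close>

definition D :: "'k lop set" where
  "D = {L \<in> torus. \<forall>h. coef L h \<noteq> 0 \<longrightarrow> (\<forall>i\<in>{1..n}. h (Suc (2 * i)) = 0)}"

lemma D_torus: "L \<in> D \<Longrightarrow> L \<in> torus" by (simp add: D_def)

lemma D_expand: assumes "L \<in> D" shows "L = (\<Sum>g\<in>supp L. sc (coef L g) * tz (\<lambda>i. g (2 * i)))"
proof -
  have "L = (\<Sum>g\<in>supp L. sc (coef L g) * t g)" by (rule torus_expand[OF D_torus[OF assms]])
  also have "\<dots> = (\<Sum>g\<in>supp L. sc (coef L g) * tz (\<lambda>i. g (2 * i)))"
  proof (intro sum.cong refl)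
    fix g assume g: "g \<in> supp L"
    then have "g = zexp (\<lambda>i. g (2 * i))" using assms torus_lattice[OF D_torus[OF assms]]
      by (intro lattice_zexpI) (auto simp: D_def)
    then show "sc (coef L g) * t g = sc (coef L g) * tz (\<lambda>i. g (2 * i))" by simp
  qed
  finally show ?thesis .
qed

lemma D_B: "L \<in> D \<Longrightarrow> L \<in> B"
  by (subst D_expand) (auto intro!: B_sum B_sc B_tz)

lemma D_tz: "tz a \<in> D"
  by (auto simp: D_def coef_t zexp_simps intro!: torus_t lattice_zexp split: if_splits)

lemma D_add: "L \<in> D \<Longrightarrow> M \<in> D \<Longrightarrow> L + M \<in> D"
proof -
  assume LM: "L \<in> D" "M \<in> D"
  have "coef L h \<noteq> 0 \<or> coef M h \<noteq> 0" if "coef (L + M) h \<noteq> 0" for h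
    using that by (auto simp: coef_add)
  then show ?thesis using LM unfolding D_def by (blast intro: torus_add)
qed

lemma D_sc: "L \<in> D \<Longrightarrow> sc c * L \<in> D"
  unfolding D_def by (auto simp: coef_sc intro: torus_sc)

lemma D_0: "0 \<in> D"
  by (simp add: D_def torus_0 coef_0)

lemma D_minus: "L \<in> D \<Longrightarrow> - L \<in> D"
  using D_sc[of L "-1"] by (simp add: sc_minus)

lemma D_sum: "(\<And>x. x \<in> A \<Longrightarrow> f x \<in> D) \<Longrightarrow> (\<Sum>x\<in>A. f x) \<in> D"
  by (induction A rule: infinite_finite_induct) (auto intro: D_0 D_add)

lemma D_mult: assumes "L \<in> D" "M \<in> D" shows "L * M \<in> D"
proof -
  have "h (Suc (2 * i)) = 0" if h: "coef (L * M) h \<noteq> 0" and i: "i \<in> {1..n}" for h i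
  proof -
    obtain g k where "coef L g \<noteq> 0" "coef M k \<noteq> 0" "h = g + k"
      using supp_mult[OF D_torus[OF assms(1)] D_torus[OF assms(2)] h] by blast
    moreover from this have "g (Suc (2 * i)) = 0" "k (Suc (2 * i)) = 0" using assms i by (auto simp: D_def)
    ultimately show ?thesis by (simp add: fun_apply)
  qed
  then show ?thesis using torus_mult assms by (auto simp: D_def)
qed

lemma D_tz_comm: "tz a * L = L * tz a" if "L \<in> D"
proof -
  have "tz a * (\<Sum>g\<in>supp L. sc (coef L g) * tz (\<lambda>i. g (2 * i))) = (\<Sum>g\<in>supp L. sc (coef L g) * tz (\<lambda>i. g (2 * i))) * tz a"
    unfolding sum_distrib_left sum_distrib_right
    by (intro sum.cong refl) (simp add: t_sc' mult.assoc tz_mult add.commute)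
  then show ?thesis using D_expand[OF that] by simp
qed

lemma D_comm: assumes "L \<in> D" "M \<in> D" shows "L * M = M * L"
proof -
  have "(\<Sum>g\<in>supp L. sc (coef L g) * tz (\<lambda>i. g (2 * i))) * M = M * (\<Sum>g\<in>supp L. sc (coef L g) * tz (\<lambda>i. g (2 * i)))"
    unfolding sum_distrib_left sum_distrib_right
    by (intro sum.cong refl) (simp add: sc_comm'[of M] mult.assoc D_tz_comm[OF assms(2)])
  then show ?thesis using D_expand[OF assms(1)] by simp
qed

lemma coef_t_mult:
  assumes "L \<in> torus" "g \<in> lattice n"
  shows "coef (t g * L) (g + h) = coef L h * tw h g" "coef (L * t g) (h + g) = coef L h * tw g h"
proof -
  have s: "supp (t g) = {g}" by (auto simp: coef_t)
  have fin: "finite (supp L)" using assms torus_finite by blast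
  have "coef (t g * L) (g + h) = (\<Sum>k\<in>supp L. if k = h then coef L h * tw h g else 0)"
    unfolding coef_mult[OF torus_t[OF assms(2)] assms(1)] s by (auto simp: coef_t intro!: sum.cong)
  then show "coef (t g * L) (g + h) = coef L h * tw h g" using fin by auto
  have "coef (L * t g) (h + g) = (\<Sum>k\<in>supp L. if k = h then coef L h * tw g h else 0)"
    unfolding coef_mult[OF assms(1) torus_t[OF assms(2)]] s by (auto simp: coef_t intro!: sum.cong)
  then show "coef (L * t g) (h + g) = coef L h * tw g h" using fin by auto
qed

text \<open>Multiplication by z^a on either side only shifts the exponents of L and multiplies by
  twists, so the equation can be compared at each exponent h separately.\<close>

lemma tz_eigen:
  assumes "L \<in> torus" "tz a * L = sc k * (L * tz a)" "coef L h \<noteq> 0"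
  shows "(\<Prod>i\<in>{1..n}. q i powi (- (h (Suc (2 * i)) * a i))) = k"
proof -
  have "coef (tz a * L) (zexp a + h) = coef L h * tw h (zexp a)" "coef (L * tz a) (zexp a + h) = coef L h"
    using coef_t_mult[OF assms(1) lattice_zexp, of a h] by (simp_all add: add.commute)
  then have "coef L h * tw h (zexp a) = k * coef L h" using assms(2) coef_sc by metis
  then have "tw h (zexp a) = k" using assms(3) by (simp add: mult.commute)
  then show ?thesis by (simp add: tw_right_zexp)
qed

section \<open>Invariant subspaces\<close>

text \<open>The first condition says that z_k acts on the value at h by q_k to the power
  \<open>h (Suc (2 * k))\<close>, the exponent of x_k in h; the second restricts F to negative
  exponents of x_k. The space is designed so that all of \<open>B\<close> preserves it but the
  inverse of x_k does not.\<close>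

definition U :: "nat \<Rightarrow> ((nat \<Rightarrow> int) \<Rightarrow> 'k) set" where
  "U k = {F. (\<forall>h. F (h + zi k) = q k powi (h (Suc (2 * k))) * F h) \<and> (\<forall>h. h (Suc (2 * k)) \<ge> 0 \<longrightarrow> F h = 0)}"

lemma tw_right_zi: assumes "k \<in> {1..n}" shows "tw g (zi k) = q k powi (- g (Suc (2 * k)))"
proof -
  have "tw g (zi k) = (\<Prod>i\<in>{1..n}. q i powi (- (g (Suc (2 * i)) * unit_vec k 1 i)))"
    using tw_right_zexp[of g "unit_vec k 1"] unfolding zexp_un(1)[OF assms] .
  also have "\<dots> = (\<Prod>i\<in>{1..n}. if i = k then q k powi (- g (Suc (2 * k))) else 1)"
    by (intro prod.cong) (auto simp: unit_vec_def)
  finally have "tw g (zi k) = (\<Prod>i\<in>{1..n}. if i = k then q k powi (- g (Suc (2 * k))) else 1)" .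
  then show ?thesis using assms by simp
qed

lemma ap_t: "ap (t g) F h = tw g h * F (h + g)" by (simp add: t.rep_eq)

lemma t_quasi_periodic:
  assumes k: "k \<in> {1..n}" and F: "\<And>h. F (h + zi k) = q k powi (h (Suc (2 * k))) * F h"
  shows "ap (t g) F (h + zi k) = q k powi (h (Suc (2 * k))) * ap (t g) F h"
proof -
  have "F (h + zi k + g) = q k powi ((h + g) (Suc (2 * k))) * F (h + g)"
    using F[of "h + g"] by (simp add: ac_simps)
  moreover have "q k powi (h (Suc (2 * k))) = q k powi (- g (Suc (2 * k))) * q k powi ((h + g) (Suc (2 * k)))"
    by (rule powi_sum_exponent[OF q_nz[OF k]]) (simp add: fun_apply)
  ultimately show ?thesis by (simp add: ap_t tw_add_right tw_right_zi[OF k])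
qed

lemma U_t: assumes "k \<in> {1..n}" "F \<in> U k" "g (Suc (2 * k)) \<ge> 0" shows "ap (t g) F \<in> U k"
  using assms t_quasi_periodic[of k F g] unfolding U_def by (auto simp: ap_t fun_apply)

lemma U_add: "F \<in> U k \<Longrightarrow> G \<in> U k \<Longrightarrow> F + G \<in> U k"
  unfolding U_def by (auto simp: fun_apply algebra_simps)

lemma U_scale: "F \<in> U k \<Longrightarrow> (\<lambda>h. c * F h) \<in> U k"
  unfolding U_def by (auto simp: algebra_simps)

lemma U_0: "0 \<in> U k" by (simp add: U_def fun_apply)

lemma ap_sc_fun: "ap (sc c * L) F = (\<lambda>h. c * ap L F h)" by (simp add: fun_eq_iff ap_sc)

lemma U_minus: "F \<in> U k \<Longrightarrow> G \<in> U k \<Longrightarrow> F - G \<in> U k"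
  using U_add[OF _ U_scale, of F k G "-1"] by (simp add: fun_eq_iff fun_apply) (simp add: fun_diff_def plus_fun_def)

text \<open>Quasi-periodicity survives every shift, and letters other than y_k do not raise the
  degree in x_k. Both shifts in the image of y_k move degree -1 to degree 0, and there their
  contributions cancel.\<close>

lemma U_rho: assumes k: "k \<in> {1..n}" and g: "gen_idx g \<in> {1..n}" and F: "F \<in> U k" shows "ap (rho g) F \<in> U k"
proof (cases g)
  case (GX i) then show ?thesis using U_t[OF k F, of "xi i"] by simp
next
  case (GW i) then show ?thesis using U_t[OF k F, of "- zi i"] by (simp add: fun_apply)
next
  case (GY i)
  then have i: "i \<in> {1..n}" using g by simp
  let ?H = "ap (sc (q i) * t (zi i - xi i)) F - ap (t (- xi i)) F"
  have eq: "ap (rho g) F = (\<lambda>h. inverse (q i - 1) * ?H h)"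
    unfolding GY rho_Y[OF i] ap_sc_fun minus_lop.rep_eq by simp
  have "?H \<in> U k"
  proof (cases "i = k")
    case False
    then show ?thesis
      by (intro U_minus) (auto simp: ap_sc_fun fun_apply intro!: U_scale U_t[OF k F])
  next
    case True
    have per: "F (h + zi k) = q k powi (h (Suc (2 * k))) * F h" and van: "h (Suc (2 * k)) \<ge> 0 \<Longrightarrow> F h = 0" for h
      using F by (auto simp: U_def)
    have "?H (h + zi k) = q k powi (h (Suc (2 * k))) * ?H h" for h
      using t_quasi_periodic[OF k per, of "zi i - xi i" h] t_quasi_periodic[OF k per, of "- xi i" h]
      by (simp add: ap_sc fun_apply algebra_simps)
    moreover have "?H h = 0" if "h (Suc (2 * k)) \<ge> 0" for h
    proof -
      have "?H h = tw (- xi k) h * (q k * F (h - xi k + zi k) - F (h - xi k))"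
      proof -
        have "tw (zi k - xi k) h = tw (- xi k) h" using tw_add_left[of "zi k" "- xi k" h] by simp
        moreover have "h + (zi k - xi k) = h - xi k + zi k" "h + - xi k = h - xi k" by simp_all
        moreover have "?H h = q k * (tw (zi k - xi k) h * F (h + (zi k - xi k))) - tw (- xi k) h * F (h + - xi k)"
          unfolding True minus_apply ap_sc ap_t ..
        ultimately show ?thesis by (simp only: right_diff_distrib mult.left_commute)
      qed
      also have "F (h - xi k + zi k) = q k powi (h (Suc (2 * k)) - 1) * F (h - xi k)"
        using per[of "h - xi k"] by (simp add: fun_apply)
      finally have H: "?H h = tw (- xi k) h * ((q k * q k powi (h (Suc (2 * k)) - 1) - 1) * F (h - xi k))"
        by (simp add: algebra_simps)
      \<comment> \<open>At degree 0 the factor is q_k q_k^(-1) - 1 = 0; at positive degree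
        \<open>h - xi k\<close> still has nonnegative degree, where F vanishes.\<close>
      show ?thesis
      proof (cases "h (Suc (2 * k)) = 0")
        case True
        then show ?thesis using H q_nz[OF k] by simp
      next
        case False
        then have "F (h - xi k) = 0" using that by (intro van) (simp add: fun_apply)
        then show ?thesis using H by simp
      qed
    qed
    ultimately show ?thesis unfolding U_def by blast
  qed
  then show ?thesis unfolding eq by (rule U_scale)
qed

lemma U_B: assumes "k \<in> {1..n}" "L \<in> B" "F \<in> U k" shows "ap L F \<in> U k"
proof -
  have w: "word_ok n w \<Longrightarrow> ap (prod_list (map rho w)) F \<in> U k" for w
    by (induction w) (auto simp: ap_simps word_ok_Cons assms(3) intro!: U_rho[OF assms(1)])
  obtain f where f: "fa_valid n f" "L = ev rho f" using assms by (auto simp: B_def)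
  have "ap (\<Sum>w\<in>A. sc (f w) * prod_list (map rho w)) F \<in> U k" if "\<And>w. w \<in> A \<Longrightarrow> word_ok n w" for A
    using that
  proof (induction A rule: infinite_finite_induct)
    case (insert v A)
    have "ap (sc (f v) * prod_list (map rho v)) F \<in> U k"
      unfolding ap_sc_fun using w insert.prems by (intro U_scale) auto
    moreover have "ap (\<Sum>w\<in>A. sc (f w) * prod_list (map rho w)) F \<in> U k" using insert by auto
    ultimately show ?case using insert.hyps by (simp add: plus_lop.rep_eq U_add)
  qed (auto simp: zero_lop.rep_eq U_0)
  from this[of "{w. f w \<noteq> 0}"] show ?thesis unfolding f(2) ev_def using f(1) by (auto simp: fa_valid_iff)
qed

text \<open>The element of \<open>U k\<close> with values prescribed by G at z_k-exponent 0 and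
  negative x_k-exponent; iterating the quasi-periodicity \<open>h (2 * k)\<close> times from there
  produces the power of q_k. These are the test functions to which elements of \<open>B\<close> are
  applied.\<close>

definition periodic_fun :: "nat \<Rightarrow> ((nat \<Rightarrow> int) \<Rightarrow> 'k) \<Rightarrow> (nat \<Rightarrow> int) \<Rightarrow> 'k" where
  "periodic_fun k G = (\<lambda>h. if h (Suc (2 * k)) < 0 then q k powi (h (2 * k) * h (Suc (2 * k))) * G (h(2 * k := 0)) else 0)"

lemma periodic_fun_U: assumes "k \<in> {1..n}" shows "periodic_fun k G \<in> U k"
proof -
  have "(h + zi k)(2 * k := 0) = h(2 * k := 0)" for h :: "nat \<Rightarrow> int"
    by (auto simp: fun_eq_iff fun_apply zi_def)
  moreover have "q k powi ((h + zi k) (2 * k) * h (Suc (2 * k))) = q k powi (h (Suc (2 * k))) * q k powi (h (2 * k) * h (Suc (2 * k)))" for h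
    by (rule powi_sum_exponent[OF q_nz[OF assms]]) (simp add: fun_apply distrib_right)
  ultimately show ?thesis unfolding U_def periodic_fun_def by (auto simp: fun_apply)
qed

lemma U_at_0: "F \<in> U k \<Longrightarrow> F 0 = 0" by (simp add: U_def fun_apply)

text \<open>Applied to F, a multiple of \<open>t g\<close> has value c F(g) at 0. If g had negative
  degree in x_k, the test function would be nonzero at g, although members of \<open>U k\<close>
  vanish at 0.\<close>

lemma B_monomial_degree:
  assumes "k \<in> {1..n}" "sc c * t g \<in> B" "c \<noteq> 0" shows "g (Suc (2 * k)) \<ge> 0"
proof (rule ccontr)
  assume "\<not> ?thesis"
  then have "periodic_fun k (\<lambda>_. 1) g \<noteq> 0" using q_nz[OF assms(1)] by (simp add: periodic_fun_def)
  moreover have "ap (sc c * t g) (periodic_fun k (\<lambda>_. 1)) 0 = 0"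
    by (rule U_at_0[OF U_B[OF assms(1,2) periodic_fun_U[OF assms(1)]]])
  ultimately show False using assms(3) by (simp add: ap_sc ap_t)
qed

text \<open>The unit and its inverse are monomials with opposite exponents. Both lie in
  \<open>B\<close>, so both have nonnegative degree in every x_i, and opposite nonnegative degrees
  are 0.\<close>

lemma B_unit:
  assumes "L \<in> B" "M \<in> B" "L * M = 1" "M * L = 1"
  shows "\<exists>a c. c \<noteq> 0 \<and> L = sc c * tz a"
proof -
  obtain g c where g: "c \<noteq> 0" "g \<in> lattice n" "L = sc c * t g"
    using torus_unit[OF B_torus B_torus] assms by blast
  obtain h d where h: "d \<noteq> 0" "h \<in> lattice n" "M = sc d * t h"
    using torus_unit[OF B_torus B_torus] assms by blast
  have "L * M = sc (c * d * tw h g) * t (g + h)"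
    by (simp add: g h sc_mult_sc t_mult sc_mult')
  then have "coef (L * M) (g + h) \<noteq> 0" using g h tw_nz by (simp add: coef_sc coef_t)
  then have gh: "g + h = 0" using assms(3) coef_t[of 0 "g + h"] by (auto split: if_splits)
  have "g (Suc (2 * i)) = 0" if i: "i \<in> {1..n}" for i
  proof -
    have "g (Suc (2 * i)) + h (Suc (2 * i)) = 0" using fun_cong[OF gh, of "Suc (2 * i)"] by (simp add: fun_apply)
    moreover have "g (Suc (2 * i)) \<ge> 0" "h (Suc (2 * i)) \<ge> 0"
      using B_monomial_degree[OF i] assms g h by auto
    ultimately show ?thesis by simp
  qed
  from lattice_zexpI[OF g(2) this] show ?thesis using g by metis
qed

section \<open>Homogeneous components of degree one\<close>

definition homog :: "nat \<Rightarrow> int \<Rightarrow> 'k lop \<Rightarrow> bool" where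
  "homog k s L \<longleftrightarrow> (\<forall>h. coef L h \<noteq> 0 \<longrightarrow> (\<forall>i\<in>{1..n}. h (Suc (2 * i)) = (if i = k then s else 0)))"

lemma homog_shift:
  assumes "L \<in> torus" "k \<in> {1..n}" "homog k s L" "g = xi k \<and> s = -1 \<or> g = - xi k \<and> s = 1"
  shows "L * t g \<in> D"
proof -
  have g: "g \<in> lattice n" using assms lattice_xi lattice_minus by auto
  have "h (Suc (2 * i)) = 0" if h: "coef (L * t g) h \<noteq> 0" and i: "i \<in> {1..n}" for h i
  proof -
    have "coef L (h - g) \<noteq> 0" using coef_t_mult(2)[OF assms(1) g, of "h - g"] h by auto
    then have "(h - g) (Suc (2 * i)) = (if i = k then s else 0)" using assms(3) i by (auto simp: homog_def)
    then show ?thesis using assms(4) by (auto simp: fun_apply split: if_splits)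
  qed
  then show ?thesis unfolding D_def using torus_mult[OF assms(1) torus_t[OF g]] by auto
qed

lemma homog_X:
  assumes "L \<in> torus" "k \<in> {1..n}" "homog k 1 L" shows "\<exists>p\<in>D. L = p * rho (GX k)"
proof
  show "L * t (- xi k) \<in> D" using assms by (intro homog_shift) auto
  show "L = L * t (- xi k) * rho (GX k)" using assms by (simp add: mult.assoc xi_cancel tw_xi_self)
qed

text \<open>A telescoping sum; the quotient is a Laurent polynomial, so negative m is covered with
  the same divisor z_k - 1.\<close>

lemma z_minus_1_dvd: assumes "k \<in> {1..n}" shows "\<exists>e\<in>D. tz (unit_vec k m) - 1 = e * (t (zi k) - 1)"
proof (induction m rule: int_induct[where k = 0])
  case base
  have "tz (unit_vec k 0) = 1" by (simp add: unit_vec_def)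
  then show ?case using D_0 by (intro bexI[of _ 0]) auto
next
  have s: "tz (unit_vec k (m + 1)) = tz (unit_vec k m) * t (zi k)" for m
  proof -
    have "unit_vec k (m + 1) = unit_vec k m + unit_vec k 1" by (auto simp: unit_vec_def fun_apply)
    then show ?thesis using tz_mult[of "unit_vec k m" "unit_vec k 1"] assms by (simp add: zexp_un)
  qed
  {
    case (step1 i)
    then obtain e where e: "e \<in> D" "tz (unit_vec k i) - 1 = e * (t (zi k) - 1)" by blast
    have "tz (unit_vec k (i + 1)) - 1 = tz (unit_vec k i) * (t (zi k) - 1) + (tz (unit_vec k i) - 1)"
      by (simp add: s right_diff_distrib)
    then have "tz (unit_vec k (i + 1)) - 1 = (tz (unit_vec k i) + e) * (t (zi k) - 1)"
      unfolding e(2) distrib_right .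
    then show ?case using D_add[OF D_tz e(1)] by blast
  next
    case (step2 i)
    then obtain e where e: "e \<in> D" "tz (unit_vec k i) - 1 = e * (t (zi k) - 1)" by blast
    have "tz (unit_vec k (i - 1)) - 1 = (tz (unit_vec k i) - 1) + - tz (unit_vec k (i - 1)) * (t (zi k) - 1)"
      using s[of "i - 1"] by (simp add: right_diff_distrib)
    then have "tz (unit_vec k (i - 1)) - 1 = (e + - tz (unit_vec k (i - 1))) * (t (zi k) - 1)"
      unfolding e(2) distrib_right .
    then show ?case using D_add[OF e(1) D_minus[OF D_tz]] by blast
  }
qed

text \<open>Preserving the subspace U_k forces the Laurent polynomial L x_k in the z_i to vanish at z_k = 1,
  hence to be divisible by z_k - 1.\<close>

lemma homog_Y:
  assumes L: "L \<in> B" and k: "k \<in> {1..n}" and hom: "homog k (- 1) L"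
  shows "\<exists>p\<in>D. L = p * rho (GY k)"
proof -
  define P where "P = L * t (xi k)"
  have P: "P \<in> D" unfolding P_def using B_torus[OF L] k hom by (intro homog_shift) auto
  have LP: "L = P * t (- xi k)" unfolding P_def using k by (simp add: mult.assoc xi_cancel tw_xi_self)
  define S where "S = supp P"
  have fin: "finite S" unfolding S_def using torus_finite[OF D_torus[OF P]] .
  have S: "h \<in> lattice n" "\<And>i. i \<in> {1..n} \<Longrightarrow> h (Suc (2 * i)) = 0" if "h \<in> S" for h
    using that P torus_lattice[OF D_torus[OF P]] by (auto simp: S_def D_def)
  \<comment> \<open>Setting the exponent of z_k to 0 is the substitution z_k = 1 on monomials of
    P.\<close>
  define pr where "pr h = h(2 * k := 0)" for h :: "nat \<Rightarrow> int"
  have PS: "P = (\<Sum>h\<in>S. sc (coef P h) * t h)" unfolding S_def by (rule torus_expand[OF D_torus[OF P]])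
  \<comment> \<open>The sums over the fibres of \<open>pr\<close> are the coefficients of P at z_k =
    1.\<close>
  have vanish: "(\<Sum>h | h \<in> S \<and> pr h = h0. coef P h) = 0" for h0
  proof -
    \<comment> \<open>This test function isolates one fibre. All exponents \<open>h - xi k\<close>
      have degree -1 in x_k, so its factor q_k^(-h(2k)) cancels the twist q_k^(h(2k)) and leaves the
      bare coefficients.\<close>
    let ?G = "\<lambda>h. if h = h0 - xi k then 1 else 0"
    have "0 = ap L (periodic_fun k ?G) 0" by (rule U_at_0[OF U_B[OF k L periodic_fun_U[OF k]], symmetric])
    also have "L = (\<Sum>h\<in>S. sc (coef P h * tw (- xi k) h) * t (h - xi k))"
      unfolding LP by (subst PS) (simp add: sum_distrib_right mult.assoc t_mult sc_mult')
    also have "ap \<dots> (periodic_fun k ?G) 0 = (\<Sum>h\<in>S. if pr h = h0 then coef P h else 0)"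
      unfolding ap_sum ap_sc ap_t
    proof (intro sum.cong refl)
      fix h assume h: "h \<in> S"
      have tw: "tw (- xi k) h = q k powi (h (2 * k))"
      proof -
        have "h = zexp (\<lambda>i. h (2 * i))" by (rule lattice_zexpI[OF S[OF h]])
        then have "tw (- xi k) h = (\<Prod>i\<in>{1..n}. q i powi (- ((- xi k) (Suc (2 * i)) * h (2 * i))))"
          using tw_right_zexp[of "- xi k" "\<lambda>i. h (2 * i)"] by metis
        also have "\<dots> = (\<Prod>i\<in>{1..n}. if i = k then q k powi (h (2 * k)) else 1)"
          by (intro prod.cong) (auto simp: fun_apply)
        finally show ?thesis using k by simp
      qed
      have "(h - xi k)(2 * k := 0) = pr h - xi k" by (auto simp: pr_def fun_eq_iff fun_apply)
      then have "periodic_fun k ?G (h - xi k) = (if pr h = h0 then q k powi (- h (2 * k)) else 0)"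
        using S(2)[OF h k] by (auto simp: periodic_fun_def fun_apply)
      then show "coef P h * tw (- xi k) h * (tw (h - xi k) 0 * periodic_fun k ?G (0 + (h - xi k))) = (if pr h = h0 then coef P h else 0)"
        using q_nz[OF k] by (simp add: tw power_int_minus)
    qed
    finally show ?thesis using fin by (simp add: sum.inter_filter)
  qed
  have pr_t: "t h = t (pr h) * tz (unit_vec k (h (2 * k)))" if h: "h \<in> S" for h
  proof -
    have "h = pr h + zexp (unit_vec k (h (2 * k)))"
      using k by (auto simp: fun_eq_iff pr_def fun_apply zexp_def unit_vec_def)
    then show ?thesis by (metis mult_1 sc_1 t_mult tw_zexp)
  qed
  have prD: "t (pr h) \<in> D" if h: "h \<in> S" for h
  proof -
    have "pr h \<in> lattice n" using S(1)[OF h] by (auto simp: lattice_def pr_def)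
    then show ?thesis using S(2)[OF h] by (auto simp: D_def coef_t torus_t pr_def odd_ne_even)
  qed
  have "(\<Sum>h\<in>S. sc (coef P h) * t (pr h)) = (\<Sum>g\<in>pr ` S. \<Sum>h | h \<in> S \<and> pr h = g. sc (coef P h) * t (pr h))"
    by (rule sum.image_gen[OF fin])
  also have "\<dots> = (\<Sum>g\<in>pr ` S. 0)"
  proof (intro sum.cong refl)
    fix g
    have add: "(\<Sum>h\<in>A. sc (coef P h)) = sc (\<Sum>h\<in>A. coef P h)" for A
      by (induction A rule: infinite_finite_induct) (auto simp: sc_add)
    have "(\<Sum>h | h \<in> S \<and> pr h = g. sc (coef P h) * t (pr h)) = (\<Sum>h | h \<in> S \<and> pr h = g. sc (coef P h)) * t g"
      by (simp add: sum_distrib_right)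
    then show "(\<Sum>h | h \<in> S \<and> pr h = g. sc (coef P h) * t (pr h)) = 0"
      by (simp add: add vanish)
  qed
  finally have z: "(\<Sum>h\<in>S. sc (coef P h) * t (pr h)) = 0" by simp
  obtain e where e: "\<And>m. e m \<in> D" "\<And>m. tz (unit_vec k m) - 1 = e m * (t (zi k) - 1)"
    using z_minus_1_dvd[OF k] by metis
  define d where "d = (\<Sum>h\<in>S. sc (coef P h) * (t (pr h) * e (h (2 * k))))"
  have dD: "d \<in> D" unfolding d_def by (intro D_sum D_sc D_mult prD e)
  \<comment> \<open>Since P vanishes at z_k = 1, each monomial may be replaced by its difference
    from its value at z_k = 1, and every such difference is divisible by z_k - 1.\<close>
  have "P = (\<Sum>h\<in>S. sc (coef P h) * t h) - (\<Sum>h\<in>S. sc (coef P h) * t (pr h))"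
    using PS z by simp
  also have "\<dots> = (\<Sum>h\<in>S. sc (coef P h) * (t (pr h) * (tz (unit_vec k (h (2 * k))) - 1)))"
    unfolding sum_subtractf[symmetric]
    by (intro sum.cong refl) (simp add: pr_t[symmetric] right_diff_distrib)
  also have "\<dots> = d * (t (zi k) - 1)"
    unfolding e(2) d_def by (simp add: sum_distrib_right mult.assoc)
  finally have Pd: "P = d * (t (zi k) - 1)" .
  have "L = (sc (q k - 1) * d) * rho (GY k)"
    unfolding LP Pd using q_ne_1[OF k] by (simp add: mult.assoc sc_comm'[of d] sc_mult')
  then show ?thesis using D_sc[OF dD] by blast
qed

section \<open>Automorphisms of the image algebra\<close>

definition alg_hom :: "('k lop \<Rightarrow> 'k lop) \<Rightarrow> bool" where
  "alg_hom f \<longleftrightarrow> (\<forall>a\<in>B. f a \<in> B) \<and> (\<forall>a\<in>B. \<forall>b\<in>B. f (a + b) = f a + f b) \<and>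
     (\<forall>c. \<forall>a\<in>B. f (sc c * a) = sc c * f a) \<and> (\<forall>a\<in>B. \<forall>b\<in>B. f (a * b) = f a * f b) \<and> f 1 = 1"

text \<open>An explicit two-sided inverse on \<open>B\<close> makes every statement about f
  available for g by symmetry. Off \<open>B\<close> only linear and multiplicative behaviour is left
  open.\<close>

definition aut_pair :: "('k lop \<Rightarrow> 'k lop) \<Rightarrow> ('k lop \<Rightarrow> 'k lop) \<Rightarrow> bool" where
  "aut_pair f g \<longleftrightarrow> alg_hom f \<and> alg_hom g \<and> (\<forall>a\<in>B. g (f a) = a) \<and> (\<forall>a\<in>B. f (g a) = a)"

lemma aut_pair_sym: "aut_pair f g \<Longrightarrow> aut_pair g f" by (auto simp: aut_pair_def)

lemma aut_pairD:
  assumes "aut_pair f g"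
  shows "a \<in> B \<Longrightarrow> f a \<in> B" "a \<in> B \<Longrightarrow> b \<in> B \<Longrightarrow> f (a + b) = f a + f b" "a \<in> B \<Longrightarrow> f (sc c * a) = sc c * f a"
    "a \<in> B \<Longrightarrow> b \<in> B \<Longrightarrow> f (a * b) = f a * f b" "f 1 = 1" "a \<in> B \<Longrightarrow> g (f a) = a" "a \<in> B \<Longrightarrow> f (g a) = a"
  using assms by (auto simp: aut_pair_def alg_hom_def)

lemma aut_0: assumes "aut_pair f g" shows "f 0 = 0"
  using aut_pairD(3)[OF assms B_1, of 0] by simp

lemma aut_diff: assumes "aut_pair f g" "a \<in> B" "b \<in> B" shows "f (a - b) = f a - f b"
  using aut_pairD(2)[OF assms(1) assms(2) B_sc[OF assms(3)], of "-1"] aut_pairD(3)[OF assms(1,3), of "-1"]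
  by (simp add: sc_minus)

lemma aut_nz: "aut_pair f g \<Longrightarrow> a \<in> B \<Longrightarrow> a \<noteq> 0 \<Longrightarrow> f a \<noteq> 0"
  using aut_pairD(6) aut_0[OF aut_pair_sym] by metis

section \<open>Degrees of the images of z_k, x_k and y_k\<close>

lemma B_X: "k \<in> {1..n} \<Longrightarrow> rho (GX k) \<in> B" and B_Y: "k \<in> {1..n} \<Longrightarrow> rho (GY k) \<in> B"
  by (rule B_gen; simp)+

lemma B_z: "k \<in> {1..n} \<Longrightarrow> t (zi k) \<in> B" "k \<in> {1..n} \<Longrightarrow> t (- zi k) \<in> B"
  using B_tz[of "unit_vec k 1"] B_tz[of "unit_vec k (- 1)"] by (simp_all add: zexp_un)

lemma lead_nz: "lead P L g \<Longrightarrow> L \<noteq> 0" by (auto simp: lead_def coef_0)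

lemma rho_nz: "gen_idx g \<in> {1..n} \<Longrightarrow> rho g \<noteq> 0" using lead_nz[OF rho_lead] .

lemma t_nz: "t g \<noteq> 0" by (metis coef_t coef_0 zero_neq_one)

lemma rho_qcomm:
  assumes "qcomm k u v" "fa_valid n u" "fa_valid n v"
  shows "ev rho u * ev rho v = sc k * (ev rho v * ev rho u)"
proof -
  have "ev rho (u \<star> v - k \<odot> (v \<star> u)) = 0" using assms(1) rho_ideal by (simp add: qcomm_def)
  moreover have "ev rho (u \<star> v - k \<odot> (v \<star> u)) = ev rho (u \<star> v) - ev rho (k \<odot> (v \<star> u))"
    by (intro ev_diff[of n] fa_valid_smult fa_valid_mult assms)
  moreover have "ev rho (k \<odot> (v \<star> u)) = sc k * ev rho (v \<star> u)"
    by (intro ev_smult[of n] fa_valid_mult assms)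
  ultimately show ?thesis using ev_mult[OF assms(2,3)] ev_mult[OF assms(3,2)] by simp
qed

lemma z_X: assumes "i \<in> {1..n}" "k \<in> {1..n}"
  shows "t (zi i) * rho (GX k) = sc (q k powi (if i = k then - 1 else 0)) * (rho (GX k) * t (zi i))"
  using rho_qcomm[OF qcomm_ZX[OF assms] fa_valid_Z[OF assms(1)] fa_valid_gen] assms
  by (simp add: ev_rho_Z ev_gen power_int_minus del: rho.simps split: if_splits)

lemma z_Y: assumes "i \<in> {1..n}" "k \<in> {1..n}"
  shows "t (zi i) * rho (GY k) = sc (q k powi (if i = k then 1 else 0)) * (rho (GY k) * t (zi i))"
  using rho_qcomm[OF qcomm_ZY[OF assms] fa_valid_Z[OF assms(1)] fa_valid_gen] assms
  by (simp add: ev_rho_Z ev_gen del: rho.simps split: if_splits)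

lemma q_powi_prod: assumes "k \<in> {1..n}" shows "(\<Prod>j\<in>{1..n}. q j powi (unit_vec k m j)) = q k powi m"
proof -
  have "(\<Prod>j\<in>{1..n}. q j powi (unit_vec k m j)) = (\<Prod>j\<in>{1..n}. if j = k then q k powi m else 1)"
    by (intro prod.cong) (auto simp: unit_vec_def)
  then show ?thesis using assms by simp
qed

lemma q_prod_inj:
  assumes "(\<Prod>j\<in>{1..n}. q j powi (e j)) = (\<Prod>j\<in>{1..n}. q j powi (e' j))" "k \<in> {1..n}"
  shows "e k = e' k"
proof -
  have "(\<Prod>j\<in>{1..n}. q j powi (e j - e' j)) = (\<Prod>j\<in>{1..n}. q j powi (e j) / q j powi (e' j))"
    by (intro prod.cong refl) (simp add: power_int_diff q_nz)
  also have "\<dots> = 1" using assms(1) q_nz by (simp add: prod_dividef)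
  finally show ?thesis using q_indep[of "\<lambda>j. e j - e' j" k] assms(2) by simp
qed

text \<open>v is an eigenvector for conjugation by z_i with eigenvalue q_k^m, hence f v is one for
  z^a with the same eigenvalue. Each exponent h of f v thus gives an equality of monomials in the
  q_j, and independence compares it factor by factor.\<close>

lemma aut_eigen:
  assumes fg: "aut_pair f g" and i: "i \<in> {1..n}" and k: "k \<in> {1..n}" and v: "v \<in> B"
    and c: "t (zi i) * v = sc (q k powi m) * (v * t (zi i))"
    and z: "f (t (zi i)) = sc d * tz a" "d \<noteq> 0" and h: "coef (f v) h \<noteq> 0" and j: "j \<in> {1..n}"
  shows "h (Suc (2 * j)) * a j = unit_vec k (- m) j"
proof -
  note F = aut_pairD[OF fg]
  have zB: "t (zi i) \<in> B" using B_z i by blast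
  have "f (t (zi i)) * f v = sc (q k powi m) * (f v * f (t (zi i)))"
    using arg_cong[OF c, of f] zB v by (simp add: F B_mult)
  then have "sc d * (tz a * f v) = sc d * (sc (q k powi m) * (f v * tz a))"
    by (simp add: z mult.assoc sc_comm'[of "f v"] sc_mult' mult.commute)
  then have "tz a * f v = sc (q k powi m) * (f v * tz a)"
    using z(2) by (metis sc_inverse(2))
  from tz_eigen[OF B_torus[OF F(1)[OF v]] this h]
  have "(\<Prod>i\<in>{1..n}. q i powi (- (h (Suc (2 * i)) * a i))) = (\<Prod>j\<in>{1..n}. q j powi (unit_vec k m j))"
    unfolding q_powi_prod[OF k] .
  from q_prod_inj[OF this j] show ?thesis by (simp add: unit_vec_def split: if_splits)
qed

lemma coef_ex: assumes "L \<in> torus" "L \<noteq> 0" shows "\<exists>h. coef L h \<noteq> 0"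
  using torus_eqI[OF assms(1) torus_0] assms(2) coef_0 by metis

text \<open>Let A i be the exponents of f(z_i) and h an exponent of f(x_k). By
  \<open>aut_eigen\<close> the product of the x_j-degree of h with \<open>A i j\<close> is 1 when i
  = j = k and 0 otherwise. Integrality turns this into A k k = 1 or -1 and the vanishing of all
  other entries.\<close>

lemma aut_degrees:
  assumes fg: "aut_pair f g"
  shows "\<exists>\<epsilon> c. \<forall>i\<in>{1..n}. (\<epsilon> i = 1 \<or> \<epsilon> i = -1) \<and> c i \<noteq> 0 \<and> f (t (zi i)) = sc (c i) * tz (unit_vec i (\<epsilon> i)) \<and>
     homog i (\<epsilon> i) (f (rho (GX i))) \<and> homog i (- \<epsilon> i) (f (rho (GY i)))"
proof -
  note F = aut_pairD[OF fg]
  have "\<exists>a c. c \<noteq> 0 \<and> f (t (zi i)) = sc c * tz a" if i: "i \<in> {1..n}" for i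
  proof (rule B_unit)
    show "f (t (zi i)) \<in> B" "f (t (- zi i)) \<in> B" using B_z[OF i] F by auto
    have "f (t (zi i)) * f (t (- zi i)) = f (t (zi i) * t (- zi i))" "f (t (- zi i)) * f (t (zi i)) = f (t (- zi i) * t (zi i))"
      using B_z[OF i] F by auto
    then show "f (t (zi i)) * f (t (- zi i)) = 1" "f (t (- zi i)) * f (t (zi i)) = 1"
      by (simp_all add: t_mult tw_minus_left F)
  qed
  then obtain A c where z: "\<And>i. i \<in> {1..n} \<Longrightarrow> c i \<noteq> 0 \<and> f (t (zi i)) = sc (c i) * tz (A i)" by metis
  have X: "h (Suc (2 * j)) * A i j = (if i = k \<and> j = k then 1 else 0)"
    if "i \<in> {1..n}" "k \<in> {1..n}" "j \<in> {1..n}" "coef (f (rho (GX k))) h \<noteq> 0" for i j k h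
    using aut_eigen[OF fg that(1,2) B_X z_X _ _ that(4,3), of "c i" "A i"] z that
    by (auto simp: unit_vec_def split: if_splits)
  have Y: "h (Suc (2 * j)) * A i j = (if i = k \<and> j = k then -1 else 0)"
    if "i \<in> {1..n}" "k \<in> {1..n}" "j \<in> {1..n}" "coef (f (rho (GY k))) h \<noteq> 0" for i j k h
    using aut_eigen[OF fg that(1,2) B_Y z_Y _ _ that(4,3), of "c i" "A i"] z that
    by (auto simp: unit_vec_def split: if_splits)
  have ex: "\<exists>h. coef (f (rho (GX k))) h \<noteq> 0" if k: "k \<in> {1..n}" for k
    using coef_ex[OF B_torus[OF F(1)[OF B_X[OF k]]]] aut_nz[OF fg B_X[OF k]] rho_nz[of "GX k"] k by simp
  have Aii: "A i i = 1 \<or> A i i = -1" if i: "i \<in> {1..n}" for i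
  proof -
    obtain h where "coef (f (rho (GX i))) h \<noteq> 0" using ex[OF i] by blast
    from X[OF i i i this] have "h (Suc (2 * i)) * A i i = 1" by simp
    then show ?thesis by (simp add: zmult_eq_1_iff) blast
  qed
  \<comment> \<open>The degree of f(x_j) in x_j is nonzero, since its product with
    \<open>A j j\<close> is 1; its product with \<open>A i j\<close> is 0.\<close>
  have Aij: "A i j = 0" if i: "i \<in> {1..n}" and j: "j \<in> {1..n}" and ij: "i \<noteq> j" for i j
  proof -
    obtain h where h: "coef (f (rho (GX j))) h \<noteq> 0" using ex[OF j] by blast
    have "h (Suc (2 * j)) * A j j = 1" "h (Suc (2 * j)) * A i j = 0" using X[OF j j j h] X[OF i j j h] ij by auto
    then show ?thesis by auto
  qed
  show ?thesis
  proof (intro exI ballI conjI)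
    fix i assume i: "i \<in> {1..n}"
    show "A i i = 1 \<or> A i i = -1" by (rule Aii[OF i])
    show "c i \<noteq> 0" using z[OF i] by blast
    have "zexp (A i) = zexp (unit_vec i (A i i))" using Aij[OF i] by (intro zexp_cong) (auto simp: unit_vec_def)
    then show "f (t (zi i)) = sc (c i) * tz (unit_vec i (A i i))" using z[OF i] by simp
    show "homog i (A i i) (f (rho (GX i)))" unfolding homog_def
    proof (intro allI impI ballI)
      fix h j assume "coef (f (rho (GX i))) h \<noteq> 0" "j \<in> {1..n}"
      from X[OF this(2) i this(2,1)] Aii[OF this(2)] show "h (Suc (2 * j)) = (if j = i then A i i else 0)"
        by (auto split: if_splits)
    qed
    show "homog i (- A i i) (f (rho (GY i)))" unfolding homog_def
    proof (intro allI impI ballI)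
      fix h j assume "coef (f (rho (GY i))) h \<noteq> 0" "j \<in> {1..n}"
      from Y[OF this(2) i this(2,1)] Aii[OF this(2)] show "h (Suc (2 * j)) = (if j = i then - A i i else 0)"
        by (auto split: if_splits)
    qed
  qed
qed

text \<open>Degree zero in all x_i amounts to commuting with every z_i, and f only replaces z_i by a
  scalar multiple of itself or of its inverse.\<close>

lemma aut_D:
  assumes fg: "aut_pair f g" and p: "p \<in> D" shows "f p \<in> D"
proof -
  note F = aut_pairD[OF fg]
  obtain \<epsilon> c where e: "\<And>i. i \<in> {1..n} \<Longrightarrow> (\<epsilon> i = 1 \<or> \<epsilon> i = -1) \<and> c i \<noteq> 0 \<and> f (t (zi i)) = sc (c i) * tz (unit_vec i (\<epsilon> i))"
    using aut_degrees[OF fg] by metis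
  have pB: "p \<in> B" using D_B p by blast
  have "h (Suc (2 * i)) = 0" if h: "coef (f p) h \<noteq> 0" and i: "i \<in> {1..n}" for h i
  proof -
    have "t (zi i) * p = sc (q i powi 0) * (p * t (zi i))"
      using D_tz_comm[OF p, of "unit_vec i 1"] i by (simp add: zexp_un)
    from aut_eigen[OF fg i i pB this _ _ h i, of "c i" "unit_vec i (\<epsilon> i)"] e[OF i] show ?thesis
      by (auto simp: unit_vec_def)
  qed
  then show ?thesis unfolding D_def using B_torus[OF F(1)[OF pB]] by blast
qed

text \<open>Indexing x_k by 1 and y_k by -1 lets signs carry the case distinction: commutation
  scalars become powers of lam or q with signs in the exponent, and an automorphism multiplies the
  index by \<epsilon>.\<close>

definition xy_gen :: "nat \<Rightarrow> int \<Rightarrow> 'k lop" where "xy_gen k s = (if s = 1 then rho (GX k) else rho (GY k))"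

lemma B_uu: "k \<in> {1..n} \<Longrightarrow> xy_gen k s \<in> B" by (simp add: xy_gen_def B_X B_Y del: rho.simps)

lemma xy_gen_nz: "k \<in> {1..n} \<Longrightarrow> xy_gen k s \<noteq> 0" by (simp add: xy_gen_def rho_nz del: rho.simps)

lemma homog_uu:
  assumes "L \<in> B" "k \<in> {1..n}" "homog k s L" "s = 1 \<or> s = -1" shows "\<exists>p\<in>D. L = p * xy_gen k s"
  using assms homog_X[OF B_torus] homog_Y unfolding xy_gen_def by (auto simp del: rho.simps)

text \<open>For a letter u the degrees give f(u) = r u' with r a Laurent polynomial in the z_i and
  u' a letter. The inverse g gives u' = f(p) f(u) in the same way, so f(p) r u' = u' and r is a unit
  of \<open>B\<close>, hence a monomial.\<close>

lemma aut_monomial: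
  assumes fg: "aut_pair f g" and k: "k \<in> {1..n}"
    and e: "\<epsilon> = 1 \<or> \<epsilon> = -1" and X: "homog k \<epsilon> (f (rho (GX k)))" and Y: "homog k (- \<epsilon>) (f (rho (GY k)))"
    and s: "s = 1 \<or> s = -1"
  shows "\<exists>\<alpha> a. \<alpha> \<noteq> 0 \<and> f (xy_gen k s) = sc \<alpha> * (tz a * xy_gen k (s * \<epsilon>))"
proof -
  note gf = aut_pair_sym[OF fg]
  note F = aut_pairD[OF fg] and G = aut_pairD[OF gf]
  have hom: "homog k (s * \<epsilon>) (f (xy_gen k s))" if "s = 1 \<or> s = -1" for s
    using that X Y by (auto simp: xy_gen_def simp del: rho.simps)
  obtain \<epsilon>' where e': "\<epsilon>' = 1 \<or> \<epsilon>' = -1" "homog k \<epsilon>' (g (rho (GX k)))" "homog k (- \<epsilon>') (g (rho (GY k)))"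
    using aut_degrees[OF gf] k by metis
  have hom': "homog k (s * \<epsilon>') (g (xy_gen k s))" if "s = 1 \<or> s = -1" for s
    using that e' by (auto simp: xy_gen_def simp del: rho.simps)
  have pull: "\<exists>p\<in>D. xy_gen k s = f p * f (xy_gen k (s * \<epsilon>'))" if s: "s = 1 \<or> s = -1" for s
  proof -
    have "s * \<epsilon>' = 1 \<or> s * \<epsilon>' = -1" using s e' by auto
    from homog_uu[OF G(1)[OF B_uu[OF k]] k hom'[OF s] this]
    obtain p where p: "p \<in> D" "g (xy_gen k s) = p * xy_gen k (s * \<epsilon>')" by blast
    have "xy_gen k s = f (g (xy_gen k s))" using F(7) B_uu[OF k] by simp
    also have "\<dots> = f p * f (xy_gen k (s * \<epsilon>'))" unfolding p(2) using F(4)[OF D_B[OF p(1)] B_uu[OF k]] .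
    finally show ?thesis using p(1) by blast
  qed
  \<comment> \<open>The x_k-degree of x_k is 1; on the other side f p contributes 0 and the second
    factor \<epsilon>' \<epsilon>, so the two signs agree.\<close>
  have "\<epsilon>' = \<epsilon>"
  proof -
    obtain p where p: "p \<in> D" "xy_gen k 1 = f p * f (xy_gen k \<epsilon>')" using pull[of 1] by auto
    have "coef (xy_gen k 1) (xi k) \<noteq> 0" by (simp add: xy_gen_def coef_t)
    then have "coef (f p * f (xy_gen k \<epsilon>')) (xi k) \<noteq> 0" unfolding p(2) .
    from supp_mult[OF D_torus[OF aut_D[OF fg p(1)]] B_torus[OF F(1)[OF B_uu[OF k]]] this]
    obtain h h' where h: "coef (f p) h \<noteq> 0" "coef (f (xy_gen k \<epsilon>')) h' \<noteq> 0" "xi k = h + h'" by blast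
    have "h (Suc (2 * k)) = 0" using aut_D[OF fg p(1)] h(1) k by (auto simp: D_def)
    moreover have "h' (Suc (2 * k)) = \<epsilon>' * \<epsilon>" using hom[OF e'(1)] h(2) k by (auto simp: homog_def)
    moreover have "1 = h (Suc (2 * k)) + h' (Suc (2 * k))" using fun_cong[OF h(3), of "Suc (2 * k)"] by (simp add: fun_apply)
    ultimately show ?thesis using e e' by auto
  qed
  have se: "s * \<epsilon> = 1 \<or> s * \<epsilon> = -1" and ee: "s * \<epsilon> * \<epsilon> = s" using s e by auto
  obtain r where r: "r \<in> D" "f (xy_gen k s) = r * xy_gen k (s * \<epsilon>)"
    using homog_uu[OF F(1)[OF B_uu[OF k]] k hom[OF s] se] by blast
  obtain p where p: "p \<in> D" "xy_gen k (s * \<epsilon>) = f p * f (xy_gen k s)"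
    using pull[OF se] \<open>\<epsilon>' = \<epsilon>\<close> ee by auto
  have fp: "f p \<in> D" by (rule aut_D[OF fg p(1)])
  have "(f p * r - 1) * xy_gen k (s * \<epsilon>) = 0" using p(2) r(2) by (simp add: left_diff_distrib mult.assoc)
  then have "f p * r - 1 = 0"
    using torus_domain[OF torus_diff[OF torus_mult torus_1] B_torus[OF B_uu[OF k]], of "f p" r "s * \<epsilon>"]
      D_torus[OF fp] D_torus[OF r(1)] xy_gen_nz[OF k] by blast
  then have "f p * r = 1" "r * f p = 1" using D_comm[OF fp r(1)] by auto
  then obtain a c where "c \<noteq> 0" "r = sc c * tz a" using B_unit[OF D_B[OF r(1)] D_B[OF fp]] by blast
  then show ?thesis using r(2) by (auto simp: mult.assoc)
qed

lemma xy_gen_tz: assumes k: "k \<in> {1..n}" and s: "s = 1 \<or> s = -1"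
  shows "xy_gen k s * tz a = sc (q k powi (s * a k)) * (tz a * xy_gen k s)"
proof -
  have tw: "tw (xi k) (zexp a) = q k powi (- a k)"
  proof -
    have "tw (xi k) (zexp a) = (\<Prod>i\<in>{1..n}. if i = k then q k powi (- a k) else 1)"
      unfolding tw_right_zexp by (intro prod.cong) auto
    then show ?thesis using k by simp
  qed
  have X: "t (xi k) * tz a = sc (q k powi (a k)) * (tz a * t (xi k))"
    using q_nz[OF k] by (simp add: t_mult tw sc_mult' power_int_minus add.commute)
  have x: "t (- xi k) * tz a = sc (q k powi (- a k)) * (tz a * t (- xi k))"
    using q_nz[OF k] by (simp add: t_mult tw tw_minus_left sc_mult' power_int_minus add.commute)
  have "(t (zi k) - 1) * tz a = tz a * (t (zi k) - 1)"
    using tz_mult[of a "unit_vec k 1"] tz_mult[of "unit_vec k 1" a] k by (simp add: zexp_un left_diff_distrib right_diff_distrib add.commute)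
  then have "rho (GY k) * tz a = sc (q k powi (- a k)) * (tz a * rho (GY k))"
    by (simp add: x mult.assoc sc_comm'[of "t (zi k) - 1"] sc_mult' t_sc' mult.commute) (simp flip: mult.assoc)
  then show ?thesis using s X by (auto simp: xy_gen_def simp del: rho.simps(2))
qed

lemma xy_gen_uu: assumes i: "i \<in> {1..n}" and k: "k \<in> {1..n}" and ik: "i \<noteq> k" and s: "s = 1 \<or> s = -1" and u: "u = 1 \<or> u = -1"
  shows "xy_gen i s * xy_gen k u = sc (lam i k powi (s * u)) * (xy_gen k u * xy_gen i s)"
proof -
  have v: "fa_valid n (fa_gen (GX j) :: 'k fa)" "fa_valid n (fa_gen (GY j) :: 'k fa)" if "j \<in> {1..n}" for j
    using that by (auto intro: fa_valid_gen)
  have l: "lam k i = lam i k powi (- 1)" using lam_inv[OF i k] by (simp add: power_int_minus)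
  have "rho (GX i) * rho (GX k) = sc (lam i k) * (rho (GX k) * rho (GX i))"
    "rho (GY i) * rho (GY k) = sc (lam i k) * (rho (GY k) * rho (GY i))"
    "rho (GX i) * rho (GY k) = sc (lam k i) * (rho (GY k) * rho (GX i))"
    "rho (GY i) * rho (GX k) = sc (lam k i) * (rho (GX k) * rho (GY i))"
    using rho_qcomm[OF qcomm_XX[OF i k ik] v(1)[OF i] v(1)[OF k]] rho_qcomm[OF qcomm_YY[OF i k ik] v(2)[OF i] v(2)[OF k]]
      rho_qcomm[OF qcomm_XY[OF i k ik] v(1)[OF i] v(2)[OF k]] rho_qcomm[OF qcomm_YX[OF i k ik] v(2)[OF i] v(1)[OF k]]
    unfolding ev_gen by blast+
  then show ?thesis using s u unfolding l xy_gen_def by (auto simp del: rho.simps)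
qed

lemma tz_uu_mult:
  assumes k: "k \<in> {1..n}" and s: "s = 1 \<or> s = -1"
  shows "(sc \<alpha> * (tz a * xy_gen k s)) * (sc \<beta> * (tz b * v)) = sc (\<alpha> * \<beta> * q k powi (s * b k)) * (tz (a + b) * (xy_gen k s * v))"
proof -
  have "(tz a * xy_gen k s) * (tz b * v) = tz a * ((xy_gen k s * tz b) * v)" by (simp add: mult.assoc)
  also have "\<dots> = sc (q k powi (s * b k)) * (tz (a + b) * (xy_gen k s * v))"
    unfolding xy_gen_tz[OF k s] tz_mult[symmetric] by (simp add: mult.assoc t_sc')
  finally show ?thesis by (simp add: sc_mult_sc sc_mult')
qed

text \<open>Both sides of f(y_k) f(x_k) = (f(z_k) - 1) / (q_k - 1) are two-term Laurent polynomials
  in the z_i. Matching the terms determines a + b and the scalar. For \<epsilon> = 1 the letters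
  multiply to y_k x_k = (z_k - 1) / (q_k - 1); for \<epsilon> = -1 to x_k y_k = (q_k z_k - 1) / (q_k
  - 1), whence the extra factor of q_k and the shift by one.\<close>

lemma aut_product:
  assumes fg: "aut_pair f g" and k: "k \<in> {1..n}" and e: "\<epsilon> = 1 \<or> \<epsilon> = -1"
    and z: "f (t (zi k)) = sc c * tz (unit_vec k \<epsilon>)"
    and X: "f (rho (GX k)) = sc \<alpha> * (tz a * xy_gen k \<epsilon>)" and Y: "f (rho (GY k)) = sc \<beta> * (tz b * xy_gen k (- \<epsilon>))"
  shows "\<epsilon> = 1 \<Longrightarrow> \<alpha> * \<beta> = q k powi (a k) \<and> (\<forall>j\<in>{1..n}. b j = - a j)"
    and "\<epsilon> = -1 \<Longrightarrow> \<alpha> * \<beta> = - (q k powi (- a k - 1)) \<and> (\<forall>j\<in>{1..n}. b j = - a j - unit_vec k 1 j)"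
proof -
  note F = aut_pairD[OF fg]
  have q: "q k \<noteq> 0" "q k - 1 \<noteq> 0" using q_nz q_ne_1 k by auto
  have zB: "t (zi k) \<in> B" using B_z k by blast
  have "f (rho (GY k)) * f (rho (GX k)) = f (rho (GY k) * rho (GX k))" using F(4) B_X B_Y k by simp
  also have "\<dots> = sc (inverse (q k - 1)) * (f (t (zi k)) - 1)"
    unfolding rho_YX[OF k] using zB by (simp add: F B_diff B_1 aut_diff[OF fg])
  finally have main: "sc (\<beta> * \<alpha> * q k powi (- \<epsilon> * a k)) * (tz (b + a) * (xy_gen k (- \<epsilon>) * xy_gen k \<epsilon>)) = sc (inverse (q k - 1)) * (sc c * tz (unit_vec k \<epsilon>) - 1)"
    unfolding X Y z using e by (subst (asm) tz_uu_mult[OF k]) auto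
  define K where "K = \<beta> * \<alpha> * q k powi (- \<epsilon> * a k)"
  have tz1: "tz (b + a) * t (zi k) = tz (b + a + unit_vec k 1)"
    using tz_mult[of "b + a" "unit_vec k 1"] k by (simp add: zexp_un)
  have cancel: "L = M" if "sc (inverse (q k - 1)) * L = sc (inverse (q k - 1)) * M" for L M :: "'k lop"
    using arg_cong[OF that, of "(*) (sc (q k - 1))"] q by (simp add: sc_mult')
  have c0: "coef 1 h = (if h = 0 then 1 else 0 :: 'k)" for h using coef_t[of 0 h] by auto
  have z0: "zexp h = 0 \<longleftrightarrow> (\<forall>i\<in>{1..n}. h i = 0)" for h using zexp_eq_iff[of h 0] zexp_0 by (simp add: fun_apply)
  {
    assume "\<epsilon> = 1"
    then have "sc (inverse (q k - 1)) * (sc K * (tz (b + a + unit_vec k 1) - tz (b + a))) = sc (inverse (q k - 1)) * (sc c * tz (unit_vec k 1) - 1)"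
      using main rho_YX[OF k] unfolding K_def xy_gen_def
      by (simp add: t_sc t_sc' sc_mult sc_mult' right_diff_distrib tz1 mult.commute mult.left_commute del: rho.simps)
    note eq = cancel[OF this]
    have E: "K * (if zexp (b + a + unit_vec k 1) = h then 1 else 0) - K * (if zexp (b + a) = h then 1 else 0)
       = c * (if zexp (unit_vec k 1) = h then 1 else 0) - (if h = 0 then 1 else 0)" for h
      using arg_cong[OF eq, of "\<lambda>L. coef L h"] by (simp only: right_diff_distrib coef_diff coef_sc coef_t c0)
    \<comment> \<open>Write e_k for the exponent of z_k. The other matching of terms would need a +
      b = - e_k and a + b = e_k at once.\<close>
    have ab: "zexp (b + a) = 0"
    proof (rule ccontr)
      assume ne: "zexp (b + a) \<noteq> 0"
      have unit_vec: "zexp (unit_vec k 1) \<noteq> 0" using k by (auto simp: z0 unit_vec_def)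
      have "zexp (b + a + unit_vec k 1) = 0" "K = -1" using E[of 0] ne unit_vec by (auto split: if_splits)
      then have "zexp (b + a) = - zexp (unit_vec k 1)" by (simp add: zexp_add eq_neg_iff_add_eq_0)
      then have "zexp (b + a) \<noteq> zexp (unit_vec k 1)" using k by (auto simp: zexp_eq_iff unit_vec_def fun_apply simp flip: zexp_minus)
      then show False using E[of "zexp (b + a)"] ne \<open>K = -1\<close> \<open>zexp (b + a + unit_vec k 1) = 0\<close> by (auto split: if_splits)
    qed
    then have "K = 1" using E[of 0] k by (auto simp: zexp_add z0 unit_vec_def split: if_splits)
    then have "\<alpha> * \<beta> = q k powi (a k)" using q \<open>\<epsilon> = 1\<close> by (simp add: K_def power_int_minus field_simps)
    then show "\<alpha> * \<beta> = q k powi (a k) \<and> (\<forall>j\<in>{1..n}. b j = - a j)"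
      using ab by (auto simp: z0 fun_apply eq_neg_iff_add_eq_0)
  next
    assume "\<epsilon> = -1"
    then have "sc (inverse (q k - 1)) * (sc K * (sc (q k) * tz (b + a + unit_vec k 1) - tz (b + a))) = sc (inverse (q k - 1)) * (sc c * tz (unit_vec k (-1)) - 1)"
      using main rho_XY[OF k] unfolding K_def xy_gen_def
      by (simp add: t_sc t_sc' sc_mult sc_mult' right_diff_distrib tz1 mult.commute mult.left_commute del: rho.simps)
    note eq = cancel[OF this]
    have E: "K * (q k * (if zexp (b + a + unit_vec k 1) = h then 1 else 0)) - K * (if zexp (b + a) = h then 1 else 0)
       = c * (if zexp (unit_vec k (-1)) = h then 1 else 0) - (if h = 0 then 1 else 0)" for h
      using arg_cong[OF eq, of "\<lambda>L. coef L h"] by (simp only: right_diff_distrib coef_diff coef_sc coef_t c0)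
    have unit_vec: "zexp (unit_vec k 1) \<noteq> 0" "zexp (unit_vec k (-1)) \<noteq> 0" "zexp (unit_vec k 1) \<noteq> zexp (unit_vec k (-1))" using k by (auto simp: z0 zexp_eq_iff unit_vec_def)
    \<comment> \<open>Here a + b = 0 would leave a term in z_k on the left that has no partner among
      z_k^(-1) and 1.\<close>
    have ne: "zexp (b + a) \<noteq> 0"
    proof
      assume z: "zexp (b + a) = 0"
      then have "zexp (b + a + unit_vec k 1) = zexp (unit_vec k 1)" by (simp add: zexp_add)
      then have "K * q k = 0" "K = 1" using E[of "zexp (unit_vec k 1)"] E[of 0] unit_vec z by (auto split: if_splits)
      then show False using q by simp
    qed
    have ab: "zexp (b + a + unit_vec k 1) = 0" and "K * q k = -1" using E[of 0] ne unit_vec by (auto split: if_splits)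
    then have "\<alpha> * \<beta> = - (q k powi (- a k - 1))"
      using q \<open>\<epsilon> = -1\<close> by (simp add: K_def power_int_minus power_int_diff field_simps)
    then show "\<alpha> * \<beta> = - (q k powi (- a k - 1)) \<and> (\<forall>j\<in>{1..n}. b j = - a j - unit_vec k 1 j)"
      using ab by (auto simp: z0 fun_apply)
  }
qed

text \<open>Applying f to x_i x_k = lam_ik x_k x_i and moving all Laurent monomials to the front
  leaves the same nonzero torus element on both sides, so only the scalars remain to be
  compared.\<close>

lemma aut_cross:
  assumes fg: "aut_pair f g" and i: "i \<in> {1..n}" and k: "k \<in> {1..n}" and ik: "i \<noteq> k"
    and s: "s = 1 \<or> s = -1" and u: "u = 1 \<or> u = -1" and nz: "\<alpha> \<noteq> 0" "\<beta> \<noteq> 0"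
    and X: "f (rho (GX i)) = sc \<alpha> * (tz a * xy_gen i s)" "f (rho (GX k)) = sc \<beta> * (tz b * xy_gen k u)"
  shows "q i powi (s * b i) * lam i k powi (s * u) = lam i k * q k powi (u * a k)"
proof -
  note F = aut_pairD[OF fg]
  have "rho (GX i) * rho (GX k) = sc (lam i k) * (rho (GX k) * rho (GX i))"
    using xy_gen_uu[OF i k ik, of 1 1] by (simp add: xy_gen_def del: rho.simps)
  from arg_cong[OF this, of f]
  have "f (rho (GX i)) * f (rho (GX k)) = sc (lam i k) * (f (rho (GX k)) * f (rho (GX i)))"
    using B_X i k by (simp add: F B_mult del: rho.simps)
  then have "sc (\<alpha> * \<beta> * q i powi (s * b i)) * (tz (a + b) * (xy_gen i s * xy_gen k u)) =
     sc (lam i k) * (sc (\<beta> * \<alpha> * q k powi (u * a k)) * (tz (b + a) * (xy_gen k u * xy_gen i s)))"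
    unfolding X tz_uu_mult[OF i s] tz_uu_mult[OF k u] .
  then have "sc (\<alpha> * \<beta> * (q i powi (s * b i) * lam i k powi (s * u))) * (tz (a + b) * (xy_gen k u * xy_gen i s)) =
     sc (\<alpha> * \<beta> * (lam i k * q k powi (u * a k))) * (tz (a + b) * (xy_gen k u * xy_gen i s))"
    unfolding xy_gen_uu[OF i k ik s u] by (simp add: t_sc' sc_mult' ac_simps)
  then have "sc (\<alpha> * \<beta> * (q i powi (s * b i) * lam i k powi (s * u)) - \<alpha> * \<beta> * (lam i k * q k powi (u * a k))) * (tz (a + b) * (xy_gen k u * xy_gen i s)) = 0"
    by (simp add: sc_diff left_diff_distrib)
  moreover have "tz (a + b) * (xy_gen k u * xy_gen i s) \<noteq> 0"
    by (intro torus_domain torus_mult B_torus B_uu B_tz xy_gen_nz t_nz i k)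
  moreover have "sc c * L = 0 \<Longrightarrow> L \<noteq> 0 \<Longrightarrow> c = 0" for c and L :: "'k lop"
    using sc_inverse(2)[of c L] by force
  ultimately have "\<alpha> * \<beta> * (q i powi (s * b i) * lam i k powi (s * u)) - \<alpha> * \<beta> * (lam i k * q k powi (u * a k)) = 0" by blast
  then show ?thesis using nz by simp
qed

section \<open>The shape of automorphisms\<close>

lemma fa_valid_monomial:
  assumes "P \<subseteq> {1..n}" "i \<in> {1..n}" "gen_idx g \<in> {1..n}"
  shows "fa_valid n ((k :: 'k) \<odot> (zprod P e \<star> zpow i m \<star> fa_gen g))"
  using assms by (intro fa_valid_smult fa_valid_mult fa_valid_zprod fa_valid_zpow fa_valid_gen)

lemma ev_monomial:
  assumes "P \<subseteq> {1..n}" "i \<in> {1..n}" "gen_idx g \<in> {1..n}"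
  shows "ev (s :: gen \<Rightarrow> 'k lop) (k \<odot> (zprod P e \<star> zpow i m \<star> fa_gen g)) = sc k * (ev s (zprod P e) * ev s (zpow i m) * s g)"
proof -
  have v: "fa_valid n (zprod P e :: 'k fa)" "fa_valid n (zpow i m :: 'k fa)" "fa_valid n (fa_gen g :: 'k fa)"
    using assms by (auto intro!: fa_valid_zprod fa_valid_zpow fa_valid_gen)
  show ?thesis
    unfolding ev_smult[OF fa_valid_mult[OF fa_valid_mult[OF v(1,2)] v(3)]]
      ev_mult[OF fa_valid_mult[OF v(1,2)] v(3)] ev_mult[OF v(1,2)] ev_gen ..
qed

lemma ev_rho_monomial:
  assumes "P \<subseteq> {1..n}" "i \<in> {1..n}" "gen_idx g \<in> {1..n}"
  shows "ev rho (k \<odot> (zprod P e \<star> zpow i m \<star> fa_gen g)) = sc k * (tz ((\<lambda>j. if j \<in> P then e j else 0) + unit_vec i m) * rho g)"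
  unfolding ev_monomial[OF assms] ev_zprod[OF assms(1)] ev_zpow[OF assms(2)] tz_mult ..

lemma q_pair_indep:
  assumes "i \<in> {1..n}" "j \<in> {1..n}" "i \<noteq> j" "q i powi m = q j powi m'"
  shows "m = 0 \<and> m' = 0"
proof -
  have "(\<Prod>k\<in>{1..n}. q k powi (unit_vec i m k)) = (\<Prod>k\<in>{1..n}. q k powi (unit_vec j m' k))"
    using assms q_powi_prod by metis
  from q_prod_inj[OF this assms(1)] q_prod_inj[OF this assms(2)] show ?thesis
    using assms(3) by (simp add: unit_vec_def)
qed

lemma bij_aut_pair:
  assumes f: "alg_hom f" and inj: "inj_on f B" and surj: "B \<subseteq> f ` B"
  shows "aut_pair f (inv_into B f)"
proof -
  let ?g = "inv_into B f"
  note F = f[unfolded alg_hom_def]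
  have gB: "?g a \<in> B" "f (?g a) = a" if "a \<in> B" for a
    using that surj by (auto intro: inv_into_into f_inv_into_f)
  have uniq: "?g a = b" if "b \<in> B" "f b = a" for a b
    using that inj by auto
  have "alg_hom ?g" unfolding alg_hom_def
    using F gB by (auto intro!: uniq B_add B_sc B_mult B_1)
  then show ?thesis unfolding aut_pair_def using f gB uniq by auto
qed

text \<open>The map \<phi> lives on representatives. Choosing a valid preimage for every element of
  \<open>B\<close> turns it into a map of \<open>B\<close>, whose value does not depend on the
  choice because congruence is equality of images.\<close>

lemma auto_imp_aut_pair:
  assumes "is_AZ_auto n q lam \<phi>"
  shows "\<exists>f g. aut_pair f g \<and> (\<forall>a. fa_valid n a \<longrightarrow> f (ev rho a) = ev rho (\<phi> a))"
proof -
  define pick where "pick L = (SOME a. fa_valid n a \<and> ev rho a = L)" for L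
  define f where "f L = ev rho (\<phi> (pick L))" for L
  have val: "fa_valid n (\<phi> a)" if "fa_valid n a" for a using assms that unfolding is_AZ_auto_def by blast
  have cg: "ev rho a = ev rho b \<longleftrightarrow> ev rho (\<phi> a) = ev rho (\<phi> b)" if "fa_valid n a" "fa_valid n b" for a b
    using assms that rho_cong[OF that] rho_cong[OF val[OF that(1)] val[OF that(2)]] unfolding is_AZ_auto_def by blast
  have pick: "fa_valid n (pick (ev rho a))" "ev rho (pick (ev rho a)) = ev rho a" if "fa_valid n a" for a
    using someI[of "\<lambda>b. fa_valid n b \<and> ev rho b = ev rho a" a] that unfolding pick_def by auto
  have fe: "f (ev rho a) = ev rho (\<phi> a)" if "fa_valid n a" for a
    unfolding f_def using cg[OF pick(1)[OF that] that] pick(2)[OF that] by simp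
  have add: "f (ev rho a + ev rho b) = f (ev rho a) + f (ev rho b)" if v: "fa_valid n a" "fa_valid n b" for a b
  proof -
    have "fa_cong n q lam (\<phi> (a + b)) (\<phi> a + \<phi> b)"
      using assms v unfolding is_AZ_auto_def fa_add_eq by blast
    then have "ev rho (\<phi> (a + b)) = ev rho (\<phi> a) + ev rho (\<phi> b)"
      using rho_cong[OF val[OF fa_valid_add[OF v]] fa_valid_add[OF val[OF v(1)] val[OF v(2)]]]
        ev_add[OF val[OF v(1)] val[OF v(2)], of rho] by simp
    then show ?thesis using fe[OF fa_valid_add[OF v]] fe[OF v(1)] fe[OF v(2)] ev_add[OF v, of rho] by simp
  qed
  have mult: "f (ev rho a * ev rho b) = f (ev rho a) * f (ev rho b)" if v: "fa_valid n a" "fa_valid n b" for a b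
  proof -
    have "fa_cong n q lam (\<phi> (a \<star> b)) (\<phi> a \<star> \<phi> b)"
      using assms v unfolding is_AZ_auto_def by blast
    then have "ev rho (\<phi> (a \<star> b)) = ev rho (\<phi> a) * ev rho (\<phi> b)"
      using rho_cong[OF val[OF fa_valid_mult[OF v]] fa_valid_mult[OF val[OF v(1)] val[OF v(2)]]]
        ev_mult[OF val[OF v(1)] val[OF v(2)], of rho] by simp
    then show ?thesis using fe[OF fa_valid_mult[OF v]] fe[OF v(1)] fe[OF v(2)] ev_mult[OF v, of rho] by simp
  qed
  have sc: "f (sc c * ev rho a) = sc c * f (ev rho a)" if v: "fa_valid n a" for a c
  proof -
    have "fa_cong n q lam (\<phi> (c \<odot> a)) (c \<odot> \<phi> a)"
      using assms v unfolding is_AZ_auto_def by blast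
    then have "ev rho (\<phi> (c \<odot> a)) = sc c * ev rho (\<phi> a)"
      using rho_cong[OF val[OF fa_valid_smult[OF v]] fa_valid_smult[OF val[OF v]]]
        ev_smult[OF val[OF v], of rho] by simp
    then show ?thesis using fe[OF fa_valid_smult[OF v]] fe[OF v] ev_smult[OF v, of rho] by simp
  qed
  have one: "f 1 = 1"
  proof -
    have "fa_cong n q lam (\<phi> fa_one) fa_one" using assms unfolding is_AZ_auto_def by blast
    then show ?thesis using rho_cong[OF val[OF fa_valid_one] fa_valid_one] fe[OF fa_valid_one] by (simp add: ev_one)
  qed
  have hom: "alg_hom f" unfolding alg_hom_def B_def
    using add mult sc one fe val by auto
  have inj: "inj_on f B" unfolding inj_on_def B_def using cg fe by auto
  have "B \<subseteq> f ` B"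
  proof
    fix L assume "L \<in> B"
    then obtain b where b: "fa_valid n b" "L = ev rho b" by (auto simp: B_def)
    have "\<forall>b. fa_valid n b \<longrightarrow> (\<exists>a. fa_valid n a \<and> fa_cong n q lam (\<phi> a) b)"
      using assms unfolding is_AZ_auto_def by (elim conjE)
    then obtain a where a: "fa_valid n a" "fa_cong n q lam (\<phi> a) b" using b(1) by blast
    then have "L = f (ev rho a)" using rho_cong[OF val[OF a(1)] b(1)] fe[OF a(1)] b(2) by simp
    then show "L \<in> f ` B" using B_ev[OF a(1)] by blast
  qed
  from bij_aut_pair[OF hom inj this] fe show ?thesis by blast
qed

text \<open>The signs \<epsilon> define the partition, and one exponent family gives all integers of
  the shape: c_k is its diagonal entry \<open>a k k\<close>, while the a_ij and b_ji are its entries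
  between the two blocks.\<close>

theorem auto_has_shape:
  assumes auto: "is_AZ_auto n q lam \<phi>"
  shows "\<exists>P1 P2 c a b \<alpha> \<beta>. shape_params n q lam P1 P2 c a b \<alpha> \<beta> \<and> auto_shape n q lam \<phi> P1 P2 c a b \<alpha> \<beta>"
proof -
  obtain f g where fg: "aut_pair f g" and fe: "\<And>a. fa_valid n a \<Longrightarrow> f (ev rho a) = ev rho (\<phi> a)"
    using auto_imp_aut_pair[OF auto] by blast
  have val: "fa_valid n (\<phi> a)" if "fa_valid n a" for a using auto that unfolding is_AZ_auto_def by blast
  obtain \<epsilon> d where e: "\<And>k. k \<in> {1..n} \<Longrightarrow> \<epsilon> k = 1 \<or> \<epsilon> k = -1"
    and z: "\<And>k. k \<in> {1..n} \<Longrightarrow> f (t (zi k)) = sc (d k) * tz (unit_vec k (\<epsilon> k))"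
    and hX: "\<And>k. k \<in> {1..n} \<Longrightarrow> homog k (\<epsilon> k) (f (rho (GX k)))" and hY: "\<And>k. k \<in> {1..n} \<Longrightarrow> homog k (- \<epsilon> k) (f (rho (GY k)))"
    using aut_degrees[OF fg] by metis
  have "\<exists>\<alpha> a. \<alpha> \<noteq> 0 \<and> f (rho (GX k)) = sc \<alpha> * (tz a * xy_gen k (\<epsilon> k))" if k: "k \<in> {1..n}" for k
    using aut_monomial[OF fg k e[OF k] hX[OF k] hY[OF k], of 1] by (simp add: xy_gen_def[of k 1] del: rho.simps)
  then obtain \<alpha> a where X: "\<And>k. k \<in> {1..n} \<Longrightarrow> \<alpha> k \<noteq> 0 \<and> f (rho (GX k)) = sc (\<alpha> k) * (tz (a k) * xy_gen k (\<epsilon> k))" by metis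
  have "\<exists>\<beta> b. \<beta> \<noteq> 0 \<and> f (rho (GY k)) = sc \<beta> * (tz b * xy_gen k (- \<epsilon> k))" if k: "k \<in> {1..n}" for k
    using aut_monomial[OF fg k e[OF k] hX[OF k] hY[OF k], of "-1"] by (simp add: xy_gen_def[of k "-1"] del: rho.simps)
  then obtain \<beta> b where Y: "\<And>k. k \<in> {1..n} \<Longrightarrow> \<beta> k \<noteq> 0 \<and> f (rho (GY k)) = sc (\<beta> k) * (tz (b k) * xy_gen k (- \<epsilon> k))" by metis
  have prod1: "\<alpha> k * \<beta> k = q k powi (a k k)" "\<And>j. j \<in> {1..n} \<Longrightarrow> b k j = - a k j" if k: "k \<in> {1..n}" and "\<epsilon> k = 1" for k
    using aut_product(1)[OF fg k e[OF k] z[OF k], of "\<alpha> k" "a k" "\<beta> k" "b k"] X[OF k] Y[OF k] \<open>\<epsilon> k = 1\<close> by auto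
  have prod2: "\<alpha> k * \<beta> k = - (q k powi (- a k k - 1))" "\<And>j. j \<in> {1..n} \<Longrightarrow> b k j = - a k j - unit_vec k 1 j"
    if k: "k \<in> {1..n}" and "\<epsilon> k = -1" for k
    using aut_product(2)[OF fg k e[OF k] z[OF k], of "\<alpha> k" "a k" "\<beta> k" "b k"] X[OF k] Y[OF k] \<open>\<epsilon> k = -1\<close> by auto
  have cross: "q i powi (\<epsilon> i * a k i) * lam i k powi (\<epsilon> i * \<epsilon> k) = lam i k * q k powi (\<epsilon> k * a i k)"
    if "i \<in> {1..n}" "k \<in> {1..n}" "i \<noteq> k" for i k
    using aut_cross[OF fg that e[OF that(1)] e[OF that(2)], of "\<alpha> i" "\<alpha> k" "a i" "a k"] X that by blast
  \<comment> \<open>For equal signs the powers of lam in the cross relation cancel, leaving a power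
    of q_i equal to a power of q_k; independence makes both exponents 0. This is why only z_j from
    the other block, and z_i itself, occur in the image of x_i.\<close>
  have zero: "a i k = 0" if ik: "i \<in> {1..n}" "k \<in> {1..n}" "i \<noteq> k" and "\<epsilon> i = \<epsilon> k" for i k
  proof -
    have "\<epsilon> i * \<epsilon> k = 1" using e[OF ik(1)] that by auto
    then have "q i powi (\<epsilon> i * a k i) = q k powi (\<epsilon> k * a i k)" using cross[OF ik] lam_nz[OF ik(1,2)] by simp
    from q_pair_indep[OF ik this] show ?thesis using e[OF ik(2)] by auto
  qed
  define P1 where "P1 = {k\<in>{1..n}. \<epsilon> k = 1}"
  define P2 where "P2 = {k\<in>{1..n}. \<epsilon> k = -1}"
  have sub: "P1 \<subseteq> {1..n}" "P2 \<subseteq> {1..n}" by (auto simp: P1_def P2_def)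
  have params: "shape_params n q lam P1 P2 (\<lambda>k. a k k) a a \<alpha> \<beta>"
    unfolding shape_params_def
  proof (intro conjI ballI)
    show "P1 \<union> P2 = {1..n}" using e unfolding P1_def P2_def by blast
    show "P1 \<inter> P2 = {}" by (auto simp: P1_def P2_def)
    show "\<alpha> k \<noteq> 0" "\<beta> k \<noteq> 0" if "k \<in> {1..n}" for k using X[OF that] Y[OF that] by auto
    show "\<alpha> i * \<beta> i = q i powi a i i" if "i \<in> P1" for i using that prod1 by (auto simp: P1_def)
    show "\<alpha> i * \<beta> i = - (q i powi (- a i i - 1))" if "i \<in> P2" for i using that prod2 by (auto simp: P2_def)
    show "q i powi a j i * q j powi a i j = (lam i j)\<^sup>2" if ij: "i \<in> P1" "j \<in> P2" for i j
    proof -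
      have ij': "i \<in> {1..n}" "j \<in> {1..n}" "i \<noteq> j" "\<epsilon> i = 1" "\<epsilon> j = -1" using ij by (auto simp: P1_def P2_def)
      show ?thesis using cross[OF ij'(1-3)] lam_nz[OF ij'(1,2)] q_nz[OF ij'(2)] ij'(4,5)
        by (simp add: power_int_minus field_simps power2_eq_square)
    qed
  qed
  \<comment> \<open>Here r is the exponent vector found for the image; congruence follows once it
    agrees on 1, ..., n with that of \<open>zprod P u\<close> times \<open>zpow i m\<close>.\<close>
  have congI: "fa_cong n q lam (\<phi> (fa_gen v)) (k \<odot> (zprod P u \<star> zpow i m \<star> fa_gen w))"
    if "P \<subseteq> {1..n}" "i \<in> {1..n}" "gen_idx v \<in> {1..n}" "gen_idx w \<in> {1..n}" "f (rho v) = sc k * (tz r * rho w)"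
      "\<And>j. j \<in> {1..n} \<Longrightarrow> r j = (if j \<in> P then u j else 0) + unit_vec i m j" for v w k P u i m r
  proof -
    have "ev rho (\<phi> (fa_gen v)) = sc k * (tz r * rho w)" using fe[OF fa_valid_gen[OF that(3)]] that(5) by (simp add: ev_gen)
    also have "zexp r = zexp ((\<lambda>j. if j \<in> P then u j else 0) + unit_vec i m)" by (intro zexp_cong) (simp add: that(6) fun_apply)
    also have "sc k * (t \<dots> * rho w) = ev rho (k \<odot> (zprod P u \<star> zpow i m \<star> fa_gen w))"
      using ev_rho_monomial[OF that(1,2,4)] by simp
    finally show ?thesis
      using rho_cong[OF val[OF fa_valid_gen[OF that(3)]] fa_valid_monomial[OF that(1,2,4)]] by simp
  qed
  have "auto_shape n q lam \<phi> P1 P2 (\<lambda>k. a k k) a a \<alpha> \<beta>"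
    unfolding auto_shape_def
  proof (intro conjI ballI)
    fix i assume "i \<in> P1"
    then have i: "i \<in> {1..n}" "\<epsilon> i = 1" by (auto simp: P1_def)
    have out: "j \<in> P2 \<or> j = i \<or> a i j = 0" "i \<notin> P2" if "j \<in> {1..n}" for j
      using zero[OF i(1) that] i(2) e[OF that] that unfolding P2_def by (cases "j = i"; auto)+
    show "fa_cong n q lam (\<phi> (X i)) (\<alpha> i \<odot> (zprod P2 (a i) \<star> zpow i (a i i) \<star> X i))"
      using X[OF i(1)] i out by (intro congI[OF sub(2), of _ _ _ _ "a i"]) (auto simp: xy_gen_def unit_vec_def simp del: rho.simps)
    show "fa_cong n q lam (\<phi> (Y i)) (\<beta> i \<odot> (zprod P2 (\<lambda>j. - a i j) \<star> zpow i (- a i i) \<star> Y i))"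
      using Y[OF i(1)] i out prod1(2)[OF i] by (intro congI[OF sub(2), of _ _ _ _ "b i"]) (auto simp: xy_gen_def unit_vec_def simp del: rho.simps)
  next
    fix i assume "i \<in> P2"
    then have i: "i \<in> {1..n}" "\<epsilon> i = -1" by (auto simp: P2_def)
    have out: "j \<in> P1 \<or> j = i \<or> a i j = 0" "i \<notin> P1" if "j \<in> {1..n}" for j
      using zero[OF i(1) that] i(2) e[OF that] that unfolding P1_def by (cases "j = i"; auto)+
    show "fa_cong n q lam (\<phi> (X i)) (\<alpha> i \<odot> (zprod P1 (a i) \<star> zpow i (a i i) \<star> Y i))"
      using X[OF i(1)] i out by (intro congI[OF sub(1), of _ _ _ _ "a i"]) (auto simp: xy_gen_def unit_vec_def simp del: rho.simps)
    show "fa_cong n q lam (\<phi> (Y i)) (\<beta> i \<odot> (zprod P1 (\<lambda>j. - a i j) \<star> zpow i (- a i i - 1) \<star> X i))"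
      using Y[OF i(1)] i out prod2(2)[OF i] by (intro congI[OF sub(1), of _ _ _ _ "b i"]) (auto simp: xy_gen_def unit_vec_def simp del: rho.simps)
  qed
  with params show ?thesis by blast
qed

text \<open>The equation between scalars is what q-commutation of the two monomials amounts to after
  all Laurent monomials have been moved to the front. It serves every pair of images of letters x
  and y with distinct indices.\<close>

lemma xy_gen_qcomm:
  assumes ik: "i \<in> {1..n}" "k \<in> {1..n}" "i \<noteq> k" and s: "s = 1 \<or> s = -1" "u = 1 \<or> u = -1"
    and eq: "q i powi (s * y i) * lam i k powi (s * u) = \<kappa> * q k powi (u * x k)"
  shows "(sc A * (tz x * xy_gen i s)) * (sc C * (tz y * xy_gen k u)) = sc \<kappa> * ((sc C * (tz y * xy_gen k u)) * (sc A * (tz x * xy_gen i s)))"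
proof -
  have "A * C * q i powi (s * y i) * lam i k powi (s * u) = A * C * (q i powi (s * y i) * lam i k powi (s * u))"
    by (simp add: ac_simps)
  also have "\<dots> = \<kappa> * (C * A * q k powi (u * x k))" unfolding eq by (simp add: ac_simps)
  finally have E: "A * C * q i powi (s * y i) * lam i k powi (s * u) = \<kappa> * (C * A * q k powi (u * x k))" .
  show ?thesis
    unfolding tz_uu_mult[OF ik(1) s(1)] tz_uu_mult[OF ik(2) s(2)] xy_gen_uu[OF ik s]
    by (simp only: t_sc' sc_mult' E add.commute[of y x])
qed

end

section \<open>Substitution homomorphisms\<close>

definition sub_word :: "(gen \<Rightarrow> 'k::field fa) \<Rightarrow> gen list \<Rightarrow> 'k fa" where
  "sub_word S w = foldr (\<lambda>g acc. S g \<star> acc) w fa_one"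

definition subst :: "(gen \<Rightarrow> 'k::field fa) \<Rightarrow> 'k fa \<Rightarrow> 'k fa" where
  "subst S f = (\<Sum>w | f w \<noteq> 0. f w \<odot> sub_word S w)"

lemma sub_word_valid:
  assumes "\<And>g. gen_idx g \<in> {1..n} \<Longrightarrow> fa_valid n (S g)"
  shows "word_ok n w \<Longrightarrow> fa_valid n (sub_word S w)"
  by (induction w) (auto simp: sub_word_def word_ok_def intro!: fa_valid_one fa_valid_mult assms)

lemma ev_sub_word:
  assumes "\<And>g. gen_idx g \<in> {1..n} \<Longrightarrow> fa_valid n (S g)"
  shows "word_ok n w \<Longrightarrow> ev s (sub_word S w) = prod_list (map (\<lambda>g. ev s (S g)) w)"
proof (induction w)
  case Nil then show ?case by (simp add: sub_word_def ev_one)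
next
  case (Cons g w)
  then have ok: "gen_idx g \<in> {1..n}" "word_ok n w" by (auto simp: word_ok_def)
  have "sub_word S (g # w) = S g \<star> sub_word S w" by (simp add: sub_word_def)
  then show ?case using ev_mult[OF assms[OF ok(1)] sub_word_valid[of n S, OF assms ok(2)]] Cons.IH[OF ok(2)] by simp
qed

lemma subst_valid:
  assumes "\<And>g. gen_idx g \<in> {1..n} \<Longrightarrow> fa_valid n (S g)" "fa_valid n f"
  shows "fa_valid n (subst S f)"
  unfolding subst_def using assms(2) sub_word_valid[of n S, OF assms(1)]
  by (auto intro!: fa_valid_sum fa_valid_smult simp: fa_valid_iff[of n f])

text \<open>Evaluating after a substitution is evaluating at the new images of the letters. The laws
  for \<open>subst S\<close>, which acts on representatives only, are obtained from those for
  \<open>ev\<close> in this way.\<close>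

lemma ev_subst:
  assumes S: "\<And>g. gen_idx g \<in> {1..n} \<Longrightarrow> fa_valid n (S g)" and f: "fa_valid n f"
  shows "ev s (subst S f) = ev (\<lambda>g. ev s (S g)) f"
proof -
  have ok: "word_ok n w" if "f w \<noteq> 0" for w using that f by (simp add: fa_valid_iff)
  have v: "fa_valid n (sub_word S w)" if "f w \<noteq> 0" for w by (rule sub_word_valid[of n S, OF S ok[OF that]])
  have "ev s (subst S f) = (\<Sum>w | f w \<noteq> 0. ev s (f w \<odot> sub_word S w))"
    unfolding subst_def by (intro ev_sum[of _ n] fa_valid_smult v) simp
  also have "\<dots> = (\<Sum>w | f w \<noteq> 0. sc (f w) * prod_list (map (\<lambda>g. ev s (S g)) w))"
  proof (intro sum.cong refl)
    fix w assume "w \<in> {w. f w \<noteq> 0}"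
    then have w: "f w \<noteq> 0" by simp
    have "ev s (sub_word S w) = prod_list (map (\<lambda>g. ev s (S g)) w)"
      by (rule ev_sub_word[of n S, OF S ok[OF w]])
    then show "ev s (f w \<odot> sub_word S w) = sc (f w) * prod_list (map (\<lambda>g. ev s (S g)) w)"
      unfolding ev_smult[OF v[OF w]] by simp
  qed
  finally show ?thesis by (simp add: ev_def)
qed

lemma ev_cong:
  assumes "\<And>g. gen_idx g \<in> {1..n} \<Longrightarrow> s g = s' g" "fa_valid n f" shows "ev s f = ev s' f"
proof -
  have "map s w = map s' w" if "f w \<noteq> 0" for w
    using assms that by (auto simp: fa_valid_def)
  then have "sc (f w) * prod_list (map s w) = sc (f w) * prod_list (map s' w)" if "w \<in> {w. f w \<noteq> 0}" for w
    using that by (metis mem_Collect_eq)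
  then show ?thesis unfolding ev_def by (rule sum.cong[OF refl])
qed

lemma subst_gen: "subst S (fa_gen g) = S g"
proof -
  have "{w. fa_gen g w \<noteq> (0::'a)} = {[g]}" by (auto simp: fa_gen_def)
  then show ?thesis by (simp add: subst_def sub_word_def fa_gen_def fa_smult_one fa_mult_one_right)
qed

section \<open>The homomorphism attached to admissible parameters\<close>

locale shape = qweyl n q lam for n and q :: "nat \<Rightarrow> 'k::field" and lam +
  fixes P1 P2 :: "nat set" and c :: "nat \<Rightarrow> int" and a b :: "nat \<Rightarrow> nat \<Rightarrow> int" and \<alpha> \<beta> :: "nat \<Rightarrow> 'k"
  assumes params: "shape_params n q lam P1 P2 c a b \<alpha> \<beta>"
begin

lemma P: "P1 \<union> P2 = {1..n}" "P1 \<inter> P2 = {}" "P1 \<subseteq> {1..n}" "P2 \<subseteq> {1..n}"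
  using params by (auto simp: shape_params_def)

lemma in_P2_iff: "k \<in> {1..n} \<Longrightarrow> k \<in> P2 \<longleftrightarrow> k \<notin> P1" using P by blast

lemma nz: "k \<in> {1..n} \<Longrightarrow> \<alpha> k \<noteq> 0" "k \<in> {1..n} \<Longrightarrow> \<beta> k \<noteq> 0"
  using params by (auto simp: shape_params_def)

lemma ab1: "i \<in> P1 \<Longrightarrow> \<alpha> i * \<beta> i = q i powi c i"
  and ab2: "i \<in> P2 \<Longrightarrow> \<alpha> i * \<beta> i = - (q i powi (- c i - 1))"
  and qlam: "i \<in> P1 \<Longrightarrow> j \<in> P2 \<Longrightarrow> q i powi b j i * q j powi a i j = (lam i j)\<^sup>2"
  using params by (auto simp: shape_params_def)

text \<open>The image of w_k is forced: on P2 the prescribed images of x_k and y_k send z_k to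
  q_k^(-1) z_k^(-1), whose inverse is q_k z_k.\<close>

fun S :: "gen \<Rightarrow> 'k fa" where
  "S (GX k) = (if k \<in> P1 then \<alpha> k \<odot> (zprod P2 (\<lambda>j. a k j) \<star> zpow k (c k) \<star> X k)
     else \<alpha> k \<odot> (zprod P1 (\<lambda>j. b k j) \<star> zpow k (c k) \<star> Y k))"
| "S (GY k) = (if k \<in> P1 then \<beta> k \<odot> (zprod P2 (\<lambda>j. - a k j) \<star> zpow k (- c k) \<star> Y k)
     else \<beta> k \<odot> (zprod P1 (\<lambda>j. - b k j) \<star> zpow k (- c k - 1) \<star> X k))"
| "S (GW k) = (if k \<in> P1 then W k else q k \<odot> Z k)"

definition sg :: "nat \<Rightarrow> int" where "sg k = (if k \<in> P1 then 1 else - 1)"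

definition ex :: "nat \<Rightarrow> nat \<Rightarrow> int" where
  "ex k = (\<lambda>j. if k \<in> P1 then (if j \<in> P2 then a k j else 0) + unit_vec k (c k) j
      else (if j \<in> P1 then b k j else 0) + unit_vec k (c k) j)"

text \<open>As in \<open>aut_product\<close>, the z-exponents of the images of x_k and y_k add up to
  0 on P1, and to those of z_k^(-1) on P2.\<close>

definition ey :: "nat \<Rightarrow> nat \<Rightarrow> int" where
  "ey k = (\<lambda>j. - ex k j - (if k \<in> P1 then 0 else unit_vec k 1 j))"

definition s :: "gen \<Rightarrow> 'k lop" where "s g = ev rho (S g)"

lemma S_valid: "gen_idx g \<in> {1..n} \<Longrightarrow> fa_valid n (S g)"
  using P by (cases g) (auto intro!: fa_valid_smult fa_valid_mult fa_valid_zprod fa_valid_zpow fa_valid_Z fa_valid_gen)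

lemma sg_cases: "sg k = 1 \<or> sg k = -1" by (simp add: sg_def)

lemma s_X: assumes k: "k \<in> {1..n}" shows "s (GX k) = sc (\<alpha> k) * (tz (ex k) * xy_gen k (sg k))"
  using k P unfolding s_def
  by (simp add: ev_rho_monomial sg_def xy_gen_def ex_def plus_fun_def del: rho.simps)

lemma s_Y: assumes k: "k \<in> {1..n}" shows "s (GY k) = sc (\<beta> k) * (tz (ey k) * xy_gen k (- sg k))"
proof -
  have "ey k = (\<lambda>j. if j \<in> P2 then - a k j else 0) + unit_vec k (- c k)" if "k \<in> P1"
    using that by (auto simp: ey_def ex_def unit_vec_def fun_eq_iff fun_apply)
  moreover have "ey k = (\<lambda>j. if j \<in> P1 then - b k j else 0) + unit_vec k (- c k - 1)" if "k \<notin> P1"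
    using that by (auto simp: ey_def ex_def unit_vec_def fun_eq_iff fun_apply)
  ultimately show ?thesis using k P unfolding s_def
    by (simp add: ev_rho_monomial sg_def xy_gen_def del: rho.simps)
qed

lemma s_W: assumes k: "k \<in> {1..n}" shows "s (GW k) = (if k \<in> P1 then t (- zi k) else sc (q k) * t (zi k))"
  using k unfolding s_def by (simp add: ev_gen ev_smult[OF fa_valid_Z[OF k]] ev_rho_Z)

text \<open>Within one block the exponents \<open>ex\<close> vanish at the other index and the signs
  agree, so both sides are lam_ij. Across the blocks it is the condition on the square of lam_ij,
  read from either side.\<close>

lemma cross: assumes ij: "i \<in> {1..n}" "j \<in> {1..n}" "i \<noteq> j"
  shows "q i powi (sg i * ex j i) * lam i j powi (sg i * sg j) = lam i j * q j powi (sg j * ex i j)"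
proof -
  have l: "lam i j \<noteq> 0" "lam j i = inverse (lam i j)" "q i \<noteq> 0" "q j \<noteq> 0"
    using ij by (simp_all only: lam_nz lam_inv[of i j] q_nz not_False_eq_True)
  consider "i \<in> P1" "j \<in> P1" | "i \<in> P1" "j \<in> P2" | "i \<in> P2" "j \<in> P1" | "i \<in> P2" "j \<in> P2"
    using in_P2_iff[OF ij(1)] in_P2_iff[OF ij(2)] by blast
  then show ?thesis
  proof cases
    case 1
    then have "i \<notin> P2" "j \<notin> P2" using P(2) by auto
    then show ?thesis using 1 ij by (simp add: sg_def ex_def unit_vec_def)
  next
    case 2
    then have "j \<notin> P1" using P(2) by auto
    then show ?thesis using 2 ij l qlam[OF 2]
      by (simp add: sg_def ex_def unit_vec_def power_int_minus field_simps power2_eq_square)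
  next
    case 3
    then have "i \<notin> P1" using P(2) by auto
    then show ?thesis using 3 ij l(1,3,4) qlam[OF 3(2,1), unfolded l(2)]
      by (simp add: sg_def ex_def unit_vec_def power_int_minus field_simps power2_eq_square)
  next
    case 4
    then have "i \<notin> P1" "j \<notin> P1" using P(2) by auto
    then show ?thesis using 4 ij by (simp add: sg_def ex_def unit_vec_def)
  qed
qed

lemma ey_other: "i \<noteq> k \<Longrightarrow> ey k i = - ex k i" by (simp add: ey_def unit_vec_def)

text \<open>On P1 the Laurent monomials and the scalars cancel. On P2 the two letters trade places,
  and the outcome is the formulas for x_k y_k and y_k x_k with q_k^(-1) z_k^(-1) substituted for
  z_k.\<close>

lemma s_products:
  assumes k: "k \<in> {1..n}"
  shows "s (GX k) * s (GY k) = (if k \<in> P1 then rho (GX k) * rho (GY k) else sc (inverse (q k - 1)) * (t (- zi k) - 1))"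
    and "s (GY k) * s (GX k) = (if k \<in> P1 then rho (GY k) * rho (GX k) else sc (inverse (q k - 1)) * (sc (inverse (q k)) * t (- zi k) - 1))"
proof -
  have q: "q k \<noteq> 0" by (rule q_nz[OF k])
  have XY: "s (GX k) * s (GY k) = sc (\<alpha> k * \<beta> k * q k powi (sg k * ey k k)) * (tz (ex k + ey k) * (xy_gen k (sg k) * xy_gen k (- sg k)))"
    unfolding s_X[OF k] s_Y[OF k] by (rule tz_uu_mult[OF k sg_cases])
  have YX: "s (GY k) * s (GX k) = sc (\<beta> k * \<alpha> k * q k powi (- sg k * ex k k)) * (tz (ey k + ex k) * (xy_gen k (- sg k) * xy_gen k (sg k)))"
    unfolding s_X[OF k] s_Y[OF k] by (rule tz_uu_mult[OF k]) (use sg_cases[of k] in auto)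
  have "(s (GX k) * s (GY k) = (if k \<in> P1 then rho (GX k) * rho (GY k) else sc (inverse (q k - 1)) * (t (- zi k) - 1))) \<and>
    (s (GY k) * s (GX k) = (if k \<in> P1 then rho (GY k) * rho (GX k) else sc (inverse (q k - 1)) * (sc (inverse (q k)) * t (- zi k) - 1)))"
  proof (cases "k \<in> P1")
    case True
    then have "k \<notin> P2" using P(2) by auto
    then have ek: "ex k k = c k" "ey k k = - c k" using True by (simp_all add: ex_def ey_def unit_vec_def)
    have e0: "ex k + ey k = 0" "ey k + ex k = 0" using True by (auto simp: ey_def fun_eq_iff fun_apply)
    have c: "\<alpha> k * \<beta> k * q k powi (- c k) = 1" using ab1[OF True] q by (simp add: power_int_minus)
    show ?thesis unfolding XY YX e0 zexp_0 using True c
      by (simp add: ek sg_def xy_gen_def mult.commute[of "\<beta> k"] del: rho.simps)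
  next
    case False
    then have P2: "k \<in> P2" using in_P2_iff[OF k] by simp
    have ek: "ex k k = c k" "ey k k = - c k - 1" using False by (simp_all add: ex_def ey_def unit_vec_def)
    have "ex k + ey k = unit_vec k (-1)" "ey k + ex k = unit_vec k (-1)"
      using False by (auto simp: ey_def unit_vec_def fun_eq_iff fun_apply)
    then have e0: "zexp (ex k + ey k) = - zi k" "zexp (ey k + ex k) = - zi k" by (simp_all only: zexp_un(2)[OF k])
    have c1: "\<alpha> k * \<beta> k * q k powi (- (- c k - 1)) = -1"
      using ab2[OF P2] q by (simp add: power_int_minus power_int_add power_int_diff field_simps)
    have c2: "\<alpha> k * \<beta> k * q k powi (c k) = - inverse (q k)"
      using ab2[OF P2] q by (simp add: power_int_minus power_int_diff field_simps)
    have c3: "inverse (q k) * (q k * inverse (q k - 1)) = inverse (q k - 1)"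
      using q by (simp flip: mult.assoc)
    have tt: "t (- zi k) * t (zi k) = 1" by (simp add: t_mult tw_minus_left)
    have "s (GX k) * s (GY k) = sc (-1) * (t (- zi k) * (rho (GY k) * rho (GX k)))"
      unfolding XY e0 using False c1 by (simp add: ek sg_def xy_gen_def del: rho.simps)
    also have "\<dots> = sc (inverse (q k - 1)) * (t (- zi k) - 1)"
      unfolding rho_YX[OF k] by (simp add: t_sc t_sc' right_diff_distrib tt sc_minus)
    finally have 1: "s (GX k) * s (GY k) = sc (inverse (q k - 1)) * (t (- zi k) - 1)" .
    have "s (GY k) * s (GX k) = sc (- inverse (q k)) * (t (- zi k) * (rho (GX k) * rho (GY k)))"
      unfolding YX e0 using False c2 by (simp add: ek sg_def xy_gen_def mult.commute[of "\<beta> k"] del: rho.simps)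
    also have "\<dots> = sc (inverse (q k - 1)) * (sc (inverse (q k)) * t (- zi k) - 1)"
      unfolding rho_XY[OF k] by (simp add: c3 t_sc t_sc' right_diff_distrib tt sc_minus sc_mult' sc_mult mult.commute)
    finally show ?thesis using 1 False by simp
  qed
  then show "s (GX k) * s (GY k) = (if k \<in> P1 then rho (GX k) * rho (GY k) else sc (inverse (q k - 1)) * (t (- zi k) - 1))"
    "s (GY k) * s (GX k) = (if k \<in> P1 then rho (GY k) * rho (GX k) else sc (inverse (q k - 1)) * (sc (inverse (q k)) * t (- zi k) - 1))"
    by auto
qed

lemma sc_inv_minus_1: "k \<in> {1..n} \<Longrightarrow> sc (inverse (q k - 1)) * (sc (q k - 1) * L) = L"
  using q_ne_1[of k] by (intro sc_inverse) simp

lemma s_Z: assumes k: "k \<in> {1..n}"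
  shows "s (GX k) * s (GY k) - s (GY k) * s (GX k) = (if k \<in> P1 then t (zi k) else sc (inverse (q k)) * t (- zi k))"
proof (cases "k \<in> P1")
  case True then show ?thesis using s_products[OF k] rho_Z[OF k] by simp
next
  case False
  have "s (GX k) * s (GY k) - s (GY k) * s (GX k) = sc (inverse (q k - 1)) * (t (- zi k) - sc (inverse (q k)) * t (- zi k))"
    using s_products[OF k] False by (simp add: right_diff_distrib)
  also have "t (- zi k) - sc (inverse (q k)) * t (- zi k) = sc (1 - inverse (q k)) * t (- zi k)"
    by (simp add: sc_diff left_diff_distrib)
  also have "1 - inverse (q k) = (q k - 1) * inverse (q k)" using q_nz[OF k] by (simp add: field_simps)
  finally show ?thesis using False sc_inv_minus_1[OF k] by (simp flip: sc_mult' )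
qed

lemma s_rels: "r \<in> fa_rels n q lam \<Longrightarrow> ev s r = 0"
proof (erule ev_relsI[rotated -1])
  fix i j assume ij: "i \<in> {1..n}" "j \<in> {1..n}" "i < j"
  show "s (GX i) * s (GX j) = sc (lam i j) * (s (GX j) * s (GX i))"
    unfolding s_X[OF ij(1)] s_X[OF ij(2)] using ij cross[OF ij(1,2)] sg_cases by (intro xy_gen_qcomm) auto
  have "q j powi (sg j * ex i j) * lam j i powi (sg j * sg i) = lam j i * q i powi (sg i * ex j i)"
    using cross[OF ij(2,1)] ij by simp
  then show "s (GY j) * s (GY i) = sc (lam j i) * (s (GY i) * s (GY j))"
    unfolding s_Y[OF ij(1)] s_Y[OF ij(2)] using ij sg_cases[of i] sg_cases[of j]
    by (intro xy_gen_qcomm) (auto simp: ey_other)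
next
  fix i j assume ij: "i \<in> {1..n}" "j \<in> {1..n}" "i \<noteq> j"
  have l: "lam i j \<noteq> 0" "lam j i = inverse (lam i j)" "q i \<noteq> 0" "q j \<noteq> 0"
    using ij by (simp_all only: lam_nz lam_inv[of i j] q_nz not_False_eq_True)
  have "q i powi (sg i * ey j i) * lam i j powi (sg i * (- sg j)) = lam j i * q j powi (- sg j * ex i j)"
    using arg_cong[OF cross[OF ij], of inverse] ij l by (simp add: ey_other power_int_minus)
  then show "s (GX i) * s (GY j) = sc (lam j i) * (s (GY j) * s (GX i))"
    unfolding s_X[OF ij(1)] s_Y[OF ij(2)] using ij sg_cases[of i] sg_cases[of j]
    by (intro xy_gen_qcomm) auto
next
  fix k assume k: "k \<in> {1..n}"
  have rel: "rho (GX k) * rho (GY k) - sc (q k) * (rho (GY k) * rho (GX k)) = 1"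
    using rho_ideal[OF rel_XY[OF k]] k
    by (simp add: ev_diff[of n] ev_smult[of n] ev_mult[of n] ev_gen ev_one fa_valid_gen fa_valid_mult fa_valid_diff fa_valid_smult fa_valid_one del: rho.simps)
  show "s (GX k) * s (GY k) - sc (q k) * (s (GY k) * s (GX k)) = 1"
  proof (cases "k \<in> P1")
    case True then show ?thesis using s_products[OF k] rel by simp
  next
    case False
    have c: "q k * (inverse (q k) * inverse (q k - 1)) = inverse (q k - 1)"
      "(q k - 1) * inverse (q k - 1) = q k * inverse (q k - 1) - inverse (q k - 1)"
      using q_nz[OF k] by (simp flip: mult.assoc, simp add: left_diff_distrib)
    have "s (GX k) * s (GY k) - sc (q k) * (s (GY k) * s (GX k)) = sc (inverse (q k - 1)) * (sc (q k - 1) * 1)"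
      using s_products[OF k] False
      by (simp add: right_diff_distrib sc_mult' sc_mult mult.commute mult.left_commute c sc_diff)
    then show ?thesis unfolding sc_inv_minus_1[OF k] .
  qed
  show "s (GW k) * (s (GX k) * s (GY k) - s (GY k) * s (GX k)) = 1"
    "(s (GX k) * s (GY k) - s (GY k) * s (GX k)) * s (GW k) = 1"
    unfolding s_Z[OF k] s_W[OF k] using q_nz[OF k]
    by (simp_all add: t_mult tw_minus_left sc_mult_sc)
qed

lemma z_diag_s: "z_diag s (\<lambda>k. if k \<in> P1 then 1 else inverse (q k)) sg"
  unfolding z_diag_def
proof (intro ballI conjI)
  fix k assume k: "k \<in> {1..n}"
  show "(if k \<in> P1 then 1 else inverse (q k)) \<noteq> 0" using q_nz[OF k] by simp
  show "ev s (Z k) = sc (if k \<in> P1 then 1 else inverse (q k)) * tz (unit_vec k (sg k))"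
    using s_Z[OF k] ev_Z[OF k, of s] k by (simp add: sg_def zexp_un)
  show "s (GW k) = sc (inverse (if k \<in> P1 then 1 else inverse (q k))) * tz (unit_vec k (- sg k))"
    using s_W[OF k] k by (simp add: sg_def zexp_un)
qed

lemma ev_s_zpow: "k \<in> {1..n} \<Longrightarrow> ev s (zpow k m) = (if k \<in> P1 then tz (unit_vec k m) else sc (q k powi (- m)) * tz (unit_vec k (- m)))"
  by (simp add: ev_zpow_diag[OF z_diag_s] sg_def power_int_inverse power_int_minus)

lemma ev_s_zprod1: "ev s (zprod P1 e) = tz (\<lambda>j. if j \<in> P1 then e j else 0)"
proof -
  have "(\<lambda>j. if j \<in> P1 then sg j * e j else 0) = (\<lambda>j. if j \<in> P1 then e j else 0)" by (auto simp: sg_def)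
  then show ?thesis by (simp add: ev_zprod_diag[OF z_diag_s P(3)])
qed

lemma ev_s_zprod2: "ev s (zprod P2 e) = sc (\<Prod>j\<in>P2. q j powi (- e j)) * tz (\<lambda>j. if j \<in> P2 then - e j else 0)"
proof -
  have "(\<lambda>j. if j \<in> P2 then sg j * e j else 0) = (\<lambda>j. if j \<in> P2 then - e j else 0)" using P(2) by (auto simp: sg_def fun_eq_iff)
  moreover have "(\<Prod>j\<in>P2. (if j \<in> P1 then 1 else inverse (q j)) powi e j) = (\<Prod>j\<in>P2. q j powi (- e j))"
    using P(2) by (intro prod.cong refl) (auto simp: power_int_inverse power_int_minus)
  ultimately show ?thesis by (simp add: ev_zprod_diag[OF z_diag_s P(4)])
qed

lemma auto_shape_subst: "auto_shape n q lam (subst S) P1 P2 c a b \<alpha> \<beta>"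
proof -
  have "fa_cong n q lam f f" for f :: "'k fa" by (simp add: cong_iff I_zero)
  moreover have "j \<notin> P1" if "j \<in> P2" for j using that P(2) by blast
  ultimately show ?thesis by (auto simp: auto_shape_def subst_gen)
qed

end

text \<open>The substitution fixes z_j for j in P1 and maps z_j to q_j^(-1) z_j^(-1) for j in P2; this is
  where the scalars in the parameters of the inverse come from.\<close>

locale shape_pair = shape n q lam P1 P2 c a b \<alpha> \<beta> + inv: shape n q lam P1 P2 c' a b \<alpha>' \<beta>'
  for n and q :: "nat \<Rightarrow> 'k::field" and lam P1 P2 c a b \<alpha> \<beta> c' \<alpha>' \<beta>' +
  assumes inv1: "k \<in> P1 \<Longrightarrow> c' k = - c k \<and> \<alpha>' k * \<alpha> k = (\<Prod>j\<in>P2. q j powi a k j) \<and> \<beta>' k * \<beta> k = (\<Prod>j\<in>P2. q j powi (- a k j))"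
    and inv2: "k \<in> P2 \<Longrightarrow> c' k = - c k - 1 \<and> \<beta>' k * \<alpha> k = q k powi c k \<and> \<alpha>' k * \<beta> k = q k powi (- c k - 1)"
begin

lemma tz_collapse:
  assumes "A * C * E * F = 1" "\<And>j. j \<in> {1..n} \<Longrightarrow> u j + v j + w j = 0"
  shows "sc A * ((sc C * tz u) * (sc E * tz v) * (sc F * (tz w * x))) = x"
proof -
  have "zexp (u + v + w) = 0" using zexp_cong[of "u + v + w" 0] assms(2) zexp_0 by (simp add: fun_apply)
  then have "tz u * (tz v * (tz w * x)) = x"
    by (metis mult.assoc mult_1 t_0 tz_mult)
  moreover have "sc A * ((sc C * tz u) * (sc E * tz v) * (sc F * (tz w * x))) = sc (A * C * E * F) * (tz u * (tz v * (tz w * x)))"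
    by (simp add: sc_mult_sc sc_mult' t_sc' mult.assoc)
  ultimately show ?thesis using assms(1) by simp
qed

lemma prod_P2: "(\<Prod>j\<in>P2. q j powi (- m j)) = inverse (\<Prod>j\<in>P2. q j powi m j)" "(\<Prod>j\<in>P2. q j powi m j) \<noteq> 0"
proof -
  have "finite P2" using P(4) finite_subset by blast
  then show "(\<Prod>j\<in>P2. q j powi m j) \<noteq> 0" using P(4) q_nz by auto
  show "(\<Prod>j\<in>P2. q j powi (- m j)) = inverse (\<Prod>j\<in>P2. q j powi m j)"
    by (simp add: power_int_minus prod_inversef[symmetric] o_def)
qed

text \<open>Read as: substituting S into \<open>inv.S g\<close> gives back g. For x_k and y_k the
  three Laurent monomials cancel and the scalars multiply to 1, which is what the conditions on c',
  \<alpha>' and \<beta>' say.\<close>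

lemma compose:
  assumes g: "gen_idx g \<in> {1..n}" shows "ev s (inv.S g) = rho g"
proof (cases g)
  case (GX k)
  then have k: "k \<in> {1..n}" using g by simp
  show ?thesis
  proof (cases "k \<in> P1")
    case True
    then have k2: "k \<notin> P2" using P(2) by auto
    have "ev s (inv.S g) = sc (\<alpha>' k) * ((sc (\<Prod>j\<in>P2. q j powi (- a k j)) * tz (\<lambda>j. if j \<in> P2 then - a k j else 0)) *
       (sc 1 * tz (unit_vec k (c' k))) * (sc (\<alpha> k) * (tz (ex k) * rho (GX k))))"
      using True k GX ev_monomial[OF P(4) k, of "GX k"]
      by (simp add: ev_s_zprod2 ev_s_zpow s_X sg_def xy_gen_def del: rho.simps)
    also have "\<dots> = rho (GX k)"
    proof (rule tz_collapse)
      show "\<alpha>' k * (\<Prod>j\<in>P2. q j powi (- a k j)) * 1 * \<alpha> k = 1"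
        using inv1[OF True] prod_P2(2)[of "a k"] by (simp add: prod_P2(1) field_simps)
    qed (use True k2 inv1[OF True] in \<open>auto simp: ex_def unit_vec_def\<close>)
    finally show ?thesis using GX by simp
  next
    case False
    then have k2: "k \<in> P2" using in_P2_iff[OF k] by simp
    have "ev s (inv.S g) = sc (\<alpha>' k) * ((sc 1 * tz (\<lambda>j. if j \<in> P1 then b k j else 0)) *
       (sc (q k powi (- c' k)) * tz (unit_vec k (- c' k))) * (sc (\<beta> k) * (tz (ey k) * rho (GX k))))"
      using False k GX ev_monomial[OF P(3) k, of "GY k"]
      by (simp add: ev_s_zprod1 ev_s_zpow s_Y sg_def xy_gen_def del: rho.simps)
    also have "\<dots> = rho (GX k)"
    proof (rule tz_collapse)
      have "\<alpha>' k * 1 * q k powi (- c' k) * \<beta> k = (\<alpha>' k * \<beta> k) * q k powi (- c' k)" by simp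
      also have "\<dots> = q k powi (- c k - 1) * q k powi (c k + 1)" using inv2[OF k2] by (simp add: add.commute)
      also have "\<dots> = 1" using q_nz[OF k] by (simp flip: power_int_add)
      finally show "\<alpha>' k * 1 * q k powi (- c' k) * \<beta> k = 1" .
    qed (use False k2 inv2[OF k2] in \<open>auto simp: ex_def ey_def unit_vec_def\<close>)
    finally show ?thesis using GX by simp
  qed
next
  case (GY k)
  then have k: "k \<in> {1..n}" using g by simp
  show ?thesis
  proof (cases "k \<in> P1")
    case True
    then have k2: "k \<notin> P2" using P(2) by auto
    have "ev s (inv.S g) = sc (\<beta>' k) * ((sc (\<Prod>j\<in>P2. q j powi (a k j)) * tz (\<lambda>j. if j \<in> P2 then a k j else 0)) *
       (sc 1 * tz (unit_vec k (- c' k))) * (sc (\<beta> k) * (tz (ey k) * rho (GY k))))"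
      using True k GY ev_monomial[OF P(4) k, of "GY k"]
      by (simp add: ev_s_zprod2 ev_s_zpow s_Y sg_def xy_gen_def del: rho.simps cong: if_cong)
    also have "\<dots> = rho (GY k)"
    proof (rule tz_collapse)
      show "\<beta>' k * (\<Prod>j\<in>P2. q j powi (a k j)) * 1 * \<beta> k = 1"
        using inv1[OF True] prod_P2(2)[of "a k"] by (simp add: prod_P2(1) field_simps)
    qed (use True k2 inv1[OF True] in \<open>auto simp: ex_def ey_def unit_vec_def\<close>)
    finally show ?thesis using GY by simp
  next
    case False
    then have k2: "k \<in> P2" using in_P2_iff[OF k] by simp
    have "ev s (inv.S g) = sc (\<beta>' k) * ((sc 1 * tz (\<lambda>j. if j \<in> P1 then - b k j else 0)) *
       (sc (q k powi (- (- c' k - 1))) * tz (unit_vec k (- (- c' k - 1)))) * (sc (\<alpha> k) * (tz (ex k) * rho (GY k))))"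
      using False k GY ev_monomial[OF P(3) k, of "GX k"]
      by (simp add: ev_s_zprod1 ev_s_zpow s_X sg_def xy_gen_def del: rho.simps)
    also have "\<dots> = rho (GY k)"
    proof (rule tz_collapse)
      have "\<beta>' k * 1 * q k powi (- (- c' k - 1)) * \<alpha> k = (\<beta>' k * \<alpha> k) * q k powi (- (- c' k - 1))" by simp
      also have "\<dots> = q k powi (c k) * q k powi (- c k)" using inv2[OF k2] by simp
      also have "\<dots> = 1" using q_nz[OF k] by (simp flip: power_int_add)
      finally show "\<beta>' k * 1 * q k powi (- (- c' k - 1)) * \<alpha> k = 1" .
    qed (use False k2 inv2[OF k2] in \<open>auto simp: ex_def unit_vec_def\<close>)
    finally show ?thesis using GY by simp
  qed
next
  case (GW k)
  then have k: "k \<in> {1..n}" using g by simp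
  have "ev s (q k \<odot> Z k) = sc (q k) * ev s (Z k)" by (rule ev_smult[OF fa_valid_Z[OF k]])
  then show ?thesis using GW k s_W[OF k] s_Z[OF k] ev_Z[OF k, of s] q_nz[OF k] by (simp add: ev_gen sc_mult')
qed

lemma ev_s_subst: assumes "fa_valid n f" shows "ev s (subst inv.S f) = ev rho f"
proof -
  have "ev s (subst inv.S f) = ev (\<lambda>g. ev s (inv.S g)) f" by (rule ev_subst[OF inv.S_valid assms])
  also have "\<dots> = ev rho f" by (rule ev_cong[OF compose assms])
  finally show ?thesis .
qed

end

section \<open>Bijectivity of the homomorphism\<close>

context shape
begin

text \<open>The inverse has the same blocks and the same a and b. Two interpretations of
  \<open>shape_pair\<close>, with the roles exchanged, give surjectivity and injectivity.\<close>

theorem subst_is_auto: "is_AZ_auto n q lam (subst S)"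
proof -
  \<comment> \<open>Obtained by solving \<open>compose\<close> for the unknown parameters. The
    products over P2 undo the scalars q_j^(-1) that the z_j acquire; on P2 one more -1 enters the
    exponent because the image of y_k carries z_k^(-c_k - 1).\<close>
  define c' where "c' k = (if k \<in> P1 then - c k else - c k - 1)" for k
  define \<alpha>' where "\<alpha>' k = (if k \<in> P1 then inverse (\<alpha> k) * (\<Prod>j\<in>P2. q j powi a k j) else inverse (\<beta> k) * q k powi (- c k - 1))" for k
  define \<beta>' where "\<beta>' k = (if k \<in> P1 then inverse (\<beta> k) * (\<Prod>j\<in>P2. q j powi (- a k j)) else inverse (\<alpha> k) * q k powi (c k))" for k
  have fin: "finite P2" using P(4) finite_subset by blast
  have qn: "(\<Prod>j\<in>P2. q j powi m j) \<noteq> 0" for m using fin P(4) q_nz by auto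
  have qm: "(\<Prod>j\<in>P2. q j powi (- m j)) = inverse (\<Prod>j\<in>P2. q j powi m j)" for m
    by (simp add: power_int_minus prod_inversef[symmetric] o_def)
  have in1: "k \<in> {1..n}" "k \<notin> P2" if "k \<in> P1" for k using that P by auto
  have in2: "k \<in> {1..n}" "k \<notin> P1" if "k \<in> P2" for k using that P by auto
  have "shape_params n q lam P1 P2 c' a b \<alpha>' \<beta>'"
    unfolding shape_params_def
  proof (intro conjI ballI)
    show "\<alpha>' k \<noteq> 0" "\<beta>' k \<noteq> 0" if "k \<in> {1..n}" for k
      using nz[OF that] qn q_nz[OF that] by (auto simp: \<alpha>'_def \<beta>'_def)
    show "\<alpha>' k * \<beta>' k = q k powi c' k" if "k \<in> P1" for k
    proof -
      have "\<alpha>' k * \<beta>' k = inverse (\<alpha> k * \<beta> k)"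
        using that qn[of "a k"] by (simp add: \<alpha>'_def \<beta>'_def qm)
      then show ?thesis using that ab1[OF that] by (simp add: c'_def power_int_minus)
    qed
    show "\<alpha>' k * \<beta>' k = - (q k powi (- c' k - 1))" if k: "k \<in> P2" for k
    proof -
      have "\<alpha>' k * \<beta>' k = inverse (\<alpha> k * \<beta> k) * (q k powi (- c k - 1) * q k powi c k)"
        using in2[OF k] by (simp add: \<alpha>'_def \<beta>'_def)
      also have "\<dots> = - (q k powi c k)" unfolding ab2[OF k]
        using q_nz[OF in2(1)[OF k]] by simp
      finally show ?thesis using in2[OF k] by (simp add: c'_def)
    qed
  qed (use P qlam in auto)
  then interpret inv: shape n q lam P1 P2 c' a b \<alpha>' \<beta>' by unfold_locales
  interpret fwd: shape_pair n q lam P1 P2 c a b \<alpha> \<beta> c' \<alpha>' \<beta>'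
    using nz in1 in2 by unfold_locales (auto simp: c'_def \<alpha>'_def \<beta>'_def)
  interpret bwd: shape_pair n q lam P1 P2 c' a b \<alpha>' \<beta>' c \<alpha> \<beta>
    using nz in1 in2 by unfold_locales (auto simp: c'_def \<alpha>'_def \<beta>'_def mult.commute)
  have val: "fa_valid n (subst S f)" if "fa_valid n f" for f by (rule subst_valid[OF S_valid that])
  have ev: "ev rho (subst S f) = ev s f" if "fa_valid n f" for f
    unfolding s_def[abs_def] by (rule ev_subst[OF S_valid that])
  have s_I: "ev s u = ev s v" if "fa_valid n u" "fa_valid n v" "fa_cong n q lam u v" for u v
  proof -
    have "ev s (u - v) = 0" by (rule ev_ideal[OF s_rels]) (use that in \<open>auto simp: cong_iff\<close>)
    then show ?thesis using ev_diff[OF that(1,2), of s] by simp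
  qed
  have cong: "fa_cong n q lam u v" if "fa_valid n u" "fa_valid n v" "ev rho u = ev rho v" for u v
    using rho_cong[OF that(1,2)] that(3) by simp
  show ?thesis unfolding is_AZ_auto_def fa_add_eq
  proof (intro conjI allI impI; (elim conjE)?)
    fix u v :: "'k fa" and k :: 'k
    show "fa_valid n u \<Longrightarrow> fa_valid n (subst S u)" by (rule val)
    show "fa_cong n q lam (subst S fa_one) fa_one"
      by (rule cong) (auto simp: ev val fa_valid_one ev_one)
    show "fa_cong n q lam (subst S (k \<odot> u)) (k \<odot> subst S u)" if u: "fa_valid n u"
      by (rule cong) (use u in \<open>auto simp: ev val fa_valid_smult ev_smult[of n]\<close>)
    show "\<exists>w. fa_valid n w \<and> fa_cong n q lam (subst S w) u" if u: "fa_valid n u"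
    proof (intro exI conjI)
      show w: "fa_valid n (subst inv.S u)" by (rule subst_valid[OF inv.S_valid u])
      show "fa_cong n q lam (subst S (subst inv.S u)) u"
        by (rule cong[OF val[OF w] u]) (simp add: ev[OF w] fwd.ev_s_subst[OF u])
    qed
    assume u: "fa_valid n u" and v: "fa_valid n v"
    show "fa_cong n q lam (subst S (u + v)) (subst S u + subst S v)"
      by (rule cong) (use u v in \<open>auto simp: ev val fa_valid_add ev_add[of n]\<close>)
    show "fa_cong n q lam (subst S (u \<star> v)) (subst S u \<star> subst S v)"
      by (rule cong) (use u v in \<open>auto simp: ev val fa_valid_mult ev_mult[of n]\<close>)
    show "fa_cong n q lam (subst S u) (subst S v)" if "fa_cong n q lam u v"
      by (rule cong) (use u v s_I[OF u v that] in \<open>auto simp: ev val\<close>)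
    show "fa_cong n q lam u v" if "fa_cong n q lam (subst S u) (subst S v)"
    proof (rule cong[OF u v])
      \<comment> \<open>Evaluation along the inverse parameters undoes the substitution.\<close>
      have "ev inv.s (subst S u - subst S v) = 0"
        by (rule ev_ideal[OF inv.s_rels]) (use that in \<open>auto simp: cong_iff\<close>)
      then have "ev inv.s (subst S u) = ev inv.s (subst S v)"
        using ev_diff[OF val[OF u] val[OF v], of inv.s] by simp
      then show "ev rho u = ev rho v" by (simp add: bwd.ev_s_subst u v)
    qed
  qed
qed

end

theorem theorem3p2:
  fixes n :: nat and q :: "nat \<Rightarrow> 'k::field" and lam :: "nat \<Rightarrow> nat \<Rightarrow> 'k"
  assumes "n \<ge> 1"
    and "\<forall>i\<in>{1..n}. q i \<noteq> 0"
    and "\<forall>i\<in>{1..n}. \<forall>j\<in>{1..n}. lam i j \<noteq> 0 \<and> lam i j = inverse (lam j i)"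
    and "\<forall>i\<in>{1..n}. lam i i = 1"
    and "\<forall>e :: nat \<Rightarrow> int. (\<Prod>k\<in>{1..n}. q k powi e k) = 1 \<longrightarrow> (\<forall>k\<in>{1..n}. e k = 0)"
  shows "(\<forall>\<phi>. is_AZ_auto n q lam \<phi> \<longrightarrow>
            (\<exists>P1 P2 c a b \<alpha> \<beta>. shape_params n q lam P1 P2 c a b \<alpha> \<beta> \<and>
                                  auto_shape n q lam \<phi> P1 P2 c a b \<alpha> \<beta>))
       \<and> (\<forall>P1 P2 c a b \<alpha> \<beta>. shape_params n q lam P1 P2 c a b \<alpha> \<beta> \<longrightarrow>
            (\<exists>\<phi>. is_AZ_auto n q lam \<phi> \<and> auto_shape n q lam \<phi> P1 P2 c a b \<alpha> \<beta>))"
proof -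
  interpret qweyl n q lam
    by unfold_locales (use assms in \<open>blast+\<close>)
  show ?thesis
  proof (intro conjI allI impI)
    fix \<phi> assume "is_AZ_auto n q lam \<phi>"
    then show "\<exists>P1 P2 c a b \<alpha> \<beta>. shape_params n q lam P1 P2 c a b \<alpha> \<beta> \<and> auto_shape n q lam \<phi> P1 P2 c a b \<alpha> \<beta>"
      by (rule auto_has_shape)
  next
    fix P1 P2 c a b \<alpha> \<beta> assume "shape_params n q lam P1 P2 c a b \<alpha> \<beta>"
    then interpret shape n q lam P1 P2 c a b \<alpha> \<beta> by unfold_locales
    show "\<exists>\<phi>. is_AZ_auto n q lam \<phi> \<and> auto_shape n q lam \<phi> P1 P2 c a b \<alpha> \<beta>"
      using subst_is_auto auto_shape_subst by blast
  qed
qed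

end
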